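(* Let $Q$ be a cluster quiver (possibly with oriented cycles) with vertex set $Q_0$ and exchange matrix $B=(b_{ij})$, and let $k>1$ be an integer. Suppose $Q_0=\tilde Q_0\sqcup\breve Q_0$ is a partition such that $k\mid b_{ij}$ and $k\mid b_{ji}$ for all $i\in\tilde Q_0$, $j\in\breve Q_0$. Let $\tilde Q$ and $\breve Q$ be the full subquivers of $Q$ on $\tilde Q_0$ and $\breve Q_0$, and let $\tilde Q\cup\breve Q$ be their disjoint union (the quiver on $Q_0$ obtained from $Q$ by deleting all arrows between $\tilde Q_0$ and $\breve Q_0$). Then every maximal green sequence of $Q$ is a maximal green sequence of $\tilde Q\cup\breve Q$, in the sense that there is a maximal green sequence of $\tilde Q\cup\breve Q$ starting from the same $C$-matrix and mutating on the same sequence of $c$-vectors.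
   Context: A cluster quiver is a finite quiver without loops or oriented 2-cycles; multiple arrows are allowed. Its exchange matrix has $b_{ij}$ = (number of arrows $i\to j$) $-$ (number of arrows $j\to i$). Mutation at $k$: add an arrow $i\to j$ for each pair $i\to k\to j$, reverse arrows at $k$, delete created 2-cycles. The framed quiver adds a frozen vertex $i'$ and an arrow $i\to i'$ for each vertex $i$. A non-frozen vertex is green if no arrow from a frozen vertex points to it; a maximal green sequence is a sequence of mutations at green vertices after which no green vertex remains. The $C$-matrix of a mutated framed quiver has $(i,j)$ entry (number of arrows $i'\to j$) $-$ (number of arrows $j\to i'$); its columns are $c$-vectors. *)

theory Defs
  imports Main
begin

text \<open>Quivers on the vertex set {0..<N} are encoded by their (signed) arrow-count
  matrix M, where M i j = (number of arrows i->j) - (number of arrows j->i).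
  For a cluster quiver (no loops, no oriented 2-cycles) this determines the quiver.
  A cluster quiver Q on {0..<n} is given by its exchange matrix B.\<close>

definition cluster_quiver :: "nat \<Rightarrow> (nat \<Rightarrow> nat \<Rightarrow> int) \<Rightarrow> bool" where
  "cluster_quiver n B \<longleftrightarrow> (\<forall>i<n. \<forall>j<n. B i j = - B j i)"

text \<open>Framed quiver: vertices 0..<n are the mutable vertices, vertex n+i is the
  frozen vertex i', with one arrow i -> i'.\<close>

definition framed :: "nat \<Rightarrow> (nat \<Rightarrow> nat \<Rightarrow> int) \<Rightarrow> nat \<Rightarrow> nat \<Rightarrow> int" where
  "framed n B i j =
     (if i < n \<and> j < n then B i j
      else if i < n \<and> j = n + i then 1
      else if j < n \<and> i = n + j then -1
      else 0)"

text \<open>Quiver mutation at k (add i->j for each path i->k->j, reverse arrows at k,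
  cancel 2-cycles), on the signed arrow-count matrix.\<close>

definition mut :: "nat \<Rightarrow> (nat \<Rightarrow> nat \<Rightarrow> int) \<Rightarrow> nat \<Rightarrow> nat \<Rightarrow> int" where
  "mut k M i j =
     (if i = k \<or> j = k then - M i j
      else M i j + max (M i k) 0 * max (M k j) 0 - max (- M i k) 0 * max (- M k j) 0)"

fun mutseq :: "nat list \<Rightarrow> (nat \<Rightarrow> nat \<Rightarrow> int) \<Rightarrow> nat \<Rightarrow> nat \<Rightarrow> int" where
  "mutseq [] M = M"
| "mutseq (k # ks) M = mutseq ks (mut k M)"

text \<open>C-matrix of a (mutated) framed quiver: entry (i,j) is
  (#arrows i'->j) - (#arrows j->i'); column j is the c-vector at j.\<close>

definition cmat :: "nat \<Rightarrow> (nat \<Rightarrow> nat \<Rightarrow> int) \<Rightarrow> nat \<Rightarrow> nat \<Rightarrow> int" where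
  "cmat n M i j = M (n + i) j"

definition green :: "nat \<Rightarrow> (nat \<Rightarrow> nat \<Rightarrow> int) \<Rightarrow> nat \<Rightarrow> bool" where
  "green n M j \<longleftrightarrow> j < n \<and> (\<forall>i<n. M (n + i) j \<le> 0)"

definition max_green_seq :: "nat \<Rightarrow> (nat \<Rightarrow> nat \<Rightarrow> int) \<Rightarrow> nat list \<Rightarrow> bool" where
  "max_green_seq n B ks \<longleftrightarrow>
     (\<forall>t < length ks. green n (mutseq (take t ks) (framed n B)) (ks ! t))
     \<and> (\<forall>j<n. \<not> green n (mutseq ks (framed n B)) j)"

definition split_quiver :: "nat set \<Rightarrow> (nat \<Rightarrow> nat \<Rightarrow> int) \<Rightarrow> nat \<Rightarrow> nat \<Rightarrow> int" where
  "split_quiver Qt B i j = (if (i \<in> Qt) = (j \<in> Qt) then B i j else 0)"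

end

theory Submission
  imports Defs "HOL-Library.Function_Algebras" "HOL-Computational_Algebra.Formal_Power_Series"
begin

text \<open>
  Write \<open>c\<^sub>j\<close> for the \<open>c\<close>-vectors and \<open>w\<close> for the skew form given by the exchange matrix, so that the
  mutated exchange matrix is \<open>w c\<^sub>i c\<^sub>j\<close>. The same sequence of vertices works for the split quiver as soon
  as no vector of one part is ever added to a vector of the other part, i.e. \<open>w c\<^sub>j c\<^sub>k \<le> 0\<close> whenever
  \<open>k\<close> is mutated and \<open>j\<close> lies in the other part.

  To see this, attach to every seed its Donaldson--Thomas series in the twisted group algebra of the
  lattice (at \<open>q = 2\<close>), characterised by attractor conditions as for consistent scattering diagrams.
  Mutating at \<open>k\<close> moves one quantum dilogarithm: the series \<open>E(c\<^sub>k) h\<close> becomes \<open>h E(-c\<^sub>k)\<close>, where \<open>h\<close> is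
  supported in the cones of both seeds. Hence along a green sequence the series factors as \<open>p r\<close> with
  \<open>p\<close> supported on nonnegative and \<open>r\<close> on nonpositive vectors, which gives sign coherence, and at the
  end of a maximal green sequence \<open>p\<close> is the product of the remaining dilogarithms.
  If \<open>m = w c\<^sub>j c\<^sub>k > 0\<close> with \<open>k\<close> mutated and \<open>j\<close> in the other part, then \<open>m \<ge> 2\<close> by divisibility.
  For red \<open>j\<close> the new vector \<open>c\<^sub>j + m c\<^sub>k\<close> is not sign coherent; for green \<open>j\<close> comparing coefficients of
  \<open>p\<close> at \<open>c\<^sub>j + c\<^sub>k\<close> shows that \<open>(2\<^sup>m - 2\<^sup>-\<^sup>m) / (2 - 1/2)\<close> is an integer, which fails for \<open>m \<ge> 2\<close>.
\<close>

section \<open>Twisted convolution\<close>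

text \<open>The deformation is essential: the multiplicity behind the contradiction is the quantum
  integer of \<open>m\<close>, which at \<open>q = 1\<close> would be the honest integer
  \<open>m\<close>. The value \<open>q = 2\<close> keeps all coefficients rational, makes those of
  the dilogarithm positive, and turns non-integrality into a congruence modulo 4. Attractor
  conditions are chosen as the characterisation because they survive mutation. The condition at
  \<open>v\<close> concerns only the middle factor in a factorisation by the sign of
  \<open>w u v\<close>. A dilogarithm removed on the left or attached on the right is absorbed by an
  outer factor whenever \<open>w e v\<close> has the matching sign, with a conjugation in the
  orthogonal case; the remaining vectors are reached through a conjugate series and a shear of the
  lattice. The obstacle is that neighbouring seeds have different cones, and \<open>c k\<close> and
  \<open>- c k\<close> cannot lie in a common pointed one. The two series can therefore be compared
  only after \<open>h\<close> has been confined to the intersection of the cones.\<close>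

definition pcone :: "'v::ab_group_add set \<Rightarrow> bool" where
  "pcone K \<longleftrightarrow> 0 \<in> K \<and> (\<forall>a\<in>K. \<forall>b\<in>K. a + b \<in> K) \<and> (\<forall>v. finite {a\<in>K. v - a \<in> K})
     \<and> (\<exists>d :: 'v \<Rightarrow> nat. \<forall>a\<in>K. \<forall>b\<in>K. b \<noteq> 0 \<longrightarrow> d a < d (a + b))"

definition supp :: "('v \<Rightarrow> rat) \<Rightarrow> 'v set" where
  "supp f = {v. f v \<noteq> 0}"

text \<open>The order behind all inductions on series. In a \<open>pcone\<close> the finiteness
  clause makes convolutions finite sums, and the degree \<open>d\<close> makes \<open>below\<close>
  well founded.\<close>

definition below :: "'v::ab_group_add set \<Rightarrow> 'v \<Rightarrow> 'v \<Rightarrow> bool" where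
  "below K a u \<longleftrightarrow> a \<in> K \<and> u - a \<in> K \<and> a \<noteq> u"

definition unit :: "'v::ab_group_add \<Rightarrow> rat" where
  "unit v = (if v = 0 then 1 else 0)"

definition deriv_by :: "('v \<Rightarrow> int) \<Rightarrow> ('v \<Rightarrow> rat) \<Rightarrow> 'v \<Rightarrow> rat" where
  "deriv_by \<delta> f v = of_int (\<delta> v) * f v"

lemma unit_0 [simp]: "unit 0 = 1" by (simp add: unit_def)

lemma supp_unit: "supp unit = {0}" by (auto simp: supp_def unit_def)

lemma suppD: "supp f \<subseteq> K \<Longrightarrow> f v \<noteq> 0 \<Longrightarrow> v \<in> K" by (auto simp: supp_def)

lemma suppI: "(\<And>v. v \<notin> K \<Longrightarrow> f v = 0) \<Longrightarrow> supp f \<subseteq> K" by (auto simp: supp_def)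

lemma supp_outside: "supp f \<subseteq> K \<Longrightarrow> v \<notin> K \<Longrightarrow> f v = 0" by (auto simp: supp_def)

lemma pcone_0: "pcone K \<Longrightarrow> 0 \<in> K" and pcone_add: "pcone K \<Longrightarrow> a \<in> K \<Longrightarrow> b \<in> K \<Longrightarrow> a + b \<in> K"
  and pcone_finite: "pcone K \<Longrightarrow> finite {a\<in>K. v - a \<in> K}"
  by (auto simp: pcone_def)

lemma pcone_degree:
  assumes "pcone K"
  obtains d :: "'v::ab_group_add \<Rightarrow> nat" where "\<And>a u. below K a u \<Longrightarrow> d a < d u"
proof -
  obtain d :: "'v \<Rightarrow> nat" where d: "\<forall>a\<in>K. \<forall>b\<in>K. b \<noteq> 0 \<longrightarrow> d a < d (a + b)"
    using assms by (auto simp: pcone_def)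
  have "d a < d u" if "below K a u" for a u
    using d[rule_format, of a "u - a"] that by (auto simp: below_def)
  then show ?thesis by (rule that)
qed

lemma pcone_induct [consumes 1, case_names below]:
  assumes "pcone K" and "\<And>u. (\<And>a. below K a u \<Longrightarrow> P a) \<Longrightarrow> P u"
  shows "P u"
proof -
  obtain d :: "'a \<Rightarrow> nat" where d: "\<And>a u. below K a u \<Longrightarrow> d a < d u"
    using pcone_degree[OF assms(1)] by metis
  show ?thesis
    by (induction u rule: measure_induct_rule[where f = d]) (blast intro: assms(2) d)
qed

lemma pcone_pointed:
  assumes "pcone K" "a \<in> K" "- a \<in> K" shows "a = 0"
proof (rule ccontr)
  assume "a \<noteq> 0"
  obtain d :: "'a \<Rightarrow> nat" where d: "\<And>a u. below K a u \<Longrightarrow> d a < d u"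
    using pcone_degree[OF assms(1)] by metis
  have "d a < d 0" by (rule d) (use assms \<open>a \<noteq> 0\<close> in \<open>auto simp: below_def\<close>)
  moreover have "d 0 < d a" by (rule d) (use assms \<open>a \<noteq> 0\<close> pcone_0 in \<open>auto simp: below_def\<close>)
  ultimately show False by simp
qed

lemma below_trans:
  assumes "pcone K" "below K a b" "below K b c" shows "below K a c"
proof -
  have "c - a \<in> K" using pcone_add[OF assms(1), of "c - b" "b - a"] assms by (auto simp: below_def)
  moreover have "a \<noteq> c"
    using pcone_pointed[OF assms(1), of "b - a"] assms by (auto simp: below_def)
  ultimately show ?thesis using assms by (auto simp: below_def)
qed

lemma below_0: "pcone K \<Longrightarrow> u \<in> K \<Longrightarrow> u \<noteq> 0 \<Longrightarrow> below K 0 u"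
  by (auto simp: below_def pcone_0)

text \<open>If \<open>\<Psi> F u\<close> depends on \<open>F u\<close> only by adding it, and
  otherwise only on strictly smaller arguments, the equations can be solved one vector at a time.
  Inverses, factorisations by sign and series with prescribed attractor data all arise this
  way.\<close>

lemma triangular_solve:
  fixes K :: "'v::ab_group_add set" and \<Psi> :: "('v \<Rightarrow> rat) \<Rightarrow> 'v \<Rightarrow> rat"
  assumes K: "pcone K"
    and tri: "\<And>F1 F2 u. supp F1 \<subseteq> K \<Longrightarrow> supp F2 \<subseteq> K \<Longrightarrow> F1 0 = 1 \<Longrightarrow> F2 0 = 1 \<Longrightarrow> u \<in> K \<Longrightarrow> u \<noteq> 0 \<Longrightarrow>
      (\<And>a. below K a u \<Longrightarrow> F1 a = F2 a) \<Longrightarrow> \<Psi> F1 u - \<Psi> F2 u = F1 u - F2 u"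
  shows "\<exists>F. supp F \<subseteq> K \<and> F 0 = 1 \<and> (\<forall>u\<in>K. u \<noteq> 0 \<longrightarrow> \<Psi> F u = g u)"
proof -
  obtain d :: "'v \<Rightarrow> nat" where d: "\<And>a u. below K a u \<Longrightarrow> d a < d u"
    using pcone_degree[OF K] by metis
  define R where "R = {(a, u). below K a u}"
  have wf: "wf R"
    by (rule wf_subset[OF wf_measure[of d]]) (auto simp: R_def d)
  \<comment> \<open>\<open>cut F u\<close> forgets the value at \<open>u\<close>, so
    \<open>\<Psi>\<close> evaluated on it is the part of the equation at \<open>u\<close> that is
    already determined; the default 0 at \<open>u\<close> makes the difference in \<open>tri\<close>
    exactly \<open>F u\<close>.\<close>
  define cut where "cut F u = (\<lambda>a. if a = 0 then 1 else if below K a u then F a else 0 :: rat)" for F and u :: 'v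
  define \<Phi> where "\<Phi> F u = (if u = 0 then 1 else if u \<in> K then g u - \<Psi> (cut F u) u else 0)" for F u
  have cut_supp: "supp (cut F u) \<subseteq> K" for F u
    by (auto simp: supp_def cut_def below_def pcone_0[OF K] split: if_splits)
  have "adm_wf R \<Phi>"
    unfolding adm_wf_def
  proof (intro allI impI)
    fix f h x assume *: "\<forall>z. (z, x) \<in> R \<longrightarrow> f z = (h z :: rat)"
    have "cut f x = cut h x" using * by (auto simp: cut_def R_def)
    then show "\<Phi> f x = \<Phi> h x" by (simp add: \<Phi>_def)
  qed
  then have fp: "wfrec R \<Phi> = \<Phi> (wfrec R \<Phi>)" by (rule wfrec_fixpoint[OF wf])
  define F where "F = wfrec R \<Phi>"
  have F: "F u = \<Phi> F u" for u using fp unfolding F_def by metis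
  have F0: "F 0 = 1" by (subst F) (simp add: \<Phi>_def)
  have FK: "supp F \<subseteq> K"
  proof
    fix u assume "u \<in> supp F"
    then have "F u \<noteq> 0" by (simp add: supp_def)
    then show "u \<in> K" using F[of u] pcone_0[OF K] by (auto simp: \<Phi>_def split: if_splits)
  qed
  have "\<Psi> F u = g u" if u: "u \<in> K" "u \<noteq> 0" for u
  proof -
    have "\<Psi> F u - \<Psi> (cut F u) u = F u - cut F u u"
      by (rule tri[OF FK cut_supp F0 _ u]) (auto simp: cut_def F0)
    moreover have "cut F u u = 0" using u by (simp add: cut_def below_def)
    moreover have "F u = g u - \<Psi> (cut F u) u" using F[of u] u by (simp add: \<Phi>_def)
    ultimately show ?thesis by simp
  qed
  with F0 FK show ?thesis by blast
qed

section \<open>The twisted group algebra of a lattice with a skew form\<close>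

locale skew_form =
  fixes w :: "'v::ab_group_add \<Rightarrow> 'v \<Rightarrow> int"
  assumes w_add_left: "w (a + b) c = w a c + w b c"
    and w_skew: "w a b = - w b a"
begin

lemma w_add_right: "w a (b + c) = w a b + w a c"
  using w_add_left[of b c a] w_skew[of a "b + c"] w_skew[of a b] w_skew[of a c] by simp

lemma w_zero_left [simp]: "w 0 a = 0"
  using w_add_left[of 0 0 a] by simp

lemma w_zero_right [simp]: "w a 0 = 0"
  using w_add_right[of a 0 0] by simp

lemma w_diff_left: "w (a - b) c = w a c - w b c"
  using w_add_left[of "a - b" b c] by simp

lemma w_diff_right: "w a (b - c) = w a b - w a c"
  using w_add_right[of a "b - c" c] by simp

lemma w_minus_left: "w (- a) b = - w a b"
  using w_diff_left[of 0 a b] by simp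

lemma w_minus_right: "w a (- b) = - w a b"
  using w_diff_right[of a 0 b] by simp

lemma w_self [simp]: "w a a = 0"
  using w_skew[of a a] by simp

text \<open>The product rule is that monomials with exponents \<open>a\<close> and \<open>b\<close>
  multiply with the factor \<open>2 powi w a b\<close>; note \<open>w a v = w a (v - a)\<close>.
  Summing over supports instead of a fixed cone lets one operation serve seeds with different cones.
  An infinite index set would give 0 by convention; it does not arise for supports in a
  \<open>pcone\<close>.\<close>

definition conv :: "('v \<Rightarrow> rat) \<Rightarrow> ('v \<Rightarrow> rat) \<Rightarrow> 'v \<Rightarrow> rat" (infixr "\<star>" 70) where
  "(f \<star> g) v = (\<Sum>a | f a \<noteq> 0 \<and> g (v - a) \<noteq> 0. 2 powi w a v * f a * g (v - a))"

lemma conv_on: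
  assumes "pcone K" "supp f \<subseteq> K" "supp g \<subseteq> K"
  shows "(f \<star> g) v = (\<Sum>a\<in>{a\<in>K. v - a \<in> K}. 2 powi w a v * f a * g (v - a))"
  unfolding conv_def
  by (rule sum.mono_neutral_left) (use assms pcone_finite in \<open>auto simp: supp_def\<close>)

lemma conv_nonzeroD:
  assumes "(f \<star> g) v \<noteq> 0" obtains a where "f a \<noteq> 0" "g (v - a) \<noteq> 0"
proof -
  have "{a. f a \<noteq> 0 \<and> g (v - a) \<noteq> 0} \<noteq> {}"
    using assms by (auto simp only: conv_def sum.empty)
  then show ?thesis using that by blast
qed

lemma supp_conv:
  assumes "supp f \<subseteq> M" "supp g \<subseteq> M" "\<And>a b. a \<in> M \<Longrightarrow> b \<in> M \<Longrightarrow> a + b \<in> M"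
  shows "supp (f \<star> g) \<subseteq> M"
proof
  fix v assume "v \<in> supp (f \<star> g)"
  then obtain a where "f a \<noteq> 0" "g (v - a) \<noteq> 0" by (auto simp: supp_def elim: conv_nonzeroD)
  then have "a \<in> M" "v - a \<in> M" using assms by (auto simp: supp_def)
  then show "v \<in> M" using assms(3)[of a "v - a"] by simp
qed

lemma supp_conv_pcone: "pcone K \<Longrightarrow> supp f \<subseteq> K \<Longrightarrow> supp g \<subseteq> K \<Longrightarrow> supp (f \<star> g) \<subseteq> K"
  by (rule supp_conv) (auto intro: pcone_add)

lemma conv_assoc:
  assumes K: "pcone K" and f: "supp f \<subseteq> K" and g: "supp g \<subseteq> K" and h: "supp h \<subseteq> K"
  shows "(f \<star> g) \<star> h = f \<star> (g \<star> h)"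
proof
  fix v
  let ?D = "\<lambda>v. {a\<in>K. v - a \<in> K}"
  have fin: "finite (?D u)" for u by (rule pcone_finite[OF K])
  have "((f \<star> g) \<star> h) v = (\<Sum>b\<in>?D v. \<Sum>a\<in>?D b. 2 powi w b v * (2 powi w a b * f a * g (b - a)) * h (v - b))"
    by (simp add: conv_on[OF K supp_conv_pcone[OF K f g] h] conv_on[OF K f g] sum_distrib_left sum_distrib_right)
  also have "\<dots> = (\<Sum>(b, a)\<in>(SIGMA b:?D v. ?D b). 2 powi w b v * (2 powi w a b * f a * g (b - a)) * h (v - b))"
    by (rule sum.Sigma) (use fin in auto)
  also have "\<dots> = (\<Sum>(a, c)\<in>(SIGMA a:?D v. ?D (v - a)). 2 powi w a v * f a * (2 powi w c (v - a) * g c * h (v - a - c)))"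
  proof (rule sum.reindex_bij_witness[of _ "\<lambda>(a, c). (a + c, a)" "\<lambda>(b, a). (a, b - a)"])
    fix p assume "p \<in> (SIGMA b:?D v. ?D b)"
    then obtain b a where p: "p = (b, a)" and *: "b \<in> K" "v - b \<in> K" "a \<in> K" "b - a \<in> K" by auto
    have "v - a \<in> K" using pcone_add[OF K *(2) *(4)] by simp
    then show "(case p of (b, a) \<Rightarrow> (a, b - a)) \<in> (SIGMA a:?D v. ?D (v - a))" using * by (simp add: p)
    show "(case case p of (b, a) \<Rightarrow> (a, b - a) of (a, c) \<Rightarrow> (a + c, a)) = p" by (simp add: p)
    have "2 powi w b v * 2 powi w a b = (2 powi w a v * 2 powi w (b - a) (v - a) :: rat)"
      by (simp add: w_diff_left w_diff_right w_skew[of b a] flip: power_int_add)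
    then show "(case case p of (b, a) \<Rightarrow> (a, b - a) of
        (a, c) \<Rightarrow> 2 powi w a v * f a * (2 powi w c (v - a) * g c * h (v - a - c)))
      = (case p of (b, a) \<Rightarrow> 2 powi w b v * (2 powi w a b * f a * g (b - a)) * h (v - b))"
      by (simp add: p)
  next
    fix p assume "p \<in> (SIGMA a:?D v. ?D (v - a))"
    then obtain a c where p: "p = (a, c)" and *: "a \<in> K" "v - a \<in> K" "c \<in> K" "v - a - c \<in> K" by auto
    then show "(case p of (a, c) \<Rightarrow> (a + c, a)) \<in> (SIGMA b:?D v. ?D b)"
      using pcone_add[OF K] by (simp add: diff_diff_add)
    show "(case case p of (a, c) \<Rightarrow> (a + c, a) of (b, a) \<Rightarrow> (a, b - a)) = p" by (simp add: p)
  qed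
  also have "\<dots> = (\<Sum>a\<in>?D v. \<Sum>c\<in>?D (v - a). 2 powi w a v * f a * (2 powi w c (v - a) * g c * h (v - a - c)))"
    by (rule sum.Sigma[symmetric]) (use fin in auto)
  also have "\<dots> = (f \<star> (g \<star> h)) v"
    by (simp add: conv_on[OF K f supp_conv_pcone[OF K g h]] conv_on[OF K g h] sum_distrib_left)
  finally show "((f \<star> g) \<star> h) v = (f \<star> (g \<star> h)) v" .
qed

lemma conv_unit_left [simp]: "unit \<star> g = g"
proof
  fix v
  have "{a. unit a \<noteq> (0::rat) \<and> g (v - a) \<noteq> 0} = (if g v = 0 then {} else {0})"
    by (auto simp: unit_def)
  then show "(unit \<star> g) v = g v" by (auto simp: conv_def)
qed

lemma conv_unit_right [simp]: "f \<star> unit = f"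
proof
  fix v
  have "{a. f a \<noteq> 0 \<and> unit (v - a) \<noteq> (0::rat)} = (if f v = 0 then {} else {v})"
    by (auto simp: unit_def)
  then show "(f \<star> unit) v = f v" by (auto simp: conv_def)
qed

lemma conv_0:
  assumes K: "pcone K" and f: "supp f \<subseteq> K" and g: "supp g \<subseteq> K"
  shows "(f \<star> g) 0 = f 0 * g 0"
proof -
  have "{a\<in>K. 0 - a \<in> K} = {0}" using pcone_pointed[OF K] pcone_0[OF K] by auto
  then show ?thesis by (simp add: conv_on[OF K f g])
qed

lemma conv_top:
  assumes K: "pcone K" and f: "supp f \<subseteq> K" and g: "supp g \<subseteq> K" and u: "u \<in> K" "u \<noteq> 0"
  shows "(f \<star> g) u = f u * g 0 + f 0 * g u + (\<Sum>a\<in>{a\<in>K. u - a \<in> K} - {0, u}. 2 powi w a u * f a * g (u - a))"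
proof -
  have "{a\<in>K. u - a \<in> K} = insert 0 (insert u ({a\<in>K. u - a \<in> K} - {0, u}))"
    using u pcone_0[OF K] by auto
  then have "(f \<star> g) u = (\<Sum>a\<in>insert 0 (insert u ({a\<in>K. u - a \<in> K} - {0, u})). 2 powi w a u * f a * g (u - a))"
    using conv_on[OF K f g] by simp
  also have "\<dots> = f u * g 0 + f 0 * g u + (\<Sum>a\<in>{a\<in>K. u - a \<in> K} - {0, u}. 2 powi w a u * f a * g (u - a))"
    using u pcone_finite[OF K, of u] by simp
  finally show ?thesis .
qed

lemma conv_diff_top:
  assumes K: "pcone K" and "supp f1 \<subseteq> K" "supp g1 \<subseteq> K" "supp f2 \<subseteq> K" "supp g2 \<subseteq> K"
    and u: "u \<in> K" "u \<noteq> 0"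
    and f: "\<And>a. below K a u \<Longrightarrow> f1 a = f2 a" and g: "\<And>a. below K a u \<Longrightarrow> g1 a = g2 a"
  shows "(f1 \<star> g1) u - (f2 \<star> g2) u = (f1 u - f2 u) * g1 0 + f1 0 * (g1 u - g2 u)"
proof -
  have "(\<Sum>a\<in>{a\<in>K. u - a \<in> K} - {0, u}. 2 powi w a u * f1 a * g1 (u - a))
      = (\<Sum>a\<in>{a\<in>K. u - a \<in> K} - {0, u}. 2 powi w a u * f2 a * g2 (u - a))"
    by (rule sum.cong) (auto simp: f g below_def)
  moreover have "f1 0 = f2 0" "g1 0 = g2 0" using f g below_0[OF K u] by auto
  ultimately show ?thesis using assms by (simp add: conv_top algebra_simps)
qed

lemma conv_agree:
  assumes K: "pcone K" and "supp f1 \<subseteq> K" "supp g1 \<subseteq> K" "supp f2 \<subseteq> K" "supp g2 \<subseteq> K"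
    and f: "\<And>a. below K a u \<Longrightarrow> f1 a = f2 a" and g: "\<And>a. below K a u \<Longrightarrow> g1 a = g2 a" and a: "below K a u"
  shows "(f1 \<star> g1) a = (f2 \<star> g2) a"
proof (cases "a = 0")
  case True
  then show ?thesis using assms a by (simp add: conv_0)
next
  case False
  have "a \<in> K" using a by (simp add: below_def)
  have "(f1 \<star> g1) a - (f2 \<star> g2) a = (f1 a - f2 a) * g1 0 + f1 0 * (g1 a - g2 a)"
    using assms(1-5) \<open>a \<in> K\<close> False f g below_trans[OF K _ a] by (intro conv_diff_top) auto
  then show ?thesis using f[OF a] g[OF a] by simp
qed

lemma conv_add_left:
  assumes "pcone K" "supp f \<subseteq> K" "supp g \<subseteq> K" "supp h \<subseteq> K"
  shows "(f + g) \<star> h = f \<star> h + g \<star> h"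
proof
  fix v
  have "supp (f + g) \<subseteq> K" by (rule suppI) (simp add: supp_outside[OF assms(2)] supp_outside[OF assms(3)])
  then show "((f + g) \<star> h) v = (f \<star> h + g \<star> h) v"
    using assms by (simp add: conv_on[of K] algebra_simps sum.distrib)
qed

lemma supp_deriv_by: "supp f \<subseteq> K \<Longrightarrow> supp (deriv_by \<delta> f) \<subseteq> K"
  by (auto simp: supp_def deriv_by_def)

lemma deriv_by_conv:
  assumes "pcone K" "supp f \<subseteq> K" "supp g \<subseteq> K" and \<delta>: "\<And>a b. \<delta> (a + b) = \<delta> a + \<delta> b"
  shows "deriv_by \<delta> (f \<star> g) = deriv_by \<delta> f \<star> g + f \<star> deriv_by \<delta> g"
proof
  fix v
  have \<delta>v: "of_int (\<delta> v) = (of_int (\<delta> a) + of_int (\<delta> (v - a)) :: rat)" for a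
    using \<delta>[of a "v - a"] by (simp flip: of_int_add)
  have "of_int (\<delta> v) * (2 powi w a v * f a * g (v - a)) = 2 powi w a v * deriv_by \<delta> f a * g (v - a)
      + 2 powi w a v * f a * deriv_by \<delta> g (v - a)" for a
    unfolding \<delta>v[of a] by (simp add: deriv_by_def algebra_simps)
  then have "deriv_by \<delta> (f \<star> g) v = (\<Sum>a\<in>{a\<in>K. v - a \<in> K}. 2 powi w a v * deriv_by \<delta> f a * g (v - a)
      + 2 powi w a v * f a * deriv_by \<delta> g (v - a))"
    using assms by (simp add: deriv_by_def[of \<delta> "f \<star> g"] conv_on[of K] sum_distrib_left)
  then show "deriv_by \<delta> (f \<star> g) v = (deriv_by \<delta> f \<star> g + f \<star> deriv_by \<delta> g) v"
    using assms by (simp add: conv_on[of K] supp_deriv_by sum.distrib)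
qed

text \<open>The triangular system yields right inverses; a right inverse of the right inverse is the
  original series by associativity, so the inverse is two-sided.\<close>

lemma conv_inverse:
  assumes K: "pcone K" and f: "supp f \<subseteq> K" "f 0 = 1"
  obtains g where "supp g \<subseteq> K" "g 0 = 1" "f \<star> g = unit" "g \<star> f = unit"
proof -
  have right: "\<exists>g. supp g \<subseteq> K \<and> g 0 = 1 \<and> f \<star> g = unit" if f: "supp f \<subseteq> K" "f 0 = 1" for f
  proof -
    have "\<exists>g. supp g \<subseteq> K \<and> g 0 = 1 \<and> (\<forall>u\<in>K. u \<noteq> 0 \<longrightarrow> (f \<star> g) u = unit u)"
    proof (rule triangular_solve[OF K])
      fix F1 F2 u assume *: "supp F1 \<subseteq> K" "supp F2 \<subseteq> K" "F1 0 = 1" "F2 0 = 1" "u \<in> K" "u \<noteq> 0"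
        "\<And>a. below K a u \<Longrightarrow> F1 a = F2 a"
      show "(f \<star> F1) u - (f \<star> F2) u = F1 u - F2 u"
        using conv_diff_top[OF K f(1) *(1) f(1) *(2) *(5,6) refl *(7)] f by simp
    qed
    then obtain g where g: "supp g \<subseteq> K" "g 0 = 1" "\<And>u. u\<in>K \<Longrightarrow> u \<noteq> 0 \<Longrightarrow> (f \<star> g) u = unit u"
      by blast
    have "f \<star> g = unit"
    proof
      fix u show "(f \<star> g) u = unit u"
        using g f conv_0[OF K f(1) g(1)] supp_outside[OF supp_conv_pcone[OF K f(1) g(1)], of u] pcone_0[OF K]
        by (cases "u = 0"; cases "u \<in> K") (auto simp: unit_def)
    qed
    with g show ?thesis by blast
  qed
  obtain g where g: "supp g \<subseteq> K" "g 0 = 1" "f \<star> g = unit" using right[OF f] by blast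
  obtain k where k: "supp k \<subseteq> K" "k 0 = 1" "g \<star> k = unit" using right[OF g(1,2)] by blast
  have "f = (f \<star> g) \<star> k" using conv_assoc[OF K f(1) g(1) k(1)] k by simp
  then have "f = k" using g by simp
  with g k show ?thesis using that by blast
qed

text \<open>For series supported orthogonally to \<open>v\<close> all twists occurring at
  \<open>v\<close> are 1, so evaluation at \<open>v\<close> is a trace. This makes the coefficient
  of a logarithmic derivative at \<open>v\<close> insensitive to conjugation although the algebra is
  not commutative.\<close>

lemma conv_trace:
  assumes K: "pcone K" and f: "supp f \<subseteq> K \<inter> {u. w u v = 0}" and g: "supp g \<subseteq> K \<inter> {u. w u v = 0}"
  shows "(f \<star> g) v = (g \<star> f) v"
proof -
  have fK: "supp f \<subseteq> K" and gK: "supp g \<subseteq> K" using f g by auto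
  have "2 powi w a v * f a * g (v - a) = f a * g (v - a)" for a
    using suppD[OF f, of a] by (cases "f a = 0") auto
  moreover have "2 powi w a v * g a * f (v - a) = g a * f (v - a)" for a
    using suppD[OF g, of a] by (cases "g a = 0") auto
  ultimately have *: "(f \<star> g) v = (\<Sum>a\<in>{a\<in>K. v - a \<in> K}. f a * g (v - a))"
    "(g \<star> f) v = (\<Sum>a\<in>{a\<in>K. v - a \<in> K}. g a * f (v - a))"
    by (simp_all only: conv_on[OF K fK gK] conv_on[OF K gK fK])
  show ?thesis unfolding *
    by (rule sum.reindex_bij_witness[of _ "\<lambda>a. v - a" "\<lambda>a. v - a"]) auto
qed

end

section \<open>Products of three normalised series at their top degree\<close>

lemma pcone_subset:
  assumes "pcone K" "M \<subseteq> K" "0 \<in> M" "\<And>a b. a \<in> M \<Longrightarrow> b \<in> M \<Longrightarrow> a + b \<in> M"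
  shows "pcone M"
proof -
  have "finite {a\<in>M. v - a \<in> M}" for v
    by (rule finite_subset[OF _ pcone_finite[OF assms(1), of v]]) (use assms(2) in auto)
  moreover obtain d :: "'a \<Rightarrow> nat" where "\<forall>a\<in>K. \<forall>b\<in>K. b \<noteq> 0 \<longrightarrow> d a < d (a + b)"
    using assms(1) by (auto simp: pcone_def)
  then have "\<forall>a\<in>M. \<forall>b\<in>M. b \<noteq> 0 \<longrightarrow> d a < d (a + b)" using assms(2) by blast
  ultimately show ?thesis using assms(3,4) unfolding pcone_def by blast
qed

context skew_form
begin

lemma conv3_diff_top:
  assumes K: "pcone K" and u: "u \<in> K" "u \<noteq> 0"
    and s: "supp A \<subseteq> K" "supp B \<subseteq> K" "supp C \<subseteq> K" "supp A' \<subseteq> K" "supp B' \<subseteq> K" "supp C' \<subseteq> K"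
    and "A 0 = 1" "B 0 = 1" "C 0 = 1"
    and agree: "\<And>a. below K a u \<Longrightarrow> A a = A' a" "\<And>a. below K a u \<Longrightarrow> B a = B' a" "\<And>a. below K a u \<Longrightarrow> C a = C' a"
  shows "(A \<star> B \<star> C) u - (A' \<star> B' \<star> C') u = (A u - A' u) + (B u - B' u) + (C u - C' u)"
proof -
  have "(A \<star> B \<star> C) u - (A' \<star> B' \<star> C') u = (A u - A' u) * (B \<star> C) 0 + A 0 * ((B \<star> C) u - (B' \<star> C') u)"
    by (rule conv_diff_top[OF K s(1) supp_conv_pcone[OF K s(2,3)] s(4) supp_conv_pcone[OF K s(5,6)] u agree(1)])
      (use conv_agree[OF K s(2,3,5,6) agree(2,3)] in auto)
  moreover have "(B \<star> C) u - (B' \<star> C') u = (B u - B' u) * C 0 + B 0 * (C u - C' u)"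
    by (rule conv_diff_top[OF K s(2,3,5,6) u agree(2,3)])
  moreover have "(B \<star> C) 0 = 1" using assms by (simp add: conv_0[OF K])
  ultimately show ?thesis using assms by simp
qed

text \<open>At a minimal vector \<open>u\<close> outside \<open>M\<close> smaller vectors contribute
  only products inside \<open>M\<close>, so the product has the value \<open>A u + B u + C u\<close>
  there. This is 0, and by separation of supports at most one summand is nonzero. Thus a support
  bound for a product passes to its factors.\<close>

lemma conv3_supports:
  assumes K: "pcone K" and s: "supp A \<subseteq> K" "supp B \<subseteq> K" "supp C \<subseteq> K"
    and one: "A 0 = 1" "B 0 = 1" "C 0 = 1"
    and disj: "\<And>u. u \<noteq> 0 \<Longrightarrow> (A u = 0 \<or> B u = 0) \<and> (A u = 0 \<or> C u = 0) \<and> (B u = 0 \<or> C u = 0)"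
    and M: "0 \<in> M" "\<And>a b. a \<in> M \<Longrightarrow> b \<in> M \<Longrightarrow> a + b \<in> M"
    and ABC: "supp (A \<star> B \<star> C) \<subseteq> M"
  shows "supp A \<subseteq> M" "supp B \<subseteq> M" "supp C \<subseteq> M"
proof -
  define res where "res f = (\<lambda>u. if u \<in> M then f u else 0 :: rat)" for f
  have resM: "supp (res f) \<subseteq> M" for f by (auto simp: supp_def res_def)
  have resK: "supp (res f) \<subseteq> K" if "supp f \<subseteq> K" for f using that by (auto simp: supp_def res_def)
  have "u \<notin> M \<longrightarrow> A u = 0 \<and> B u = 0 \<and> C u = 0" for u
  proof (induction u rule: pcone_induct[OF K])
    case (1 u)
    show ?case
    proof (cases "u \<in> K")
      case True
      show ?thesis
      proof
        assume u: "u \<notin> M"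
        with M have "u \<noteq> 0" by auto
        have "(A \<star> B \<star> C) u - (res A \<star> res B \<star> res C) u = (A u - res A u) + (B u - res B u) + (C u - res C u)"
          by (rule conv3_diff_top[OF K True \<open>u \<noteq> 0\<close>]) (use s one 1 in \<open>auto simp: resK\<close>, auto simp: res_def)
        moreover have "(A \<star> B \<star> C) u = 0" using ABC u by (rule supp_outside)
        moreover have "(res A \<star> res B \<star> res C) u = 0"
          by (rule supp_outside[OF supp_conv[OF resM supp_conv[OF resM resM]] u]) (auto intro: M)
        ultimately have "A u + B u + C u = 0" using u by (simp add: res_def)
        then show "A u = 0 \<and> B u = 0 \<and> C u = 0" using disj[OF \<open>u \<noteq> 0\<close>] by auto
      qed
    qed (simp add: s[THEN supp_outside])
  qed
  then show "supp A \<subseteq> M" "supp B \<subseteq> M" "supp C \<subseteq> M" by (auto simp: supp_def)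
qed

section \<open>Attractor conditions\<close>

text \<open>The functional \<open>\<lambda>u. w u v\<close> is the attractor point of
  \<open>v\<close>; \<open>B\<close> is the element of the scattering diagram attached to that
  point, and \<open>A\<close>, \<open>C\<close> collect the two sides.\<close>

definition fact :: "'v set \<Rightarrow> 'v \<Rightarrow> ('v \<Rightarrow> rat) \<Rightarrow> ('v \<Rightarrow> rat) \<Rightarrow> ('v \<Rightarrow> rat) \<Rightarrow> bool" where
  "fact K v A B C \<longleftrightarrow> supp A \<subseteq> K \<inter> {u. u = 0 \<or> w u v > 0} \<and> supp B \<subseteq> K \<inter> {u. w u v = 0}
     \<and> supp C \<subseteq> K \<inter> {u. u = 0 \<or> w u v < 0} \<and> A 0 = 1 \<and> B 0 = 1 \<and> C 0 = 1"

text \<open>For additive \<open>\<delta>\<close> the value of \<open>\<omega>\<close> at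
  \<open>v\<close> is \<open>\<delta> v\<close> times that of the logarithm of \<open>B\<close>,
  since commutators of series orthogonal to \<open>v\<close> vanish at \<open>v\<close>. The
  logarithmic derivative stands in for the logarithm.\<close>

definition log_deriv :: "('v \<Rightarrow> int) \<Rightarrow> 'v set \<Rightarrow> 'v \<Rightarrow> ('v \<Rightarrow> rat) \<Rightarrow> ('v \<Rightarrow> rat) \<Rightarrow> bool" where
  "log_deriv \<delta> K v B \<omega> \<longleftrightarrow> supp \<omega> \<subseteq> K \<inter> {u. w u v = 0} \<and> deriv_by \<delta> B = \<omega> \<star> B"

definition attractor_coeff :: "('v \<Rightarrow> int) \<Rightarrow> 'v set \<Rightarrow> ('v \<Rightarrow> rat) \<Rightarrow> 'v \<Rightarrow> ('v \<Rightarrow> rat) \<Rightarrow> bool" where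
  "attractor_coeff \<delta> K g v \<omega> \<longleftrightarrow> (\<exists>A B C. fact K v A B C \<and> g = A \<star> B \<star> C \<and> log_deriv \<delta> K v B \<omega>)"

text \<open>Over a \<open>pcone\<close> every additive \<open>\<delta>\<close> with
  \<open>\<delta> v \<noteq> 0\<close> gives the same condition on a normalised series supported
  there. The existential form allows \<open>\<delta>\<close> to be replaced by its composite with a
  shear.\<close>

definition attr :: "'v set \<Rightarrow> ('v \<Rightarrow> rat) \<Rightarrow> 'v \<Rightarrow> bool" where
  "attr K g v \<longleftrightarrow> (\<exists>\<delta> \<omega>. (\<forall>a b. \<delta> (a + b) = \<delta> a + \<delta> b) \<and> \<delta> v \<noteq> 0 \<and> attractor_coeff \<delta> K g v \<omega> \<and> \<omega> v = 0)"

lemma fact_supp: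
  assumes "fact K v A B C" shows "supp A \<subseteq> K" "supp B \<subseteq> K" "supp C \<subseteq> K"
  using assms by (auto simp: fact_def)

lemma fact_0:
  assumes "fact K v A B C" shows "A 0 = 1" "B 0 = 1" "C 0 = 1"
  using assms by (auto simp: fact_def)

lemma fact_disjoint:
  assumes "fact K v A B C" "u \<noteq> 0"
  shows "(A u = 0 \<or> B u = 0) \<and> (A u = 0 \<or> C u = 0) \<and> (B u = 0 \<or> C u = 0)"
proof -
  have "A u \<noteq> 0 \<Longrightarrow> w u v > 0" "B u \<noteq> 0 \<Longrightarrow> w u v = 0" "C u \<noteq> 0 \<Longrightarrow> w u v < 0"
    using assms by (auto simp: fact_def supp_def)
  then show ?thesis by fastforce
qed

text \<open>The three unknown factors are restrictions of one unknown \<open>F\<close> to the three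
  signs, because a triangular system determines one value per vector.\<close>

lemma fact_exists:
  assumes K: "pcone K" and g: "supp g \<subseteq> K" "g 0 = 1"
  obtains A B C where "fact K v A B C" "g = A \<star> B \<star> C"
proof -
  define P where "P F = (\<lambda>u. if u = 0 then 1 else if w u v > 0 then F u else 0 :: rat)" for F
  define Z where "Z F = (\<lambda>u. if w u v = 0 then F u else 0 :: rat)" for F
  define N where "N F = (\<lambda>u. if u = 0 then 1 else if w u v < 0 then F u else 0 :: rat)" for F
  have s: "supp (P F) \<subseteq> K" "supp (Z F) \<subseteq> K" "supp (N F) \<subseteq> K" if "supp F \<subseteq> K" for F
    using that pcone_0[OF K] by (auto simp: supp_def P_def Z_def N_def)
  have "\<exists>F. supp F \<subseteq> K \<and> F 0 = 1 \<and> (\<forall>u\<in>K. u \<noteq> 0 \<longrightarrow> (P F \<star> Z F \<star> N F) u = g u)"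
  proof (rule triangular_solve[OF K])
    fix F1 F2 u assume *: "supp F1 \<subseteq> K" "supp F2 \<subseteq> K" "F1 0 = 1" "F2 0 = 1" "u \<in> K" "u \<noteq> 0"
      "\<And>a. below K a u \<Longrightarrow> F1 a = F2 a"
    have "(P F1 \<star> Z F1 \<star> N F1) u - (P F2 \<star> Z F2 \<star> N F2) u
       = (P F1 u - P F2 u) + (Z F1 u - Z F2 u) + (N F1 u - N F2 u)"
      by (rule conv3_diff_top[OF K *(5,6) s[OF *(1)] s[OF *(2)]])
        (use * in \<open>auto simp: P_def Z_def N_def\<close>)
    also have "\<dots> = F1 u - F2 u" using * by (auto simp: P_def Z_def N_def)
    finally show "(P F1 \<star> Z F1 \<star> N F1) u - (P F2 \<star> Z F2 \<star> N F2) u = F1 u - F2 u" .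
  qed
  then obtain F where F: "supp F \<subseteq> K" "F 0 = 1" "\<And>u. u\<in>K \<Longrightarrow> u \<noteq> 0 \<Longrightarrow> (P F \<star> Z F \<star> N F) u = g u"
    by blast
  have "fact K v (P F) (Z F) (N F)"
    using s[OF F(1)] F(2) unfolding fact_def by (auto simp: supp_def P_def Z_def N_def)
  moreover have "g = P F \<star> Z F \<star> N F"
  proof
    fix u
    note sc = supp_conv_pcone[OF K s(2,3)[OF F(1)]]
    have "(P F \<star> Z F \<star> N F) 0 = 1"
      using F(2) by (simp add: conv_0[OF K s(1)[OF F(1)] sc] conv_0[OF K s(2,3)[OF F(1)]]) (simp add: P_def Z_def N_def)
    moreover have "u \<notin> K \<Longrightarrow> (P F \<star> Z F \<star> N F) u = 0"
      by (rule supp_outside[OF supp_conv_pcone[OF K s(1)[OF F(1)] sc]])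
    ultimately show "g u = (P F \<star> Z F \<star> N F) u"
      using F(3)[of u] g supp_outside[OF g(1), of u] by (cases "u = 0"; cases "u \<in> K") auto
  qed
  ultimately show ?thesis by (rule that)
qed

lemma log_deriv_exists:
  assumes K: "pcone K" and B: "supp B \<subseteq> K \<inter> {u. w u v = 0}" "B 0 = 1"
  obtains \<omega> where "log_deriv \<delta> K v B \<omega>"
proof -
  let ?M = "K \<inter> {u. w u v = 0}"
  have M: "pcone ?M"
    by (rule pcone_subset[OF K]) (use pcone_0[OF K] pcone_add[OF K] in \<open>auto simp: w_add_left\<close>)
  obtain B' where B': "supp B' \<subseteq> ?M" "B' \<star> B = unit" by (rule conv_inverse[OF M B])
  let ?d = "deriv_by \<delta> B"
  have "log_deriv \<delta> K v B (?d \<star> B')"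
    unfolding log_deriv_def
    using supp_conv_pcone[OF M supp_deriv_by[OF B(1)] B'(1)] conv_assoc[OF M supp_deriv_by[OF B(1)] B'(1) B(1)] B'(2)
    by auto
  then show ?thesis by (rule that)
qed

lemma log_deriv_supports:
  assumes K: "pcone K" and B: "supp B \<subseteq> M" "supp B \<subseteq> K" "B 0 = 1" and \<omega>: "log_deriv \<delta> K v B \<omega>"
    and M: "0 \<in> M" "\<And>a b. a \<in> M \<Longrightarrow> b \<in> M \<Longrightarrow> a + b \<in> M"
  shows "supp \<omega> \<subseteq> M"
proof -
  have KM: "pcone (K \<inter> M)"
    by (rule pcone_subset[OF K]) (use pcone_0[OF K] pcone_add[OF K] M in auto)
  have BM: "supp B \<subseteq> K \<inter> M" using B by simp
  obtain B' where B': "supp B' \<subseteq> K \<inter> M" "B \<star> B' = unit" by (rule conv_inverse[OF KM BM B(3)])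
  have \<omega>K: "supp \<omega> \<subseteq> K" using \<omega> by (auto simp: log_deriv_def)
  have B'K: "supp B' \<subseteq> K" using B' by simp
  have "\<omega> = \<omega> \<star> B \<star> B'" by (simp add: B')
  also have "\<dots> = (\<omega> \<star> B) \<star> B'" by (rule conv_assoc[OF K \<omega>K B(2) B'K, symmetric])
  also have "\<omega> \<star> B = deriv_by \<delta> B" using \<omega> by (simp add: log_deriv_def)
  finally have "\<omega> = deriv_by \<delta> B \<star> B'" .
  then show ?thesis using supp_conv_pcone[OF KM supp_deriv_by[OF BM] B'(1), of \<delta>] by auto
qed

lemma attractor_coeff_exists:
  assumes K: "pcone K" and g: "supp g \<subseteq> K" "g 0 = 1"
  shows "\<exists>\<omega>. attractor_coeff \<delta> K g v \<omega>"
proof -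
  obtain A B C where f: "fact K v A B C" "g = A \<star> B \<star> C" by (rule fact_exists[OF K g])
  then have "supp B \<subseteq> K \<inter> {u. w u v = 0}" "B 0 = 1" by (auto simp: fact_def)
  then obtain \<omega> where "log_deriv \<delta> K v B \<omega>" by (rule log_deriv_exists[OF K])
  with f show ?thesis unfolding attractor_coeff_def by blast
qed

text \<open>Outside the cone the condition is empty. It has to be available there because a vector
  of the mutated cone may lie outside the old one.\<close>

lemma attr_outside:
  fixes \<delta> :: "'v \<Rightarrow> int"
  assumes K: "pcone K" and g: "supp g \<subseteq> K" "g 0 = 1" and v: "v \<notin> K"
    and \<delta>: "\<And>a b. \<delta> (a + b) = \<delta> a + \<delta> b" "\<delta> v \<noteq> 0"
  shows "attr K g v"
proof -
  obtain \<omega> where \<omega>: "attractor_coeff \<delta> K g v \<omega>" using attractor_coeff_exists[OF K g] by blast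
  then have "supp \<omega> \<subseteq> K" by (auto simp: attractor_coeff_def log_deriv_def)
  then have "\<omega> v = 0" using v by (rule supp_outside)
  then show ?thesis unfolding attr_def using \<delta> \<omega> by blast
qed

lemma fact_agree:
  assumes K: "pcone K" and f1: "fact K v A1 B1 C1" and f2: "fact K v A2 B2 C2"
    and agree: "\<And>a. below K a u \<Longrightarrow> (A1 \<star> B1 \<star> C1) a = (A2 \<star> B2 \<star> C2) a"
  shows "below K a u \<Longrightarrow> A1 a = A2 a \<and> B1 a = B2 a \<and> C1 a = C2 a"
proof (induction a rule: pcone_induct[OF K])
  case (1 a)
  show ?case
  proof (cases "a = 0")
    case False
    have aK: "a \<in> K" using 1(2) by (simp add: below_def)
    have IH: "A1 b = A2 b" "B1 b = B2 b" "C1 b = C2 b" if "below K b a" for b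
      using 1(1)[OF that below_trans[OF K that 1(2)]] by auto
    have "(A1 \<star> B1 \<star> C1) a - (A2 \<star> B2 \<star> C2) a = (A1 a - A2 a) + (B1 a - B2 a) + (C1 a - C2 a)"
      by (rule conv3_diff_top[OF K aK False fact_supp[OF f1] fact_supp[OF f2] fact_0[OF f1] IH])
    then have "(A1 a - A2 a) + (B1 a - B2 a) + (C1 a - C2 a) = 0" using agree[OF 1(2)] by simp
    moreover have "A1 a \<noteq> 0 \<Longrightarrow> w a v > 0" "B1 a \<noteq> 0 \<Longrightarrow> w a v = 0" "C1 a \<noteq> 0 \<Longrightarrow> w a v < 0"
      "A2 a \<noteq> 0 \<Longrightarrow> w a v > 0" "B2 a \<noteq> 0 \<Longrightarrow> w a v = 0" "C2 a \<noteq> 0 \<Longrightarrow> w a v < 0"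
      using f1 f2 False by (auto simp: fact_def supp_def)
    then have "w a v \<le> 0 \<Longrightarrow> A1 a = 0 \<and> A2 a = 0" "w a v \<noteq> 0 \<Longrightarrow> B1 a = 0 \<and> B2 a = 0"
      "w a v \<ge> 0 \<Longrightarrow> C1 a = 0 \<and> C2 a = 0" by force+
    ultimately show ?thesis
      by (cases "w a v" "0 :: int" rule: linorder_cases) auto
  qed (use f1 f2 in \<open>simp add: fact_0\<close>)
qed

text \<open>Triangularity of the attractor condition: as \<open>w v v = 0\<close>, the outer factors
  vanish at \<open>v\<close>, so a change of \<open>g v\<close> passes entirely into
  \<open>B v\<close> and from there, multiplied by \<open>\<delta> v\<close>, into
  \<open>\<omega> v\<close>.\<close>

lemma attractor_coeff_diff:
  assumes K: "pcone K" and c: "attractor_coeff \<delta> K g1 v \<omega>1" "attractor_coeff \<delta> K g2 v \<omega>2"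
    and v: "v \<in> K" "v \<noteq> 0" and \<delta>: "\<And>a b. \<delta> (a + b) = \<delta> a + \<delta> b"
    and agree: "\<And>a. below K a v \<Longrightarrow> g1 a = g2 a"
  shows "\<omega>1 v - \<omega>2 v = of_int (\<delta> v) * (g1 v - g2 v)"
proof -
  obtain A1 B1 C1 where f1: "fact K v A1 B1 C1" and g1: "g1 = A1 \<star> B1 \<star> C1" and l1: "log_deriv \<delta> K v B1 \<omega>1"
    using c(1) by (auto simp: attractor_coeff_def)
  obtain A2 B2 C2 where f2: "fact K v A2 B2 C2" and g2: "g2 = A2 \<star> B2 \<star> C2" and l2: "log_deriv \<delta> K v B2 \<omega>2"
    using c(2) by (auto simp: attractor_coeff_def)
  have eq: "A1 a = A2 a" "B1 a = B2 a" "C1 a = C2 a" if "below K a v" for a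
    using fact_agree[OF K f1 f2 _ that] agree g1 g2 by auto
  have "g1 v - g2 v = (A1 v - A2 v) + (B1 v - B2 v) + (C1 v - C2 v)"
    unfolding g1 g2 by (rule conv3_diff_top[OF K v fact_supp[OF f1] fact_supp[OF f2] fact_0[OF f1] eq])
  moreover have "A1 v = 0" "A2 v = 0" "C1 v = 0" "C2 v = 0"
    using f1 f2 v by (auto simp: fact_def supp_def)
  ultimately have gB: "g1 v - g2 v = B1 v - B2 v" by simp
  have d1: "deriv_by \<delta> B1 = \<omega>1 \<star> B1" and s1: "supp \<omega>1 \<subseteq> K" and d2: "deriv_by \<delta> B2 = \<omega>2 \<star> B2" and s2: "supp \<omega>2 \<subseteq> K"
    using l1 l2 by (auto simp: log_deriv_def)
  note sB1 = fact_supp(2)[OF f1] and sB2 = fact_supp(2)[OF f2]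
  have "\<delta> 0 = 0" using \<delta>[of 0 0] by simp
  then have z: "\<omega>1 0 = 0" "\<omega>2 0 = 0"
    using fun_cong[OF d1, of 0] fun_cong[OF d2, of 0]
    by (simp_all add: conv_0[OF K s1 sB1] conv_0[OF K s2 sB2] fact_0[OF f1] fact_0[OF f2] deriv_by_def)
  have step: "of_int (\<delta> a) * (B1 a - B2 a) = \<omega>1 a - \<omega>2 a"
    if "a \<in> K" "a \<noteq> 0" "\<And>b. below K b a \<Longrightarrow> \<omega>1 b = \<omega>2 b" "\<And>b. below K b a \<Longrightarrow> B1 b = B2 b" for a
  proof -
    have "(\<omega>1 \<star> B1) a - (\<omega>2 \<star> B2) a = (\<omega>1 a - \<omega>2 a) * B1 0 + \<omega>1 0 * (B1 a - B2 a)"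
      by (rule conv_diff_top[OF K s1 sB1 s2 sB2 that])
    then show ?thesis using fun_cong[OF d1, of a] fun_cong[OF d2, of a] z fact_0[OF f1]
      by (simp add: deriv_by_def algebra_simps)
  qed
  have \<omega>eq: "below K a v \<longrightarrow> \<omega>1 a = \<omega>2 a" for a
  proof (induction a rule: pcone_induct[OF K])
    case (1 a)
    show ?case
    proof (cases "a = 0")
      case False
      show ?thesis
      proof
        assume a: "below K a v"
        have "of_int (\<delta> a) * (B1 a - B2 a) = \<omega>1 a - \<omega>2 a"
          using 1 a False below_trans[OF K _ a] eq by (intro step) (auto simp: below_def)
        then show "\<omega>1 a = \<omega>2 a" using eq(2)[OF a] by simp
      qed
    qed (simp add: z)
  qed
  show ?thesis unfolding gB using step[OF v] \<omega>eq eq(2) by simp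
qed

lemma attractor_solution:
  fixes \<delta> :: "'v \<Rightarrow> int"
  assumes K: "pcone K" and \<delta>: "\<And>a b. \<delta> (a + b) = \<delta> a + \<delta> b" "\<And>v. v \<in> K \<Longrightarrow> v \<noteq> 0 \<Longrightarrow> \<delta> v \<noteq> 0"
  obtains g where "supp g \<subseteq> K" "g 0 = 1" "\<And>v. v \<in> K \<Longrightarrow> v \<noteq> 0 \<Longrightarrow> v \<in> X \<Longrightarrow> g v = \<tau> v"
    "\<And>v. v \<in> K \<Longrightarrow> v \<noteq> 0 \<Longrightarrow> v \<notin> X \<Longrightarrow> attr K g v"
proof -
  define W where "W g v = (SOME \<omega>. attractor_coeff \<delta> K g v \<omega>)" for g v
  have W: "attractor_coeff \<delta> K g v (W g v)" if "supp g \<subseteq> K" "g 0 = 1" for g v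
    unfolding W_def using attractor_coeff_exists[OF K that] by (rule someI_ex)
  define \<Psi> where "\<Psi> g v = (if v \<in> X then g v else W g v v / of_int (\<delta> v))" for g v
  have "\<exists>g. supp g \<subseteq> K \<and> g 0 = 1 \<and> (\<forall>v\<in>K. v \<noteq> 0 \<longrightarrow> \<Psi> g v = (if v \<in> X then \<tau> v else 0))"
  proof (rule triangular_solve[OF K])
    fix F1 F2 u assume *: "supp F1 \<subseteq> K" "supp F2 \<subseteq> K" "F1 0 = 1" "F2 0 = 1" "u \<in> K" "u \<noteq> 0"
      "\<And>a. below K a u \<Longrightarrow> F1 a = F2 a"
    have "W F1 u u - W F2 u u = of_int (\<delta> u) * (F1 u - F2 u)"
      by (rule attractor_coeff_diff[OF K W[OF *(1,3)] W[OF *(2,4)] *(5,6) \<delta>(1) *(7)])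
    then show "\<Psi> F1 u - \<Psi> F2 u = F1 u - F2 u"
      using \<delta>(2)[OF *(5,6)] by (auto simp: \<Psi>_def simp flip: diff_divide_distrib)
  qed
  then obtain g where g: "supp g \<subseteq> K" "g 0 = 1"
    and sol: "\<And>v. v\<in>K \<Longrightarrow> v \<noteq> 0 \<Longrightarrow> \<Psi> g v = (if v \<in> X then \<tau> v else 0)" by blast
  show ?thesis
  proof (rule that[OF g])
    show "g v = \<tau> v" if "v \<in> K" "v \<noteq> 0" "v \<in> X" for v using sol[OF that(1,2)] that by (simp add: \<Psi>_def)
    show "attr K g v" if v: "v \<in> K" "v \<noteq> 0" "v \<notin> X" for v
    proof -
      have "W g v v = 0" using sol[OF v(1,2)] v \<delta>(2)[OF v(1,2)] by (simp add: \<Psi>_def)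
      then show ?thesis unfolding attr_def using W[OF g] \<delta>(2)[OF v(1,2)] \<delta>(1) by blast
    qed
  qed
qed

text \<open>Indecomposability of \<open>v\<close> in \<open>M\<close> leaves only the two extreme
  terms of every product at \<open>v\<close>. Then \<open>\<omega> v = 0\<close> forces
  \<open>B v = 0\<close>, and the outer factors vanish at \<open>v\<close> because
  \<open>w v v = 0\<close>. The vector \<open>v\<close> itself may belong to \<open>M\<close>, as
  happens when a support bound is known only up to some depth.\<close>

lemma attractor_vanishing:
  assumes K: "pcone K" and f: "fact K v A B C" and l: "log_deriv \<delta> K v B \<omega>" and "\<omega> v = 0" "\<delta> v \<noteq> 0"
    and M: "0 \<in> M" "\<And>a b. a \<in> M \<Longrightarrow> b \<in> M \<Longrightarrow> a + b \<in> M" and ABC: "supp (A \<star> B \<star> C) \<subseteq> M"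
    and v: "v \<in> K" "v \<noteq> 0" and indec: "\<And>a b. a \<in> M \<Longrightarrow> b \<in> M \<Longrightarrow> a + b = v \<Longrightarrow> a = 0 \<or> b = 0"
    and \<delta>: "\<And>a b. \<delta> (a + b) = \<delta> a + \<delta> b"
  shows "(A \<star> B \<star> C) v = 0"
proof -
  note s = fact_supp[OF f] and o = fact_0[OF f]
  have sM: "supp A \<subseteq> M" "supp B \<subseteq> M" "supp C \<subseteq> M"
    by (rule conv3_supports[OF K s o fact_disjoint[OF f] M ABC]; assumption)+
  have \<omega>M: "supp \<omega> \<subseteq> M" by (rule log_deriv_supports[OF K sM(2) s(2) o(2) l M])
  have split: "(F \<star> G) v = F v * G 0 + F 0 * G v" if "supp F \<subseteq> M" "supp G \<subseteq> M" "supp F \<subseteq> K" "supp G \<subseteq> K" for F G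
  proof -
    have "F a * G (v - a) = 0" if "a \<notin> {0, v}" for a
      using indec[of a "v - a"] that \<open>supp F \<subseteq> M\<close> \<open>supp G \<subseteq> M\<close> by (force simp: supp_def)
    then have "(\<Sum>a\<in>{a\<in>K. v - a \<in> K} - {0, v}. 2 powi w a v * F a * G (v - a)) = 0"
      by (intro sum.neutral) (auto simp: mult.assoc)
    then show ?thesis using conv_top[OF K that(3,4) v] by simp
  qed
  have "\<delta> 0 = 0" using \<delta>[of 0 0] by simp
  have d: "deriv_by \<delta> B = \<omega> \<star> B" and sw: "supp \<omega> \<subseteq> K" using l by (auto simp: log_deriv_def)
  have "\<omega> 0 = 0" using fun_cong[OF d, of 0] \<open>\<delta> 0 = 0\<close> o by (simp add: conv_0[OF K sw s(2)] deriv_by_def)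
  then have "of_int (\<delta> v) * B v = 0"
    using fun_cong[OF d, of v] split[OF \<omega>M sM(2) sw s(2)] o \<open>\<omega> v = 0\<close> by (simp add: deriv_by_def)
  then have "B v = 0" using \<open>\<delta> v \<noteq> 0\<close> by simp
  moreover have "A v = 0" "C v = 0" using f v by (auto simp: fact_def supp_def)
  moreover have "supp (B \<star> C) \<subseteq> M" by (rule supp_conv[OF sM(2,3) M(2)])
  ultimately show ?thesis
    using split[OF sM(1) _ s(1) supp_conv_pcone[OF K s(2,3)]] split[OF sM(2,3) s(2,3)] o by simp
qed

end

unbundle fps_syntax

section \<open>The quantum dilogarithm\<close>

text \<open>Coefficients of the quantum dilogarithm at \<open>q = 2\<close>.\<close>

fun qdil :: "nat \<Rightarrow> rat" where
  "qdil 0 = 1"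
| "qdil (Suc n) = qdil n * (2 / (4 ^ Suc n - 1))"

definition qdil_fps :: "rat \<Rightarrow> rat fps" where
  "qdil_fps a = Abs_fps (\<lambda>i. qdil i * a ^ i)"

lemma qdil_rec: "qdil (Suc n) * 4 ^ Suc n = qdil (Suc n) + 2 * qdil n"
proof -
  have "(4::rat) ^ Suc n > 1" by (rule one_less_power) auto
  then have "qdil (Suc n) * (4 ^ Suc n - 1) = 2 * qdil n" by simp
  then show ?thesis by (simp only: right_diff_distrib mult_1_right)
qed

lemma qdil_pos: "qdil n > 0"
proof (induction n)
  case (Suc n)
  have "(4::rat) ^ Suc n > 1" by (rule one_less_power) auto
  then show ?case using Suc by simp
qed simp

text \<open>The functional equation \<open>E(q^2 x) = (1 + q x) E(x)\<close>. Iterating it turns the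
  ratio of the dilogarithms at \<open>2 ^ r\<close> and \<open>1 / 2 ^ r\<close> into a polynomial
  of degree \<open>r\<close>, the source of the finite support bounds.\<close>

lemma qdil_fps_4: "qdil_fps (4 * a) = (1 + fps_const (2 * a) * fps_X) * qdil_fps a"
proof (rule fps_ext)
  fix n show "qdil_fps (4 * a) $ n = ((1 + fps_const (2 * a) * fps_X) * qdil_fps a) $ n"
  proof (cases n)
    case 0 then show ?thesis by (simp add: qdil_fps_def algebra_simps)
  next
    case (Suc m)
    have "((1 + fps_const (2 * a) * fps_X) * qdil_fps a) $ Suc m
        = qdil (Suc m) * a ^ Suc m + 2 * a * (qdil m * a ^ m)"
      by (simp only: distrib_right mult_1_left mult.assoc fps_add_nth fps_mult_left_const_nth) (simp add: qdil_fps_def)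
    also have "\<dots> = (qdil (Suc m) + 2 * qdil m) * a ^ Suc m" by (simp add: algebra_simps del: qdil.simps)
    also have "\<dots> = qdil (Suc m) * 4 ^ Suc m * a ^ Suc m" by (simp only: qdil_rec)
    also have "\<dots> = qdil (Suc m) * (4 * a) ^ Suc m" by (simp only: power_mult_distrib mult.assoc)
    finally show ?thesis by (simp add: Suc qdil_fps_def del: qdil.simps)
  qed
qed

lemma qdil_fps_nonzero: "qdil_fps a \<noteq> 0"
proof
  assume "qdil_fps a = 0"
  then have "qdil_fps a $ 0 = 0" by simp
  then show False by (simp add: qdil_fps_def)
qed

section \<open>Bounded degree and reversal of polynomials\<close>

definition fdeg :: "nat \<Rightarrow> rat fps \<Rightarrow> bool" where
  "fdeg N F \<longleftrightarrow> (\<forall>j>N. F $ j = 0)"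

text \<open>The reciprocal polynomial \<open>x^N F(1/x)\<close>. The bound \<open>N\<close> is
  explicit and need not be the actual degree, so that reversal is a fixed reflection of a lattice
  line.\<close>

definition rev_fps :: "nat \<Rightarrow> rat fps \<Rightarrow> rat fps" where
  "rev_fps N F = Abs_fps (\<lambda>j. if j \<le> N then F $ (N - j) else 0)"

lemma linear_factor_nth:
  fixes F :: "rat fps"
  shows "((1 + fps_const a * fps_X) * F) $ j = F $ j + (if j = 0 then 0 else a * F $ (j - 1))"
  by (simp only: distrib_right mult_1_left mult.assoc fps_add_nth fps_mult_left_const_nth) simp

lemma linear_factor_nth':
  fixes F :: "rat fps"
  shows "((fps_X + fps_const a) * F) $ j = (if j = 0 then 0 else F $ (j - 1)) + a * F $ j"
  by (simp only: distrib_right mult_1_left mult.assoc fps_add_nth fps_mult_left_const_nth) simp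

lemma linear_factor_rev:
  assumes "fdeg N F"
  shows "fdeg (Suc N) ((1 + fps_const a * fps_X) * F)"
    and "rev_fps (Suc N) ((1 + fps_const a * fps_X) * F) = (fps_X + fps_const a) * rev_fps N F"
proof -
  show "fdeg (Suc N) ((1 + fps_const a * fps_X) * F)"
    using assms by (auto simp: fdeg_def linear_factor_nth)
  have "rev_fps (Suc N) ((1 + fps_const a * fps_X) * F) $ j = ((fps_X + fps_const a) * rev_fps N F) $ j" for j
    using assms by (cases j; cases "j \<le> N"; cases "j = Suc N")
      (auto simp: fdeg_def linear_factor_nth linear_factor_nth' rev_fps_def Suc_diff_le)
  then show "rev_fps (Suc N) ((1 + fps_const a * fps_X) * F) = (fps_X + fps_const a) * rev_fps N F"
    by (rule fps_ext)
qed

lemma linear_factors_rev: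
  assumes "fdeg N F"
  shows "fdeg (N + r) ((\<Prod>i<r. 1 + fps_const (a i) * fps_X) * F)
    \<and> rev_fps (N + r) ((\<Prod>i<r. 1 + fps_const (a i) * fps_X) * F) = (\<Prod>i<r. fps_X + fps_const (a i)) * rev_fps N F"
proof (induction r)
  case (Suc r)
  have "(\<Prod>i<Suc r. 1 + fps_const (a i) * fps_X) * F
      = (1 + fps_const (a r) * fps_X) * ((\<Prod>i<r. 1 + fps_const (a i) * fps_X) * F)"
    by (simp add: mult_ac)
  then show ?case using linear_factor_rev[OF conjunct1[OF Suc], of "a r"] Suc by (simp add: mult_ac)
qed (use assms in simp)

text \<open>The factors are \<open>1 + 2 powi (2 i + 1 - r) x\<close>, with exponents running
  symmetrically from \<open>1 - r\<close> to \<open>r - 1\<close> in steps of two.\<close>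

definition qfac :: "nat \<Rightarrow> rat fps" where
  "qfac r = (\<Prod>i<r. 1 + fps_const (2 * 4 ^ i / 2 ^ r) * fps_X)"

lemma qdil_fps_ratio: "qdil_fps (2 ^ r) = qfac r * qdil_fps (1 / 2 ^ r)"
proof -
  have "qdil_fps (4 ^ m / 2 ^ r) = (\<Prod>i<m. 1 + fps_const (2 * 4 ^ i / 2 ^ r) * fps_X) * qdil_fps (1 / 2 ^ r)" for m
  proof (induction m)
    case (Suc m)
    have "qdil_fps (4 ^ Suc m / 2 ^ r) = (1 + fps_const (2 * (4 ^ m / 2 ^ r)) * fps_X) * qdil_fps (4 ^ m / 2 ^ r)"
      using qdil_fps_4[of "4 ^ m / 2 ^ r"] by simp
    then show ?case using Suc by (simp add: mult_ac)
  qed simp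
  from this[of r] have "qdil_fps (4 ^ r / 2 ^ r) = qfac r * qdil_fps (1 / 2 ^ r)" by (simp add: qfac_def)
  moreover have "(4::rat) ^ r / 2 ^ r = 2 ^ r" by (simp flip: power_divide)
  ultimately show ?thesis by simp
qed

text \<open>The coefficients at \<open>i\<close> and \<open>r - Suc i\<close> are inverse to each
  other, so inversion permutes the roots, and the product of all coefficients is 1. This symmetry is
  what relates the dilogarithms at \<open>e\<close> and \<open>- e\<close>.\<close>

lemma qfac_palindromic: "(\<Prod>i<r. fps_X + fps_const (2 * 4 ^ i / 2 ^ r)) = qfac r"
proof -
  define a where "a i = (2 * 4 ^ i / 2 ^ r :: rat)" for i
  have pos: "a i > 0" for i by (simp add: a_def)
  have inv: "a i * a (r - Suc i) = 1" if "i < r" for i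
  proof -
    obtain k where r: "r = Suc (i + k)" using \<open>i < r\<close> less_imp_Suc_add by blast
    have "a i * a (r - Suc i) = (4 ^ Suc (i + k)) / (2 ^ r * 2 ^ r)"
      unfolding a_def r by (simp add: power_add)
    also have "\<dots> = 1" unfolding r by (simp flip: power_mult_distrib)
    finally show ?thesis .
  qed
  have "(\<Prod>i<r. a i) * (\<Prod>i<r. a (r - Suc i)) = 1"
    by (simp add: inv flip: prod.distrib)
  moreover have "(\<Prod>i<r. a (r - Suc i)) = (\<Prod>i<r. a i)" by (rule prod.nat_diff_reindex)
  ultimately have "(\<Prod>i<r. a i)\<^sup>2 = 1" by (simp add: power2_eq_square)
  moreover have "(\<Prod>i<r. a i) > 0" by (intro prod_pos) (simp add: pos)
  ultimately have one: "(\<Prod>i<r. a i) = 1" by (simp add: power2_eq_1_iff)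
  have "fps_X + fps_const (a i) = fps_const (a i) * (1 + fps_const (a (r - Suc i)) * fps_X)" if "i < r" for i
    by (simp add: distrib_left inv[OF that] mult.assoc[symmetric] fps_const_mult[symmetric] del: fps_const_mult)
      (simp add: inv[OF that])
  then have "(\<Prod>i<r. fps_X + fps_const (a i))
      = (\<Prod>i<r. fps_const (a i)) * (\<Prod>i<r. 1 + fps_const (a (r - Suc i)) * fps_X)"
    by (simp flip: prod.distrib)
  also have "(\<Prod>i<r. 1 + fps_const (a (r - Suc i)) * fps_X) = (\<Prod>i<r. 1 + fps_const (a i) * fps_X)"
    by (rule prod.nat_diff_reindex)
  also have "(\<Prod>i<m. fps_const (a i)) = fps_const (\<Prod>i<m. a i)" for m
    by (induction m) auto
  finally have "(\<Prod>i<r. fps_X + fps_const (a i)) = (\<Prod>i<r. 1 + fps_const (a i) * fps_X)"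
    unfolding one by simp
  then show ?thesis by (simp only: qfac_def a_def)
qed

text \<open>The relation says \<open>G = qfac r * F\<close>. Multiplication by a palindromic
  polynomial of degree \<open>r\<close> raises the degree bound by \<open>r\<close> and commutes
  with reversal.\<close>

lemma qdil_transfer_nat:
  assumes "fdeg N F" and "qdil_fps (2 ^ r) * F = qdil_fps (1 / 2 ^ r) * G"
  shows "fdeg (N + r) G" and "qdil_fps (1 / 2 ^ r) * rev_fps (N + r) G = qdil_fps (2 ^ r) * rev_fps N F"
proof -
  have "qdil_fps (1 / 2 ^ r) * (qfac r * F) = qdil_fps (1 / 2 ^ r) * G"
    using assms(2) by (simp add: qdil_fps_ratio mult_ac)
  then have G: "G = qfac r * F" using qdil_fps_nonzero by simp
  show "fdeg (N + r) G"
    unfolding G qfac_def using linear_factors_rev[OF assms(1), of r "\<lambda>i. 2 * 4 ^ i / 2 ^ r"] by blast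
  have "rev_fps (N + r) G = qfac r * rev_fps N F"
    unfolding G using linear_factors_rev[OF assms(1), of r "\<lambda>i. 2 * 4 ^ i / 2 ^ r"]
    by (simp add: qfac_palindromic) (simp add: qfac_def)
  then show "qdil_fps (1 / 2 ^ r) * rev_fps (N + r) G = qdil_fps (2 ^ r) * rev_fps N F"
    by (simp add: qdil_fps_ratio mult_ac)
qed

lemma qdil_fdeg_transfer:
  assumes "qdil_fps (2 powi r) * F = qdil_fps (2 powi - r) * G" and "fdeg N F" and "r \<ge> 0" and "int N' = int N + r"
  shows "fdeg N' G"
proof -
  obtain k where r: "r = int k" using \<open>r \<ge> 0\<close> zero_le_imp_eq_int by blast
  have "fdeg (N + k) G"
    using assms(1) by (intro qdil_transfer_nat[OF assms(2)]) (simp add: r power_int_minus field_simps)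
  moreover have "N' = N + k" using assms(4) r by simp
  ultimately show ?thesis by simp
qed

lemma qdil_rev_transfer:
  assumes "qdil_fps (2 powi r) * F = qdil_fps (2 powi - r) * G" and "fdeg N F" "fdeg N' G" and "int N' = int N + r"
  shows "qdil_fps (2 powi - r) * rev_fps N' G = qdil_fps (2 powi r) * rev_fps N F"
proof (cases "r \<ge> 0")
  case True
  then obtain k where r: "r = int k" using zero_le_imp_eq_int by blast
  have "N' = N + k" using assms(4) r by simp
  then show ?thesis using qdil_transfer_nat(2)[OF assms(2), of k G] assms(1) by (simp add: r power_int_minus field_simps)
next
  case False
  then obtain k where "- r = int k" using zero_le_imp_eq_int[of "- r"] by auto
  then have r: "r = - int k" by simp
  have "N = N' + k" using assms(4) r by simp
  then show ?thesis using qdil_transfer_nat(2)[OF assms(3), of k F] assms(1) by (simp add: r power_int_minus field_simps)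
qed

section \<open>Dilogarithms in the twisted algebra\<close>

definition sm :: "int \<Rightarrow> (nat \<Rightarrow> int) \<Rightarrow> nat \<Rightarrow> int" where
  "sm m v = (\<lambda>j. m * v j)"

lemma sm_apply: "sm m v j = m * v j" by (simp add: sm_def)
lemma sm_add_left: "sm (a + b) v = sm a v + sm b v" by (auto simp: sm_def algebra_simps)
lemma sm_add_right: "sm a (u + v) = sm a u + sm a v" by (auto simp: sm_def algebra_simps)
lemma sm_diff_left: "sm (a - b) v = sm a v - sm b v" by (auto simp: sm_def algebra_simps)
lemma sm_0 [simp]: "sm 0 v = 0" by (auto simp: sm_def)
lemma sm_1 [simp]: "sm 1 v = v" by (auto simp: sm_def)
lemma sm_zero [simp]: "sm m 0 = 0" by (auto simp: sm_def)
lemma sm_minus_left: "sm (- a) v = - sm a v" by (auto simp: sm_def)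
lemma sm_minus_right: "sm a (- v) = - sm a v" by (auto simp: sm_def)
lemma sm_sm: "sm a (sm b v) = sm (a * b) v" by (auto simp: sm_def)

declare plus_fun_apply [simp del] zero_fun_apply [simp del]

lemma sm_eq_0_iff: "sm m v = 0 \<longleftrightarrow> m = 0 \<or> v = 0"
  by (auto simp: sm_def fun_eq_iff zero_fun_apply)

lemma sm_cancel: "v \<noteq> 0 \<Longrightarrow> sm a v = sm b v \<longleftrightarrow> a = b"
  using sm_eq_0_iff[of "a - b" v] by (auto simp: sm_diff_left)

lemma additive_sm:
  fixes f :: "(nat \<Rightarrow> int) \<Rightarrow> int"
  assumes "\<And>a b. f (a + b) = f a + f b"
  shows "f (sm m a) = m * f a"
proof -
  have 0: "f 0 = 0" using assms[of 0 0] by simp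
  show ?thesis
  proof (induction m rule: int_induct[of _ 0])
    case (step1 i)
    have "f (sm (i + 1) a) = f (sm i a) + f a" unfolding sm_add_left sm_1 by (rule assms)
    then show ?case using step1 by (simp add: algebra_simps)
  next
    case (step2 i)
    have "f (sm i a) = f (sm (i - 1) a) + f a"
      using assms[of "sm (i - 1) a" a] unfolding sm_diff_left sm_1 by (metis diff_add_cancel)
    then show ?case using step2 by (simp add: algebra_simps)
  qed (simp add: 0)
qed

definition dil :: "(nat \<Rightarrow> int) \<Rightarrow> (nat \<Rightarrow> int) \<Rightarrow> rat" where
  "dil e v = (if \<exists>m. v = sm (int m) e then qdil (SOME m. v = sm (int m) e) else 0)"

lemma dil_sm: "e \<noteq> 0 \<Longrightarrow> dil e (sm (int m) e) = qdil m"
  by (auto simp: dil_def sm_cancel)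

lemma dil_0: "e \<noteq> 0 \<Longrightarrow> dil e 0 = 1"
  using dil_sm[of e 0] by simp

lemma dil_self: "e \<noteq> 0 \<Longrightarrow> dil e e = 2 / 3"
  using dil_sm[of e 1] by simp

lemma dil_nonzeroD: "dil e v \<noteq> 0 \<Longrightarrow> \<exists>m. v = sm (int m) e"
  by (auto simp: dil_def split: if_splits)

lemma sm_nat_mem:
  assumes "0 \<in> M" "\<And>a b. a \<in> M \<Longrightarrow> b \<in> M \<Longrightarrow> a + b \<in> M" "e \<in> M"
  shows "sm (int m) e \<in> M"
proof (induction m)
  case (Suc m)
  have "sm (int (Suc m)) e = sm (int m) e + e" by (simp add: sm_add_left add.commute)
  then show ?case using assms(2)[OF Suc assms(3)] by simp
qed (simp add: assms(1))

lemma supp_dil: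
  assumes "0 \<in> M" "\<And>a b. a \<in> M \<Longrightarrow> b \<in> M \<Longrightarrow> a + b \<in> M" "e \<in> M"
  shows "supp (dil e) \<subseteq> M"
  using sm_nat_mem[OF assms] by (auto simp: supp_def dest!: dil_nonzeroD)

lemma supp_dil_pcone: "pcone K \<Longrightarrow> e \<in> K \<Longrightarrow> supp (dil e) \<subseteq> K"
  by (rule supp_dil) (auto intro: pcone_0 pcone_add)

locale int_form = skew_form w for w :: "(nat \<Rightarrow> int) \<Rightarrow> (nat \<Rightarrow> int) \<Rightarrow> int"
begin

lemma w_sm_left: "w (sm m a) b = m * w a b"
  by (rule additive_sm) (rule w_add_left)

lemma w_sm_right: "w a (sm m b) = m * w a b"
  by (rule additive_sm) (rule w_add_right)

lemma dil_conv:
  assumes e: "e \<noteq> 0" and z: "\<And>i. i > I \<Longrightarrow> h (v - sm (int i) e) = 0"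
  shows "(dil e \<star> h) v = (\<Sum>i\<le>I. qdil i * 2 powi (int i * w e v) * h (v - sm (int i) e))"
proof -
  have "{a. dil e a \<noteq> 0 \<and> h (v - a) \<noteq> 0} \<subseteq> (\<lambda>i. sm (int i) e) ` {..I}"
    using z by (fastforce dest!: dil_nonzeroD simp: not_less[symmetric])
  then have "(dil e \<star> h) v = (\<Sum>a\<in>(\<lambda>i. sm (int i) e) ` {..I}. 2 powi w a v * dil e a * h (v - a))"
    unfolding conv_def by (intro sum.mono_neutral_left) auto
  also have "\<dots> = (\<Sum>i\<le>I. qdil i * 2 powi (int i * w e v) * h (v - sm (int i) e))"
    by (subst sum.reindex) (auto simp: inj_on_def sm_cancel[OF e] dil_sm[OF e] w_sm_left intro!: sum.cong)
  finally show ?thesis .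
qed

lemma conv_dil:
  assumes e: "e \<noteq> 0" and z: "\<And>i. i > I \<Longrightarrow> h (v - sm (int i) e) = 0"
  shows "(h \<star> dil e) v = (\<Sum>i\<le>I. qdil i * 2 powi (- int i * w e v) * h (v - sm (int i) e))"
proof -
  have "{a. h a \<noteq> 0 \<and> dil e (v - a) \<noteq> 0} \<subseteq> (\<lambda>i. v - sm (int i) e) ` {..I}"
  proof
    fix a assume "a \<in> {a. h a \<noteq> 0 \<and> dil e (v - a) \<noteq> 0}"
    then have "h a \<noteq> 0" and "dil e (v - a) \<noteq> 0" by auto
    then obtain m where "v - a = sm (int m) e" using dil_nonzeroD by blast
    then have a: "a = v - sm (int m) e" by (metis add_diff_cancel_left' diff_add_cancel)
    with z \<open>h a \<noteq> 0\<close> have "m \<le> I" by (meson not_le)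
    with a show "a \<in> (\<lambda>i. v - sm (int i) e) ` {..I}" by blast
  qed
  then have "(h \<star> dil e) v = (\<Sum>a\<in>(\<lambda>i. v - sm (int i) e) ` {..I}. 2 powi w a v * h a * dil e (v - a))"
    unfolding conv_def by (intro sum.mono_neutral_left) auto
  also have "\<dots> = (\<Sum>i\<le>I. qdil i * 2 powi (- int i * w e v) * h (v - sm (int i) e))"
    by (subst sum.reindex) (auto simp: inj_on_def sm_cancel[OF e] dil_sm[OF e] w_sm_left w_diff_left intro!: sum.cong)
  finally show ?thesis .
qed

text \<open>Along a line in direction \<open>e\<close> the twist of \<open>e\<close> against the
  running point is the constant \<open>w e v0\<close>, because \<open>w e e = 0\<close>. Left and
  right multiplication by \<open>dil e\<close> thus become products of power series in one variable,
  with opposite exponents.\<close>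

lemma dil_line_fps:
  assumes e: "e \<noteq> 0" and h: "\<And>l. l < 0 \<Longrightarrow> h (v0 + sm l e) = 0"
  shows "(dil e \<star> h) (v0 + sm (int j) e) = (qdil_fps (2 powi w e v0) * Abs_fps (\<lambda>j. h (v0 + sm (int j) e))) $ j"
    and "(h \<star> dil e) (v0 + sm (int j) e) = (qdil_fps (2 powi - w e v0) * Abs_fps (\<lambda>j. h (v0 + sm (int j) e))) $ j"
proof -
  have shift: "v0 + sm (int j) e - sm (int i) e = v0 + sm (int j - int i) e" for i
    by (simp add: sm_diff_left)
  have z: "h (v0 + sm (int j) e - sm (int i) e) = 0" if "i > j" for i
    unfolding shift using that by (intro h) simp
  have *: "{..j} = {0..j}" by auto
  have "(dil e \<star> h) (v0 + sm (int j) e)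
      = (\<Sum>i\<le>j. qdil i * 2 powi (int i * w e (v0 + sm (int j) e)) * h (v0 + sm (int j) e - sm (int i) e))"
    by (rule dil_conv[OF e]) (erule z)
  then show "(dil e \<star> h) (v0 + sm (int j) e) = (qdil_fps (2 powi w e v0) * Abs_fps (\<lambda>j. h (v0 + sm (int j) e))) $ j"
    unfolding fps_mult_nth * shift
    by (auto simp: qdil_fps_def w_add_right w_sm_right power_int_mult of_nat_diff mult.commute[of "int _"] intro!: sum.cong)
  have "(h \<star> dil e) (v0 + sm (int j) e)
      = (\<Sum>i\<le>j. qdil i * 2 powi (- int i * w e (v0 + sm (int j) e)) * h (v0 + sm (int j) e - sm (int i) e))"
    by (rule conv_dil[OF e]) (erule z)
  then show "(h \<star> dil e) (v0 + sm (int j) e) = (qdil_fps (2 powi - w e v0) * Abs_fps (\<lambda>j. h (v0 + sm (int j) e))) $ j"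
    unfolding fps_mult_nth * shift
    by (auto simp: qdil_fps_def w_add_right w_sm_right of_nat_diff power_int_minus power_int_mult mult.commute[of "int _"]
        power_inverse intro!: sum.cong)
qed

lemma dil_line_eq:
  assumes e: "e \<noteq> 0" and h: "\<And>l. l < 0 \<Longrightarrow> h (v0 + sm l e) = 0" and h': "\<And>l. l < 0 \<Longrightarrow> h' (v0 + sm l e) = 0"
    and eq: "dil e \<star> h = h' \<star> dil e"
  shows "qdil_fps (2 powi w e v0) * Abs_fps (\<lambda>j. h (v0 + sm (int j) e))
       = qdil_fps (2 powi - w e v0) * Abs_fps (\<lambda>j. h' (v0 + sm (int j) e))"
  using dil_line_fps(1)[of e h v0, OF e h] dil_line_fps(2)[of e h' v0, OF e h'] eq by (intro fps_ext) (simp add: eq)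

text \<open>On the line, conjugation by \<open>dil e\<close> multiplies by a polynomial of degree
  \<open>w e v0\<close>, or divides by one of degree \<open>- w e v0\<close>. Degree bounds
  therefore travel only in the direction of multiplication: from \<open>h\<close> to
  \<open>h'\<close> if \<open>w e v0 \<ge> 0\<close>, back if \<open>w e v0 \<le> 0\<close>.\<close>

lemma dil_line_degree:
  assumes e: "e \<noteq> 0" and h: "\<And>l. l < 0 \<Longrightarrow> h (v0 + sm l e) = 0" and h': "\<And>l. l < 0 \<Longrightarrow> h' (v0 + sm l e) = 0"
    and eq: "dil e \<star> h = h' \<star> dil e" and N: "N \<ge> 0" "N' \<ge> 0" "N' = N + w e v0"
  shows "w e v0 \<ge> 0 \<Longrightarrow> (\<And>l. l > N \<Longrightarrow> h (v0 + sm l e) = 0) \<Longrightarrow> l > N' \<Longrightarrow> h' (v0 + sm l e) = 0"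
    and "w e v0 \<le> 0 \<Longrightarrow> (\<And>l. l > N' \<Longrightarrow> h' (v0 + sm l e) = 0) \<Longrightarrow> l > N \<Longrightarrow> h (v0 + sm l e) = 0"
proof -
  note rel = dil_line_eq[of e h v0 h', OF e h h' eq]
  show "h' (v0 + sm l e) = 0" if "w e v0 \<ge> 0" "\<And>l. l > N \<Longrightarrow> h (v0 + sm l e) = 0" "l > N'"
  proof -
    have "fdeg (nat N') (Abs_fps (\<lambda>j. h' (v0 + sm (int j) e)))"
      by (rule qdil_fdeg_transfer[OF rel, of "nat N"]) (use that N in \<open>auto simp: fdeg_def nat_less_iff\<close>)
    then have "h' (v0 + sm (int (nat l)) e) = 0" using that N unfolding fdeg_def by (metis fps_nth_Abs_fps nat_mono_iff order.strict_trans1)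
    then show ?thesis using that N by simp
  qed
  show "h (v0 + sm l e) = 0" if "w e v0 \<le> 0" "\<And>l. l > N' \<Longrightarrow> h' (v0 + sm l e) = 0" "l > N"
  proof -
    have rel': "qdil_fps (2 powi (- w e v0)) * Abs_fps (\<lambda>j. h' (v0 + sm (int j) e))
       = qdil_fps (2 powi - (- w e v0)) * Abs_fps (\<lambda>j. h (v0 + sm (int j) e))" using rel by simp
    have "fdeg (nat N) (Abs_fps (\<lambda>j. h (v0 + sm (int j) e)))"
      by (rule qdil_fdeg_transfer[OF rel', of "nat N'"]) (use that N in \<open>auto simp: fdeg_def nat_less_iff\<close>)
    then have "h (v0 + sm (int (nat l)) e) = 0" using that N unfolding fdeg_def by (metis fps_nth_Abs_fps nat_mono_iff order.strict_trans1)
    then show ?thesis using that N by simp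
  qed
qed

text \<open>\<open>E(x) E(x\<^sup>-\<^sup>1)\<close> acts by conjugation as a shear of the lattice; this is what makes
  mutation compatible with the attractor conditions.\<close>

lemma dil_line_shear:
  assumes e: "e \<noteq> 0" and h: "\<And>l. l < 0 \<or> l > N \<Longrightarrow> h (v0 + sm l e) = 0"
    and h': "\<And>l. l < 0 \<or> l > N' \<Longrightarrow> h' (v0 + sm l e) = 0"
    and eq: "dil e \<star> h = h' \<star> dil e" and N: "N \<ge> 0" "N' \<ge> 0" "N' = N + w e v0"
  shows "(dil (- e) \<star> (\<lambda>u. h' (u + sm (w e u) e))) (v0 + sm j e) = (h \<star> dil (- e)) (v0 + sm j e)"
proof -
  define r where "r = w e v0"
  define F where "F = Abs_fps (\<lambda>j. h (v0 + sm (int j) e))"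
  define G where "G = Abs_fps (\<lambda>j. h' (v0 + sm (int j) e))"
  define h2 where "h2 = (\<lambda>u. h' (u + sm (w e u) e))"
  have e': "- e \<noteq> 0" using e by simp
  have rel: "qdil_fps (2 powi r) * F = qdil_fps (2 powi - r) * G"
    unfolding F_def G_def r_def by (rule dil_line_eq[of e h v0 h', OF e _ _ eq]) (auto simp: h h')
  have rev: "qdil_fps (2 powi - r) * rev_fps (nat N') G = qdil_fps (2 powi r) * rev_fps (nat N) F"
    by (rule qdil_rev_transfer[OF rel]) (use N in \<open>auto simp: fdeg_def F_def G_def h h' r_def nat_less_iff\<close>)
  have h2: "h2 (v0 + sm l e) = h' (v0 + sm (l + r) e)" for l
    by (simp add: h2_def w_add_right w_sm_right r_def sm_add_left add.assoc add.left_commute)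
  have shift: "v0 + sm j e - sm (int i) (- e) = v0 + sm (j + int i) e" for i
    by (simp add: sm_minus_right sm_add_left add.assoc)
  \<comment> \<open>The position \<open>j\<close> counted from the upper end \<open>N\<close> of the
    line. Multiplication by \<open>dil (- e)\<close> gathers values from \<open>j\<close> upwards,
    so it becomes a power series product after reversal.\<close>
  define I where "I = nat (N - j)"
  have z: "h (v0 + sm j e - sm (int i) (- e)) = 0" if "i > I" for i
    unfolding shift using that by (intro h) (unfold I_def, linarith)
  have z2: "h2 (v0 + sm j e - sm (int i) (- e)) = 0" if "i > I" for i
    unfolding shift h2 using that N by (intro h') (unfold I_def r_def, linarith)
  have wj: "w (- e) (v0 + sm j e) = - r" by (simp add: w_minus_left w_add_right w_sm_right r_def)
  have "(dil (- e) \<star> h2) (v0 + sm j e)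
      = (\<Sum>i\<le>I. qdil i * 2 powi (int i * w (- e) (v0 + sm j e)) * h2 (v0 + sm j e - sm (int i) (- e)))"
    by (rule dil_conv[OF e']) (erule z2)
  then have L: "(dil (- e) \<star> h2) (v0 + sm j e) = (\<Sum>i\<le>I. qdil i * (2 powi - r) ^ i * h' (v0 + sm (j + int i + r) e))"
    unfolding wj shift h2 by (auto simp: power_int_minus power_int_mult power_inverse mult.commute[of "int _"] intro!: sum.cong)
  have "(h \<star> dil (- e)) (v0 + sm j e)
      = (\<Sum>i\<le>I. qdil i * 2 powi (- int i * w (- e) (v0 + sm j e)) * h (v0 + sm j e - sm (int i) (- e)))"
    by (rule conv_dil[OF e']) (erule z)
  then have R: "(h \<star> dil (- e)) (v0 + sm j e) = (\<Sum>i\<le>I. qdil i * (2 powi r) ^ i * h (v0 + sm (j + int i) e))"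
    unfolding wj shift by (auto simp: power_int_mult mult.commute[of "int _"] intro!: sum.cong)
  show ?thesis
  proof (cases "j > N")
    case True
    then show ?thesis unfolding h2_def[symmetric] L R using N by (simp add: I_def h h' r_def)
  next
    case False
    have *: "{..I} = {0..I}" by auto
    have "(dil (- e) \<star> h2) (v0 + sm j e) = (qdil_fps (2 powi - r) * rev_fps (nat N') G) $ I"
      unfolding L fps_mult_nth * 
    proof (intro sum.cong refl)
      fix i assume "i \<in> {0..I}"
      have "h' (v0 + sm (j + int i + r) e) = rev_fps (nat N') G $ (I - i)"
      proof (cases "I - i \<le> nat N'")
        case True
        then have "int (nat N' - (I - i)) = j + int i + r"
          using \<open>i \<in> {0..I}\<close> False N by (auto simp: I_def r_def)
        then show ?thesis using True by (simp add: rev_fps_def G_def)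
      next
        case F: False
        then have "j + int i + r < 0" using \<open>i \<in> {0..I}\<close> False N by (auto simp: I_def r_def)
        then show ?thesis using F by (simp add: rev_fps_def h')
      qed
      then show "qdil i * (2 powi - r) ^ i * h' (v0 + sm (j + int i + r) e) = qdil_fps (2 powi - r) $ i * rev_fps (nat N') G $ (I - i)"
        by (simp add: qdil_fps_def)
    qed
    moreover have "(h \<star> dil (- e)) (v0 + sm j e) = (qdil_fps (2 powi r) * rev_fps (nat N) F) $ I"
      unfolding R fps_mult_nth * 
    proof (intro sum.cong refl)
      fix i assume "i \<in> {0..I}"
      have "h (v0 + sm (j + int i) e) = rev_fps (nat N) F $ (I - i)"
      proof (cases "I - i \<le> nat N")
        case True
        then have "int (nat N - (I - i)) = j + int i"
          using \<open>i \<in> {0..I}\<close> False N by (auto simp: I_def)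
        then show ?thesis using True by (simp add: rev_fps_def F_def)
      next
        case F: False
        then have "j + int i < 0" using \<open>i \<in> {0..I}\<close> False N by (auto simp: I_def)
        then show ?thesis using F by (simp add: rev_fps_def h)
      qed
      then show "qdil i * (2 powi r) ^ i * h (v0 + sm (j + int i) e) = qdil_fps (2 powi r) $ i * rev_fps (nat N) F $ (I - i)"
        by (simp add: qdil_fps_def)
    qed
    ultimately show ?thesis using rev by (simp add: h2_def)
  qed
qed

end

section \<open>Seeds and their mutation\<close>

definition lattice :: "nat \<Rightarrow> (nat \<Rightarrow> int) set" where
  "lattice n = {v. \<forall>i\<ge>n. v i = 0}"

lemma lattice_0: "0 \<in> lattice n" by (simp add: lattice_def zero_fun_apply)
lemma lattice_add: "a \<in> lattice n \<Longrightarrow> b \<in> lattice n \<Longrightarrow> a + b \<in> lattice n" by (simp add: lattice_def plus_fun_apply)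
lemma lattice_diff: "a \<in> lattice n \<Longrightarrow> b \<in> lattice n \<Longrightarrow> a - b \<in> lattice n" by (simp add: lattice_def)
lemma lattice_sm: "a \<in> lattice n \<Longrightarrow> sm m a \<in> lattice n" by (simp add: lattice_def sm_apply)
lemma lattice_uminus: "a \<in> lattice n \<Longrightarrow> - a \<in> lattice n" by (simp add: lattice_def)

lemma lattice_sum: "(\<And>i. i \<in> I \<Longrightarrow> f i \<in> lattice n) \<Longrightarrow> sum f I \<in> lattice n"
  by (induction I rule: infinite_finite_induct) (auto simp: lattice_0 intro: lattice_add)

section \<open>Lattice bases, dual coordinates and their cones\<close>

definition basis :: "nat \<Rightarrow> (nat \<Rightarrow> nat \<Rightarrow> int) \<Rightarrow> (nat \<Rightarrow> (nat \<Rightarrow> int) \<Rightarrow> int) \<Rightarrow> bool" where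
  "basis n c X \<longleftrightarrow> (\<forall>i<n. c i \<in> lattice n) \<and> (\<forall>i<n. \<forall>a b. X i (a + b) = X i a + X i b)
     \<and> (\<forall>i<n. \<forall>j<n. X i (c j) = (if i = j then 1 else 0))
     \<and> (\<forall>v\<in>lattice n. (\<forall>i<n. X i v = 0) \<longrightarrow> v = 0)"

definition cone :: "nat \<Rightarrow> (nat \<Rightarrow> (nat \<Rightarrow> int) \<Rightarrow> int) \<Rightarrow> (nat \<Rightarrow> int) set" where
  "cone n X = {v \<in> lattice n. \<forall>i<n. 0 \<le> X i v}"

context
  fixes n c X assumes basis: "basis n c X"
begin

lemma basis_add: "i < n \<Longrightarrow> X i (a + b) = X i a + X i b"
  using basis by (simp add: basis_def)

lemma basis_sm: "i < n \<Longrightarrow> X i (sm m a) = m * X i a"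
  by (rule additive_sm) (rule basis_add)

lemma basis_0: "i < n \<Longrightarrow> X i 0 = 0"
  using basis_add[of i 0 0] by simp

lemma basis_diff: "i < n \<Longrightarrow> X i (a - b) = X i a - X i b"
  using basis_add[of i "a - b" b] by simp

lemma basis_uminus: "i < n \<Longrightarrow> X i (- a) = - X i a"
  using basis_diff[of i 0 a] by (simp add: basis_0)

lemma basis_c: "i < n \<Longrightarrow> j < n \<Longrightarrow> X i (c j) = (if i = j then 1 else 0)"
  using basis by (simp add: basis_def)

lemma basis_lattice: "i < n \<Longrightarrow> c i \<in> lattice n"
  using basis by (simp add: basis_def)

lemma basis_inj: "v \<in> lattice n \<Longrightarrow> (\<And>i. i < n \<Longrightarrow> X i v = 0) \<Longrightarrow> v = 0"
  using basis by (auto simp: basis_def)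

lemma basis_eq: "u \<in> lattice n \<Longrightarrow> v \<in> lattice n \<Longrightarrow> (\<And>i. i < n \<Longrightarrow> X i u = X i v) \<Longrightarrow> u = v"
  using basis_inj[of "u - v"] by (auto simp: lattice_diff basis_diff)

lemma basis_c_nonzero: "i < n \<Longrightarrow> c i \<noteq> 0"
  using basis_c[of i i] basis_0[of i] by auto

lemma basis_sum: "i < n \<Longrightarrow> X i (sum f I) = (\<Sum>j\<in>I. X i (f j))"
  by (induction I rule: infinite_finite_induct) (auto simp: basis_0 basis_add)

lemma basis_expand:
  assumes "v \<in> lattice n" shows "v = (\<Sum>j<n. sm (X j v) (c j))"
proof (rule basis_eq[OF assms])
  show "(\<Sum>j<n. sm (X j v) (c j)) \<in> lattice n" by (intro lattice_sum lattice_sm basis_lattice) simp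
  show "X i v = X i (\<Sum>j<n. sm (X j v) (c j))" if "i < n" for i
    using that by (simp add: basis_sum basis_sm basis_c if_distrib cong: if_cong)
qed

lemma cone_sm_mem: "i < n \<Longrightarrow> sm (int m) (c i) \<in> cone n X"
  by (auto simp: cone_def lattice_sm basis_lattice basis_sm basis_c)

lemma cone_c_mem: "i < n \<Longrightarrow> c i \<in> cone n X"
  using cone_sm_mem[of i 1] by simp

lemma cone_pcone: "pcone (cone n X)"
  unfolding pcone_def
proof (intro conjI)
  show "0 \<in> cone n X" by (simp add: cone_def lattice_0 basis_0)
  show "\<forall>a\<in>cone n X. \<forall>b\<in>cone n X. a + b \<in> cone n X" by (simp add: cone_def lattice_add basis_add)
  show "\<forall>v. finite {a \<in> cone n X. v - a \<in> cone n X}"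
  proof
    fix v
    let ?A = "{a \<in> cone n X. v - a \<in> cone n X}"
    let ?f = "\<lambda>a. \<lambda>i\<in>{..<n}. X i a"
    have "?f ` ?A \<subseteq> (\<Pi>\<^sub>E i\<in>{..<n}. {0..X i v})"
      by (intro image_subsetI PiE_I) (auto simp: cone_def basis_diff)
    then have "finite (?f ` ?A)" by (rule finite_subset) (auto intro: finite_PiE)
    moreover have "inj_on ?f ?A"
    proof (rule inj_onI)
      fix a b assume *: "a \<in> ?A" "b \<in> ?A" "?f a = ?f b"
      have "X i a = X i b" if "i < n" for i using fun_cong[OF *(3), of i] that by simp
      then show "a = b" using * by (intro basis_eq) (auto simp: cone_def)
    qed
    ultimately show "finite ?A" by (rule finite_imageD)
  qed
  have "nat (\<Sum>i<n. X i a) < nat (\<Sum>i<n. X i (a + b))" if "a \<in> cone n X" "b \<in> cone n X" "b \<noteq> 0" for a b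
  proof -
    have "\<not> (\<forall>i<n. X i b = 0)" using basis_inj[of b] that by (auto simp: cone_def)
    then obtain i where "i < n" "X i b \<noteq> 0" by blast
    then have "(\<Sum>i<n. X i b) > 0" using that by (intro sum_pos2[of _ i]) (auto simp: cone_def order.strict_iff_order)
    moreover have "(\<Sum>i<n. X i a) \<ge> 0" using that by (intro sum_nonneg) (auto simp: cone_def)
    ultimately show ?thesis by (simp add: basis_add sum.distrib)
  qed
  then show "\<exists>d :: (nat \<Rightarrow> int) \<Rightarrow> nat. \<forall>a\<in>cone n X. \<forall>b\<in>cone n X. b \<noteq> 0 \<longrightarrow> d a < d (a + b)"
    by (intro exI[of _ "\<lambda>a. nat (\<Sum>i<n. X i a)"]) blast
qed

end

section \<open>Logarithmic derivatives of products and conjugation\<close>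

context skew_form
begin

lemma conv_cong_right:
  assumes "\<And>a. f a \<noteq> 0 \<Longrightarrow> g (u - a) = g' (u - a)" shows "(f \<star> g) u = (f \<star> g') u"
  unfolding conv_def using assms by (intro sum.cong) auto

lemma conv_cong_left:
  assumes "\<And>a. g (u - a) \<noteq> 0 \<Longrightarrow> f a = f' a" shows "(f \<star> g) u = (f' \<star> g) u"
  unfolding conv_def using assms by (intro sum.cong) auto

text \<open>The logarithmic derivative of \<open>F \<star> G\<close> is that of \<open>F\<close>
  plus the conjugate by \<open>F\<close> of that of \<open>G\<close>; the trace property removes the
  conjugation at \<open>v\<close>.\<close>

lemma log_deriv_conv:
  assumes K: "pcone K" and F: "supp F \<subseteq> K \<inter> {u. w u v = 0}" "F 0 = 1" and G: "supp G \<subseteq> K \<inter> {u. w u v = 0}"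
    and lF: "log_deriv \<delta> K v F \<omega>" and lG: "log_deriv \<delta> K v G \<eta>" and \<delta>: "\<And>a b. \<delta> (a + b) = \<delta> a + \<delta> b"
  obtains \<theta> where "log_deriv \<delta> K v (F \<star> G) \<theta>" "\<theta> v = \<omega> v + \<eta> v"
proof -
  let ?M = "K \<inter> {u. w u v = 0}"
  have M: "pcone ?M"
    by (rule pcone_subset[OF K]) (use pcone_0[OF K] pcone_add[OF K] in \<open>auto simp: w_add_left\<close>)
  obtain F' where F': "supp F' \<subseteq> ?M" "F \<star> F' = unit" "F' \<star> F = unit" by (rule conv_inverse[OF M F])
  have \<omega>: "supp \<omega> \<subseteq> ?M" "deriv_by \<delta> F = \<omega> \<star> F" and \<eta>: "supp \<eta> \<subseteq> ?M" "deriv_by \<delta> G = \<eta> \<star> G"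
    using lF lG by (auto simp: log_deriv_def)
  note sc = supp_conv_pcone[OF M]
  define \<tau> where "\<tau> = F \<star> \<eta> \<star> F'"
  have \<tau>: "supp \<tau> \<subseteq> ?M" unfolding \<tau>_def by (intro sc F(1) \<eta>(1) F'(1))
  have "\<tau> v = ((\<eta> \<star> F') \<star> F) v"
    unfolding \<tau>_def by (rule conv_trace[OF K F(1) sc[OF \<eta>(1) F'(1)]])
  also have "(\<eta> \<star> F') \<star> F = \<eta>" by (simp add: conv_assoc[OF M \<eta>(1) F'(1) F(1)] F')
  finally have \<tau>v: "\<tau> v = \<eta> v" .
  have "\<tau> \<star> F \<star> G = F \<star> \<eta> \<star> F' \<star> F \<star> G"
    unfolding \<tau>_def
    by (simp only: conv_assoc[OF M F(1) sc[OF \<eta>(1) F'(1)] sc[OF F(1) G]] conv_assoc[OF M \<eta>(1) F'(1) sc[OF F(1) G]])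
  also have "F' \<star> F \<star> G = G" by (simp add: conv_assoc[OF M F'(1) F(1) G, symmetric] F')
  finally have \<tau>FG: "\<tau> \<star> F \<star> G = F \<star> \<eta> \<star> G" .
  have "deriv_by \<delta> (F \<star> G) = deriv_by \<delta> F \<star> G + F \<star> deriv_by \<delta> G"
    by (rule deriv_by_conv[OF M F(1) G \<delta>])
  also have "\<dots> = \<omega> \<star> F \<star> G + \<tau> \<star> F \<star> G"
    by (simp add: \<omega>(2) \<eta>(2) \<tau>FG conv_assoc[OF M \<omega>(1) F(1) G])
  also have "\<dots> = (\<omega> + \<tau>) \<star> F \<star> G"
    by (rule conv_add_left[OF M \<omega>(1) \<tau> sc[OF F(1) G], symmetric])
  finally have "deriv_by \<delta> (F \<star> G) = (\<omega> + \<tau>) \<star> F \<star> G" .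
  moreover have "supp (\<omega> + \<tau>) \<subseteq> ?M"
  proof (rule suppI)
    fix u assume u: "u \<notin> ?M"
    show "(\<omega> + \<tau>) u = 0"
      by (simp only: plus_fun_apply supp_outside[OF \<omega>(1) u] supp_outside[OF \<tau> u] add_0)
  qed
  ultimately have "log_deriv \<delta> K v (F \<star> G) (\<omega> + \<tau>)" unfolding log_deriv_def by (intro conjI)
  moreover have "(\<omega> + \<tau>) v = \<omega> v + \<eta> v" by (simp add: plus_fun_apply \<tau>v)
  ultimately show ?thesis by (rule that)
qed

text \<open>Conjugation by series orthogonal to \<open>v\<close> preserves the grading by
  \<open>w u v\<close>; in grade 0 the series \<open>F\<close> is the unit and stays so. The sign
  \<open>s\<close> covers both outer factors.\<close>

lemma conj_support:
  assumes K: "pcone K" and U: "supp U \<subseteq> K \<inter> {u. w u v = 0}" and V: "supp V \<subseteq> K \<inter> {u. w u v = 0}"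
    and UV: "U \<star> V = unit" and F: "supp F \<subseteq> K \<inter> {u. u = 0 \<or> s * w u v > 0}" "F 0 = 1"
  shows "supp (U \<star> F \<star> V) \<subseteq> K \<inter> {u. u = 0 \<or> s * w u v > 0}" and "(U \<star> F \<star> V) 0 = 1"
proof -
  let ?H = "K \<inter> {u. s * w u v \<ge> 0}"
  have H: "supp (U \<star> F \<star> V) \<subseteq> ?H"
    by (intro supp_conv) (use U V F pcone_add[OF K] in \<open>auto simp: w_add_left distrib_left\<close>)
  have level: "(U \<star> F \<star> V) u = unit u" if "s * w u v = 0" for u
  proof -
    have "(U \<star> F \<star> V) u = (U \<star> V) u"
    proof (rule conv_cong_right)
      fix a assume "U a \<noteq> 0"
      then have a: "w a v = 0" using U by (auto simp: supp_def)
      have "(F \<star> V) (u - a) = (unit \<star> V) (u - a)"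
      proof (rule conv_cong_left)
        fix b assume "V (u - a - b) \<noteq> 0"
        then have "w (u - a - b) v = 0" using V by (auto simp: supp_def)
        then have "s * w b v = 0" using a that by (simp add: w_diff_left)
        then show "F b = unit b" using F by (auto simp: supp_def unit_def)
      qed
      then show "(F \<star> V) (u - a) = V (u - a)" by simp
    qed
    then show ?thesis by (simp add: UV)
  qed
  show "(U \<star> F \<star> V) 0 = 1" by (simp add: level)
  show "supp (U \<star> F \<star> V) \<subseteq> K \<inter> {u. u = 0 \<or> s * w u v > 0}"
  proof
    fix u assume u: "u \<in> supp (U \<star> F \<star> V)"
    then have "u \<in> K" "s * w u v \<ge> 0" using H by auto
    moreover have "u = 0" if "s * w u v = 0"
      using u level[OF that] by (simp add: supp_def unit_def split: if_splits)
    ultimately show "u \<in> K \<inter> {u. u = 0 \<or> s * w u v > 0}" by auto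
  qed
qed

end

context int_form
begin

text \<open>Following Kontsevich and Soibelman, the Donaldson--Thomas series of a seed is determined by its
  attractor data: dilogarithms at the basis vectors and nothing elsewhere.\<close>

definition is_DT :: "nat \<Rightarrow> (nat \<Rightarrow> nat \<Rightarrow> int) \<Rightarrow> (nat \<Rightarrow> (nat \<Rightarrow> int) \<Rightarrow> int) \<Rightarrow> ((nat \<Rightarrow> int) \<Rightarrow> rat) \<Rightarrow> bool" where
  "is_DT n c X g \<longleftrightarrow> supp g \<subseteq> cone n X \<and> g 0 = 1 \<and> (\<forall>i<n. \<forall>m. g (sm (int m) (c i)) = qdil m)
     \<and> (\<forall>v\<in>cone n X. v \<noteq> 0 \<longrightarrow> (\<forall>i<n. \<forall>m. v \<noteq> sm (int m) (c i)) \<longrightarrow> attr (cone n X) g v)"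

text \<open>The mutation rule for \<open>c\<close>-vectors with the sign fixed as for green
  \<open>k\<close>.\<close>

definition mut_basis :: "nat \<Rightarrow> (nat \<Rightarrow> nat \<Rightarrow> int) \<Rightarrow> nat \<Rightarrow> nat \<Rightarrow> int" where
  "mut_basis k c j = (if j = k then - c k else c j + sm (max (w (c j) (c k)) 0) (c k))"

text \<open>The upper bound that the mutated cone puts on the \<open>k\<close>-th
  coordinate.\<close>

definition inflow :: "nat \<Rightarrow> nat \<Rightarrow> (nat \<Rightarrow> nat \<Rightarrow> int) \<Rightarrow> (nat \<Rightarrow> (nat \<Rightarrow> int) \<Rightarrow> int) \<Rightarrow> (nat \<Rightarrow> int) \<Rightarrow> int" where
  "inflow n k c X v = (\<Sum>j<n. max (w (c j) (c k)) 0 * X j v)"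

definition mut_coord :: "nat \<Rightarrow> nat \<Rightarrow> (nat \<Rightarrow> nat \<Rightarrow> int) \<Rightarrow> (nat \<Rightarrow> (nat \<Rightarrow> int) \<Rightarrow> int) \<Rightarrow> nat \<Rightarrow> (nat \<Rightarrow> int) \<Rightarrow> int" where
  "mut_coord n k c X i v = (if i = k then inflow n k c X v - X k v else X i v)"

lemma inflow_add: "basis n c X \<Longrightarrow> inflow n k c X (a + b) = inflow n k c X a + inflow n k c X b"
  by (simp add: inflow_def basis_add sum.distrib distrib_left)

lemma inflow_sm: "basis n c X \<Longrightarrow> inflow n k c X (sm m a) = m * inflow n k c X a"
  by (rule additive_sm) (rule inflow_add)

lemma inflow_c:
  assumes "basis n c X" "j < n" shows "inflow n k c X (c j) = max (w (c j) (c k)) 0"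
proof -
  have "inflow n k c X (c j) = (\<Sum>i<n. if i = j then max (w (c j) (c k)) 0 else 0)"
    unfolding inflow_def using assms by (intro sum.cong) (auto simp: basis_c)
  then show ?thesis using assms by simp
qed

text \<open>Because \<open>max x 0 - x = max (- x) 0\<close>, subtracting \<open>w v (c k)\<close>
  turns the bound for this mutation into the one for the mutation of opposite sign. Both are
  nonnegative on the cone.\<close>

lemma inflow_minus_w:
  assumes b: "basis n c X" and v: "v \<in> lattice n"
  shows "inflow n k c X v - w v (c k) = (\<Sum>j<n. max (- w (c j) (c k)) 0 * X j v)"
proof -
  have "w (\<Sum>j\<in>J. f j) (c k) = (\<Sum>j\<in>J. w (f j) (c k))" for f :: "nat \<Rightarrow> nat \<Rightarrow> int" and J
    by (induction J rule: infinite_finite_induct) (auto simp: w_add_left)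
  then have "w (\<Sum>j<n. sm (X j v) (c j)) (c k) = (\<Sum>j<n. X j v * w (c j) (c k))"
    by (simp add: w_sm_left)
  then have "w v (c k) = (\<Sum>j<n. X j v * w (c j) (c k))" using basis_expand[OF b v] by simp
  then have "inflow n k c X v - w v (c k) = (\<Sum>j<n. max (w (c j) (c k)) 0 * X j v - X j v * w (c j) (c k))"
    by (simp add: inflow_def sum_subtractf)
  also have "\<dots> = (\<Sum>j<n. max (- w (c j) (c k)) 0 * X j v)"
    by (intro sum.cong) (auto simp: max_def algebra_simps)
  finally show ?thesis .
qed

lemma basis_mut:
  assumes b: "basis n c X" and k: "k < n"
  shows "basis n (mut_basis k c) (mut_coord n k c X)"
  unfolding basis_def
proof (intro conjI allI impI ballI)
  fix i assume i: "i < n"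
  show "mut_basis k c i \<in> lattice n"
    using i k by (auto simp: mut_basis_def intro!: lattice_uminus lattice_add lattice_sm basis_lattice[OF b])
  show "mut_coord n k c X i (u + v) = mut_coord n k c X i u + mut_coord n k c X i v" for u v
    using i k by (simp add: mut_coord_def basis_add[OF b] inflow_add[OF b])
  fix j assume j: "j < n"
  have N: "inflow n k c X (- c k) = 0"
    using inflow_sm[OF b, of k "-1" "c k"] inflow_c[OF b k, of k] by (simp add: sm_minus_left)
  show "mut_coord n k c X i (mut_basis k c j) = (if i = j then 1 else 0)"
  proof (cases "j = k")
    case True
    then show ?thesis using i k by (simp add: mut_coord_def mut_basis_def N basis_uminus[OF b] basis_c[OF b])
  next
    case False
    have "inflow n k c X (c j + sm m (c k)) = max (w (c j) (c k)) 0" for m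
      by (simp add: inflow_add[OF b] inflow_sm[OF b] inflow_c[OF b j] inflow_c[OF b k])
    then show ?thesis using False i j k
      by (simp add: mut_coord_def mut_basis_def basis_add[OF b] basis_sm[OF b] basis_c[OF b])
  qed
next
  fix v assume v: "v \<in> lattice n" "\<forall>i<n. mut_coord n k c X i v = 0"
  have X: "X i v = 0" if "i < n" "i \<noteq> k" for i using v(2)[rule_format, OF that(1)] that by (simp add: mut_coord_def)
  have "max (w (c j) (c k)) 0 * X j v = 0" if "j < n" for j
    using X[of j] that by (cases "j = k") auto
  then have "inflow n k c X v = 0" by (simp add: inflow_def sum.neutral)
  moreover have "mut_coord n k c X k v = 0" using v(2) k by simp
  ultimately have "X k v = 0" by (simp add: mut_coord_def)
  with X show "v = 0" by (intro basis_inj[OF b v(1)]) metis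
qed

end

section \<open>One mutation: removing the dilogarithm on either side\<close>

locale mutation = int_form w for w :: "(nat \<Rightarrow> int) \<Rightarrow> (nat \<Rightarrow> int) \<Rightarrow> int" +
  fixes n :: nat and c X k g
  assumes b: "basis n c X" and k: "k < n" and g: "is_DT n c X g"
begin

definition "e = c k"
definition "K = cone n X"
definition "N = inflow n k c X"
text \<open>\<open>M\<close> is the intersection of the old cone with the new one, \<open>Mt\<close>
  that of the old cone with the cone of the mutation of opposite sign. They turn out to bound the
  supports of \<open>h\<close> and \<open>ht\<close>.\<close>

definition "M = {v\<in>K. X k v \<le> N v}"
definition "Mt = {v\<in>K. X k v + w v e \<le> N v}"
text \<open>The degree transverse to \<open>e\<close>: constant on lines in direction
  \<open>e\<close>, so that a whole line belongs to one stage of an induction.\<close>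

definition "depth v = (\<Sum>j\<in>{..<n} - {k}. X j v)"
definition "K' = cone n (mut_coord n k c X)"
definition "R = {v. \<exists>m. v = sm (int m) e}"

lemma K: "pcone K" unfolding K_def by (rule cone_pcone[OF b])
lemma K': "pcone K'" unfolding K'_def by (rule cone_pcone[OF basis_mut[OF b k]])

lemma e: "e \<noteq> 0" "X k e = 1" "e \<in> K" "e \<in> lattice n" "\<And>j. j < n \<Longrightarrow> j \<noteq> k \<Longrightarrow> X j e = 0"
  using k by (simp_all add: e_def K_def basis_c_nonzero[OF b] basis_c[OF b] cone_c_mem[OF b] basis_lattice[OF b])

lemma N_linear [simp]: "N (u + v) = N u + N v" "N (sm m v) = m * N v" "N e = 0" "N 0 = 0"
  using inflow_c[OF b k, of k] inflow_sm[OF b, of k 0 0]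
  by (simp_all add: N_def e_def inflow_add[OF b] inflow_sm[OF b])

lemma N_diff [simp]: "N (u - v) = N u - N v"
  using N_linear(1)[of "u - v" v] by simp

lemma X_linear [simp]: "j < n \<Longrightarrow> X j (u + v) = X j u + X j v" "j < n \<Longrightarrow> X j (sm m v) = m * X j v"
  "j < n \<Longrightarrow> X j (u - v) = X j u - X j v" "j < n \<Longrightarrow> X j 0 = 0" "j < n \<Longrightarrow> X j (- v) = - X j v"
  by (simp_all add: basis_add[OF b] basis_sm[OF b] basis_diff[OF b] basis_0[OF b] basis_uminus[OF b])

lemma depth_linear: "depth (u + v) = depth u + depth v" "depth (sm m v) = m * depth v" "depth e = 0"
  by (simp_all add: depth_def sum.distrib sum_distrib_left e(5))

lemma N_nonneg: "(\<And>j. j < n \<Longrightarrow> j \<noteq> k \<Longrightarrow> X j v \<ge> 0) \<Longrightarrow> N v \<ge> 0"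
  unfolding N_def inflow_def by (intro sum_nonneg) (metis lessThan_iff max.cobounded2 max.idem mult_eq_0_iff mult_nonneg_nonneg w_self order_refl)

lemma N_minus_nonneg: "v \<in> lattice n \<Longrightarrow> (\<And>j. j < n \<Longrightarrow> j \<noteq> k \<Longrightarrow> X j v \<ge> 0) \<Longrightarrow> N v - w v e \<ge> 0"
  unfolding N_def e_def inflow_minus_w[OF b]
  by (intro sum_nonneg) (metis lessThan_iff max.cobounded2 max.idem mult_eq_0_iff mult_nonneg_nonneg w_self order_refl minus_zero)

lemma K_D: "v \<in> K \<Longrightarrow> v \<in> lattice n" "v \<in> K \<Longrightarrow> j < n \<Longrightarrow> X j v \<ge> 0"
  by (auto simp: K_def cone_def)

lemma K_I: "v \<in> lattice n \<Longrightarrow> (\<And>j. j < n \<Longrightarrow> j \<noteq> k \<Longrightarrow> X j v \<ge> 0) \<Longrightarrow> X k v \<ge> 0 \<Longrightarrow> v \<in> K"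
  by (auto simp: K_def cone_def)

lemma K'_iff: "v \<in> K' \<longleftrightarrow> v \<in> lattice n \<and> (\<forall>j<n. j \<noteq> k \<longrightarrow> X j v \<ge> 0) \<and> X k v \<le> N v"
  using k by (auto simp: K'_def cone_def mut_coord_def N_def)

lemma M_mono: "M \<subseteq> K" "Mt \<subseteq> K" "M \<subseteq> K'"
  by (auto simp: M_def Mt_def K'_iff K_D)

lemma M_closed: "0 \<in> M" "a \<in> M \<Longrightarrow> b \<in> M \<Longrightarrow> a + b \<in> M"
  using k pcone_0[OF K] pcone_add[OF K, of a b] by (auto simp: M_def)

lemma Mt_closed: "0 \<in> Mt" "a \<in> Mt \<Longrightarrow> b \<in> Mt \<Longrightarrow> a + b \<in> Mt"
  using k pcone_0[OF K] pcone_add[OF K, of a b] by (auto simp: Mt_def w_add_left)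

lemma depth_nonneg: "v \<in> K \<Longrightarrow> depth v \<ge> 0"
  unfolding depth_def by (intro sum_nonneg) (auto simp: K_D)

lemma depth_0D:
  assumes "v \<in> K" "depth v = 0" shows "v = sm (X k v) e"
proof (rule basis_eq[OF b])
  show "v \<in> lattice n" "sm (X k v) e \<in> lattice n" using assms e by (auto simp: K_D lattice_sm)
  have "\<forall>j\<in>{..<n} - {k}. X j v = 0"
    using assms unfolding depth_def by (subst (asm) sum_nonneg_eq_0_iff) (auto simp: K_D)
  then show "X i v = X i (sm (X k v) e)" if "i < n" for i using that k e by (cases "i = k") auto
qed

lemma R_subset: "R \<subseteq> K" "R \<subseteq> {u. w e u = 0}"
  using sm_nat_mem[OF pcone_0[OF K] pcone_add[OF K] e(3)] by (auto simp: R_def w_sm_right)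

lemma R_pcone: "pcone R"
proof (rule pcone_subset[OF K R_subset(1)])
  show "0 \<in> R" unfolding R_def by (auto intro: exI[of _ 0])
  show "u + v \<in> R" if "u \<in> R" "v \<in> R" for u v
    using that unfolding R_def by (auto simp flip: sm_add_left of_nat_add)
qed

lemma supp_dil_R: "supp (dil e) \<subseteq> R"
  by (auto simp: supp_def R_def dest: dil_nonzeroD)

definition "Ti = (SOME f. supp f \<subseteq> R \<and> f 0 = 1 \<and> dil e \<star> f = unit \<and> f \<star> dil e = unit)"

lemma Ti: "supp Ti \<subseteq> R" "Ti 0 = 1" "dil e \<star> Ti = unit" "Ti \<star> dil e = unit"
proof -
  obtain f where "supp f \<subseteq> R" "f 0 = 1" "dil e \<star> f = unit" "f \<star> dil e = unit"
    by (rule conv_inverse[OF R_pcone supp_dil_R dil_0[OF e(1)]])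
  then have "\<exists>f. supp f \<subseteq> R \<and> f 0 = 1 \<and> dil e \<star> f = unit \<and> f \<star> dil e = unit" by blast
  from someI_ex[OF this] show "supp Ti \<subseteq> R" "Ti 0 = 1" "dil e \<star> Ti = unit" "Ti \<star> dil e = unit"
    unfolding Ti_def by auto
qed

lemma supp_K: "supp (dil e) \<subseteq> K" "supp Ti \<subseteq> K" "supp g \<subseteq> K"
  using supp_dil_R Ti(1) R_subset(1) g by (auto simp: is_DT_def K_def)

lemma g_0: "g 0 = 1" using g by (simp add: is_DT_def)

text \<open>The dilogarithm at \<open>e\<close> is stripped on the left for \<open>h\<close> and on
  the right for \<open>ht\<close>, so \<open>ht\<close> is the conjugate of \<open>h\<close> by
  \<open>dil e\<close>.\<close>

definition "h = Ti \<star> g"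
definition "ht = g \<star> Ti"

lemma supp_h: "supp h \<subseteq> K" "supp ht \<subseteq> K"
  unfolding h_def ht_def by (intro supp_conv_pcone[OF K] supp_K)+

lemma dil_h: "dil e \<star> h = g" "ht \<star> dil e = g"
  unfolding h_def ht_def
  using conv_assoc[OF K supp_K(1,2,3)] conv_assoc[OF K supp_K(3,2,1)] Ti by simp_all

lemma h_0: "h 0 = 1" "ht 0 = 1"
  unfolding h_def ht_def by (simp_all add: conv_0[OF K supp_K(2,3)] conv_0[OF K supp_K(3,2)] Ti g_0)

lemma not_mem_K: "z < 0 \<Longrightarrow> sm z e \<notin> K"
  using K_D(2)[of "sm z e" k] k e by auto

lemma g_line: "g (sm z e) = dil e (sm z e)"
proof (cases "z \<ge> 0")
  case True
  then obtain m where "z = int m" using zero_le_imp_eq_int by blast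
  then show ?thesis using g k by (simp add: is_DT_def e_def dil_sm[OF e(1)[unfolded e_def]])
next
  case False
  then show ?thesis using supp_outside[OF supp_K(3)] supp_outside[OF supp_K(1)] not_mem_K by simp
qed

lemma h_line: "h (sm z e) = unit (sm z e)" "ht (sm z e) = unit (sm z e)"
proof -
  have "h (sm z e) = (Ti \<star> dil e) (sm z e)" unfolding h_def
  proof (rule conv_cong_right)
    fix a assume "Ti a \<noteq> 0"
    then obtain m where a: "a = sm (int m) e" using Ti(1) by (auto simp: supp_def R_def)
    show "g (sm z e - a) = dil e (sm z e - a)" unfolding a sm_diff_left[symmetric] by (rule g_line)
  qed
  then show "h (sm z e) = unit (sm z e)" by (simp add: Ti)
  have "ht (sm z e) = (dil e \<star> Ti) (sm z e)" unfolding ht_def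
  proof (rule conv_cong_left)
    fix a assume "Ti (sm z e - a) \<noteq> 0"
    then obtain m where "sm z e - a = sm (int m) e" using Ti(1) by (auto simp: supp_def R_def)
    then have a: "a = sm (z - int m) e" unfolding sm_diff_left by (metis diff_diff_eq2 add_diff_cancel_left')
    show "g a = dil e a" unfolding a by (rule g_line)
  qed
  then show "ht (sm z e) = unit (sm z e)" by (simp add: Ti)
qed

lemma depth_0_zero: "v \<in> K \<Longrightarrow> depth v = 0 \<Longrightarrow> v \<noteq> 0 \<Longrightarrow> h v = 0 \<and> ht v = 0"
  using depth_0D[of v] h_line[of "X k v"] by (metis unit_def)

lemma attr_g:
  assumes "v \<in> lattice n" "v \<noteq> 0" "\<And>i m. i < n \<Longrightarrow> v \<noteq> sm (int m) (c i)"
  shows "attr K g v"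
proof (cases "v \<in> K")
  case True
  then show ?thesis using g assms by (auto simp: is_DT_def K_def)
next
  case False
  have "\<not> (\<forall>i<n. X i v = 0)" using basis_inj[OF b assms(1)] assms(2) by blast
  then obtain i where i: "i < n" "X i v \<noteq> 0" by blast
  show ?thesis by (rule attr_outside[OF K supp_K(3) g_0 False, of "X i"]) (use i in auto)
qed

lemma supp_R_perp: "supp f \<subseteq> R \<Longrightarrow> w e v = 0 \<Longrightarrow> supp f \<subseteq> K \<inter> {u. w u v = 0}"
  using R_subset by (auto simp: R_def w_sm_left)

text \<open>\<open>Ti\<close> lives on multiples of \<open>e\<close>, whose sign against
  \<open>v\<close> is that of \<open>w e v\<close>. If this is positive, \<open>Ti\<close> is
  absorbed by \<open>A\<close> and the middle factor is unchanged. If it is 0, \<open>Ti\<close>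
  joins the middle factor after conjugating \<open>A\<close>; its logarithmic derivative vanishes at
  \<open>v\<close>, which is not a multiple of \<open>e\<close>.\<close>

lemma h_fact:
  assumes v: "v \<in> lattice n" "v \<noteq> 0" "\<And>i m. i < n \<Longrightarrow> v \<noteq> sm (int m) (c i)" and s: "w e v \<ge> 0"
  obtains A B C \<delta> \<omega> where "fact K v A B C" "h = A \<star> B \<star> C" "log_deriv \<delta> K v B \<omega>" "\<omega> v = 0"
    "\<And>a b. \<delta> (a + b) = \<delta> a + \<delta> b" "\<delta> v \<noteq> 0"
proof -
  obtain A B C \<delta> \<omega> where f: "fact K v A B C" and gABC: "g = A \<star> B \<star> C" and l: "log_deriv \<delta> K v B \<omega>" and \<omega>: "\<omega> v = 0"
    and \<delta>: "\<And>a b. \<delta> (a + b) = \<delta> a + \<delta> b" "\<delta> v \<noteq> 0"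
    using attr_g[OF v] by (auto simp: attr_def attractor_coeff_def)
  note s' = fact_supp[OF f] and o = fact_0[OF f]
  note sc = supp_conv_pcone[OF K]
  have h1: "h = (Ti \<star> A) \<star> B \<star> C"
    unfolding conv_assoc[OF K supp_K(2) s'(1) sc[OF s'(2,3)]] by (subst gABC[symmetric]) (rule h_def)
  show ?thesis
  proof (cases "w e v = 0")
    case False
    then have pos: "w e v > 0" using s by simp
    have "supp (Ti \<star> A) \<subseteq> K \<inter> {u. u = 0 \<or> w u v > 0}"
    proof (rule supp_conv)
      show "supp Ti \<subseteq> K \<inter> {u. u = 0 \<or> w u v > 0}"
      proof
        fix u assume "u \<in> supp Ti"
        then have "u \<in> R" using Ti(1) by auto
        then obtain m where m: "u = sm (int m) e" by (auto simp: R_def)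
        then have "u = 0 \<or> w u v > 0" using pos by (cases m) (auto simp: w_sm_left)
        then show "u \<in> K \<inter> {u. u = 0 \<or> w u v > 0}" using \<open>u \<in> R\<close> R_subset(1) by auto
      qed
      show "supp A \<subseteq> K \<inter> {u. u = 0 \<or> w u v > 0}" using f by (simp add: fact_def)
    qed (use pcone_add[OF K] in \<open>auto simp: w_add_left\<close>)
    moreover have "(Ti \<star> A) 0 = 1" by (simp add: conv_0[OF K supp_K(2) s'(1)] Ti o)
    ultimately have "fact K v (Ti \<star> A) B C" using f by (simp add: fact_def)
    then show ?thesis using h1 l \<omega> \<delta> by (rule that)
  next
    case True
    note T1 = supp_R_perp[OF supp_dil_R True] and T2 = supp_R_perp[OF Ti(1) True]
    have A: "supp A \<subseteq> K \<inter> {u. u = 0 \<or> 1 * w u v > 0}" using f by (simp add: fact_def)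
    note conj = conj_support[OF K T2 T1 Ti(4) A o(1)]
    have BK: "supp B \<subseteq> K \<inter> {u. w u v = 0}" using f by (simp add: fact_def)
    obtain \<tau> where \<tau>: "log_deriv \<delta> K v Ti \<tau>" by (rule log_deriv_exists[OF K T2 Ti(2)])
    have "supp \<tau> \<subseteq> R"
      by (rule log_deriv_supports[OF K Ti(1) supp_K(2) Ti(2) \<tau>]) (use pcone_0[OF R_pcone] pcone_add[OF R_pcone] in auto)
    moreover have "v \<notin> R" using v(3)[OF k] by (auto simp: R_def e_def)
    ultimately have "\<tau> v = 0" by (rule supp_outside)
    obtain \<theta> where \<theta>: "log_deriv \<delta> K v (Ti \<star> B) \<theta>" "\<theta> v = \<tau> v + \<omega> v"
      by (rule log_deriv_conv[OF K T2 Ti(2) BK \<tau> l \<delta>(1)])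
    have "fact K v (Ti \<star> A \<star> dil e) (Ti \<star> B) C"
      unfolding fact_def
    proof (intro conjI)
      show "supp (Ti \<star> B) \<subseteq> K \<inter> {u. w u v = 0}"
        by (rule supp_conv[OF T2 BK]) (use pcone_add[OF K] in \<open>auto simp: w_add_left\<close>)
      show "(Ti \<star> B) 0 = 1" by (simp add: conv_0[OF K supp_K(2) s'(2)] Ti o)
    qed (use conj f in \<open>simp_all add: fact_def\<close>)
    moreover have "h = (Ti \<star> A \<star> dil e) \<star> (Ti \<star> B) \<star> C"
    proof -
      have "dil e \<star> (Ti \<star> B) \<star> C = dil e \<star> Ti \<star> B \<star> C"
        by (simp only: conv_assoc[OF K supp_K(2) s'(2,3)])
      also have "\<dots> = B \<star> C"
        using conv_assoc[OF K supp_K(1,2) sc[OF s'(2,3)]] Ti by simp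
      finally have "(Ti \<star> A) \<star> dil e \<star> (Ti \<star> B) \<star> C = h" by (simp only: h1)
      moreover have "(Ti \<star> A \<star> dil e) = (Ti \<star> A) \<star> dil e"
        by (rule conv_assoc[OF K supp_K(2) s'(1) supp_K(1), symmetric])
      moreover have "((Ti \<star> A) \<star> dil e) \<star> ((Ti \<star> B) \<star> C) = (Ti \<star> A) \<star> dil e \<star> (Ti \<star> B) \<star> C"
        by (rule conv_assoc[OF K sc[OF supp_K(2) s'(1)] supp_K(1) sc[OF sc[OF supp_K(2) s'(2)] s'(3)]])
      ultimately show ?thesis by simp
    qed
    ultimately show ?thesis using \<theta>(1) _ \<delta> by (rule that) (simp add: \<theta>(2) \<omega> \<open>\<tau> v = 0\<close>)
  qed
qed

lemma ht_fact:
  assumes v: "v \<in> lattice n" "v \<noteq> 0" "\<And>i m. i < n \<Longrightarrow> v \<noteq> sm (int m) (c i)" and s: "w e v < 0"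
  obtains A B C \<delta> \<omega> where "fact K v A B C" "ht = A \<star> B \<star> C" "log_deriv \<delta> K v B \<omega>" "\<omega> v = 0"
    "\<And>a b. \<delta> (a + b) = \<delta> a + \<delta> b" "\<delta> v \<noteq> 0"
proof -
  obtain A B C \<delta> \<omega> where f: "fact K v A B C" and gABC: "g = A \<star> B \<star> C" and l: "log_deriv \<delta> K v B \<omega>" and \<omega>: "\<omega> v = 0"
    and \<delta>: "\<And>a b. \<delta> (a + b) = \<delta> a + \<delta> b" "\<delta> v \<noteq> 0"
    using attr_g[OF v] by (auto simp: attr_def attractor_coeff_def)
  note s' = fact_supp[OF f] and o = fact_0[OF f]
  note sc = supp_conv_pcone[OF K]
  have ht: "ht = A \<star> B \<star> (C \<star> Ti)"
    unfolding conv_assoc[OF K s'(2,3) supp_K(2), symmetric] conv_assoc[OF K s'(1) sc[OF s'(2,3)] supp_K(2), symmetric]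
    by (subst gABC[symmetric]) (rule ht_def)
  have "supp (C \<star> Ti) \<subseteq> K \<inter> {u. u = 0 \<or> w u v < 0}"
  proof (rule supp_conv)
    show "supp Ti \<subseteq> K \<inter> {u. u = 0 \<or> w u v < 0}"
    proof
      fix u assume "u \<in> supp Ti"
      then have "u \<in> R" using Ti(1) by auto
      then obtain m where m: "u = sm (int m) e" by (auto simp: R_def)
      then have "u = 0 \<or> w u v < 0" using s by (cases m) (auto simp: w_sm_left mult_less_0_iff)
      then show "u \<in> K \<inter> {u. u = 0 \<or> w u v < 0}" using \<open>u \<in> R\<close> R_subset(1) by auto
    qed
    show "supp C \<subseteq> K \<inter> {u. u = 0 \<or> w u v < 0}" using f by (simp add: fact_def)
  qed (use pcone_add[OF K] in \<open>auto simp: w_add_left\<close>)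
  moreover have "(C \<star> Ti) 0 = 1" by (simp add: conv_0[OF K s'(3) supp_K(2)] Ti o)
  ultimately have "fact K v A B (C \<star> Ti)" using f by (simp add: fact_def)
  then show ?thesis using ht l \<omega> \<delta> by (rule that)
qed

section \<open>Support bounds for \<open>h\<close> and \<open>ht\<close> by induction on the
  depth\<close>

definition "deep D = {u\<in>K. depth u \<ge> int D}"

lemma deep_closed:
  assumes P: "P \<subseteq> K" "0 \<in> P" "\<And>a b. a \<in> P \<Longrightarrow> b \<in> P \<Longrightarrow> a + b \<in> P"
  shows "0 \<in> P \<union> deep D" "a \<in> P \<union> deep D \<Longrightarrow> b \<in> P \<union> deep D \<Longrightarrow> a + b \<in> P \<union> deep D"
proof -
  show "0 \<in> P \<union> deep D" using P by simp
  have "u + v \<in> deep D" if "u \<in> deep D" "v \<in> K" for u v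
    using that pcone_add[OF K] depth_nonneg[of v] by (auto simp: deep_def depth_linear)
  moreover have "u + v \<in> deep D" if "u \<in> K" "v \<in> deep D" for u v
    using that pcone_add[OF K] depth_nonneg[of u] by (auto simp: deep_def depth_linear)
  ultimately show "a + b \<in> P \<union> deep D" if "a \<in> P \<union> deep D" "b \<in> P \<union> deep D"
    using that P by (auto simp: deep_def)
qed

text \<open>Nonzero summands of a vector of depth \<open>D\<close> both have positive depth, so
  neither reaches depth \<open>D\<close>. Both then lie in \<open>P\<close>, and so would their
  sum.\<close>

lemma deep_indec:
  assumes P: "P \<subseteq> K" "\<And>a b. a \<in> P \<Longrightarrow> b \<in> P \<Longrightarrow> a + b \<in> P" "\<And>u. u \<in> P \<Longrightarrow> depth u = 0 \<Longrightarrow> u = 0"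
    and D: "D > 0" and v: "v \<notin> P" "depth v = int D"
    and ab: "a \<in> P \<union> deep D" "b \<in> P \<union> deep D" "a + b = v"
  shows "a = 0 \<or> b = 0"
proof (rule ccontr)
  assume "\<not> (a = 0 \<or> b = 0)"
  then have ne: "a \<noteq> 0" "b \<noteq> 0" by auto
  have pos: "depth u > 0" if "u \<in> P \<union> deep D" "u \<noteq> 0" for u
    using that P depth_nonneg[of u] D by (force simp: deep_def)
  have "depth a + depth b = int D" using ab v by (auto simp: depth_linear)
  with pos[OF ab(1) ne(1)] pos[OF ab(2) ne(2)] have "a \<notin> deep D" "b \<notin> deep D" by (auto simp: deep_def)
  then have "a \<in> P" "b \<in> P" using ab by auto
  then show False using P(2) ab(3) v(1) by blast
qed

lemma M_depth_0: "u \<in> M \<Longrightarrow> depth u = 0 \<Longrightarrow> u = 0" "u \<in> Mt \<Longrightarrow> depth u = 0 \<Longrightarrow> u = 0"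
proof -
  have *: "u = 0" if u: "u \<in> K" "depth u = 0" "X k u \<le> 0" for u
  proof -
    have "X k u = 0" using K_D(2)[OF u(1) k] u(3) by simp
    then show ?thesis using depth_0D[OF u(1,2)] by simp
  qed
  have **: "N u = 0 \<and> w u e = 0" if "u \<in> K" "depth u = 0" for u
  proof -
    have "N (sm (X k u) e) = 0 \<and> w (sm (X k u) e) e = 0" by (simp add: w_sm_left)
    then show ?thesis using depth_0D[OF that] by simp
  qed
  show "u \<in> M \<Longrightarrow> depth u = 0 \<Longrightarrow> u = 0" using *[of u] **[of u] by (simp add: M_def)
  show "u \<in> Mt \<Longrightarrow> depth u = 0 \<Longrightarrow> u = 0" using *[of u] **[of u] by (simp add: Mt_def)
qed

lemma not_multiple:
  assumes "X k u > 0" "depth u > 0" "i < n" shows "u \<noteq> sm (int m) (c i)"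
proof
  assume u: "u = sm (int m) (c i)"
  show False
  proof (cases "i = k")
    case True
    then show False using assms u depth_linear by (simp add: e_def)
  next
    case False
    then show False using assms u k by (simp add: basis_c[OF b])
  qed
qed

lemma line_base:
  assumes "v \<in> K'\<union> K"
  obtains v0 where "v = v0 + sm (X k v) e" "v0 \<in> lattice n" "X k v0 = 0" "\<And>j. j < n \<Longrightarrow> j \<noteq> k \<Longrightarrow> X j v0 \<ge> 0"
    "w e v0 = w e v" "N v0 = N v" "depth v0 = depth v"
proof (rule that[of "v - sm (X k v) e"])
  have *: "v \<in> lattice n" "\<And>j. j < n \<Longrightarrow> j \<noteq> k \<Longrightarrow> X j v \<ge> 0" using assms by (auto simp: K'_iff K_D)
  show "v - sm (X k v) e \<in> lattice n" using * e by (intro lattice_diff lattice_sm)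
  show "X k (v - sm (X k v) e) = 0" using k e by simp
  show "X j (v - sm (X k v) e) \<ge> 0" if "j < n" "j \<noteq> k" for j using * that e by simp
  show "w e (v - sm (X k v) e) = w e v" by (simp add: w_diff_right w_sm_right)
  show "depth (v - sm (X k v) e) = depth v"
    using depth_linear(1)[of "v - sm (X k v) e" "sm (X k v) e"] by (simp add: depth_linear)
qed simp_all

text \<open>On a line the two bounds are intervals from 0 whose lengths differ by
  \<open>w e v0\<close>, exactly the degree shift caused by conjugation with
  \<open>dil e\<close>.\<close>

lemma line_mem:
  assumes v0: "v0 \<in> lattice n" "X k v0 = 0" "\<And>j. j < n \<Longrightarrow> j \<noteq> k \<Longrightarrow> X j v0 \<ge> 0"
  shows "v0 + sm l e \<in> K \<longleftrightarrow> l \<ge> 0" "v0 + sm l e \<in> M \<longleftrightarrow> 0 \<le> l \<and> l \<le> N v0"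
    "v0 + sm l e \<in> Mt \<longleftrightarrow> 0 \<le> l \<and> l \<le> N v0 + w e v0"
proof -
  have L: "v0 + sm l e \<in> lattice n" using v0 e by (intro lattice_add lattice_sm)
  show 1: "v0 + sm l e \<in> K \<longleftrightarrow> l \<ge> 0"
    using K_D(2)[of "v0 + sm l e" k] K_I[OF L] v0 k e by auto
  show "v0 + sm l e \<in> M \<longleftrightarrow> 0 \<le> l \<and> l \<le> N v0" using 1 v0 k e by (auto simp: M_def)
  show "v0 + sm l e \<in> Mt \<longleftrightarrow> 0 \<le> l \<and> l \<le> N v0 + w e v0"
    using 1 v0 k e w_skew[of v0 e] by (auto simp: Mt_def w_add_left w_sm_left)
qed

lemma line_depth: "depth (v0 + sm l e) = depth v0" "w e (v0 + sm l e) = w e v0"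
  by (simp_all add: depth_linear w_add_right w_sm_right)

text \<open>Along the lines in direction \<open>e\<close> on which \<open>w e v \<ge> 0\<close> the attractor conditions bound the
  support of \<open>h\<close>, on the others that of its conjugate \<open>ht\<close>; the relation
  \<open>dil e \<star> h = ht \<star> dil e\<close> carries each bound over to the other series.\<close>

lemma supports_step:
  assumes D: "D > 0" and IH: "supp h \<subseteq> M \<union> deep D" "supp ht \<subseteq> Mt \<union> deep D"
    and u: "u \<in> K" "depth u = int D"
  shows "u \<notin> M \<Longrightarrow> h u = 0" and "u \<notin> Mt \<Longrightarrow> ht u = 0"
proof -
  have h1: "h u = 0" if u: "u \<in> K" "depth u = int D" "w e u \<ge> 0" "u \<notin> M" for u
  proof -
    \<comment> \<open>Outside \<open>M\<close> this forces \<open>X k u > 0\<close>; with positive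
      depth \<open>u\<close> is then not a multiple of a basis vector, so the attractor condition at
      \<open>u\<close> is available.\<close>
    have "N u \<ge> 0" using N_nonneg K_D(2)[OF u(1)] by blast
    then have pos: "X k u > 0" using u by (auto simp: M_def)
    then have "u \<noteq> 0" using k by auto
    obtain A B C \<delta> \<omega> where f: "fact K u A B C" and h: "h = A \<star> B \<star> C" and l: "log_deriv \<delta> K u B \<omega>" "\<omega> u = 0"
      and \<delta>: "\<And>a b. \<delta> (a + b) = \<delta> a + \<delta> b" "\<delta> u \<noteq> 0"
      by (rule h_fact[OF K_D(1)[OF u(1)] \<open>u \<noteq> 0\<close> not_multiple[OF pos] u(3)]) (use u D in auto)
    have s: "supp (A \<star> B \<star> C) \<subseteq> M \<union> deep D" using IH(1) unfolding h .
    have z: "0 \<in> M \<union> deep D" using M_closed(1) by simp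
    have add: "x + y \<in> M \<union> deep D" if "x \<in> M \<union> deep D" "y \<in> M \<union> deep D" for x y
      by (rule deep_closed(2)[OF M_mono(1) M_closed(1) _ that]) (erule M_closed(2), assumption)
    have ind: "x = 0 \<or> y = 0" if "x \<in> M \<union> deep D" "y \<in> M \<union> deep D" "x + y = u" for x y
      by (rule deep_indec[OF M_mono(1) _ _ D u(4,2) that]) (erule M_closed(2), assumption, erule M_depth_0(1), assumption)
    show ?thesis unfolding h
      by (rule attractor_vanishing[OF K f l \<delta>(2) z add s u(1) \<open>u \<noteq> 0\<close> ind \<delta>(1)])
  qed
  have h2: "ht u = 0" if u: "u \<in> K" "depth u = int D" "w e u < 0" "u \<notin> Mt" for u
  proof -
    have "N u - w u e \<ge> 0" using N_minus_nonneg K_D[OF u(1)] by blast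
    then have pos: "X k u > 0" using u by (auto simp: Mt_def)
    then have "u \<noteq> 0" using k by auto
    obtain A B C \<delta> \<omega> where f: "fact K u A B C" and h: "ht = A \<star> B \<star> C" and l: "log_deriv \<delta> K u B \<omega>" "\<omega> u = 0"
      and \<delta>: "\<And>a b. \<delta> (a + b) = \<delta> a + \<delta> b" "\<delta> u \<noteq> 0"
      by (rule ht_fact[OF K_D(1)[OF u(1)] \<open>u \<noteq> 0\<close> not_multiple[OF pos] u(3)]) (use u D in auto)
    have s: "supp (A \<star> B \<star> C) \<subseteq> Mt \<union> deep D" using IH(2) unfolding h .
    have z: "0 \<in> Mt \<union> deep D" using Mt_closed(1) by simp
    have add: "x + y \<in> Mt \<union> deep D" if "x \<in> Mt \<union> deep D" "y \<in> Mt \<union> deep D" for x y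
      by (rule deep_closed(2)[OF M_mono(2) Mt_closed(1) _ that]) (erule Mt_closed(2), assumption)
    have ind: "x = 0 \<or> y = 0" if "x \<in> Mt \<union> deep D" "y \<in> Mt \<union> deep D" "x + y = u" for x y
      by (rule deep_indec[OF M_mono(2) _ _ D u(4,2) that]) (erule Mt_closed(2), assumption, erule M_depth_0(2), assumption)
    show ?thesis unfolding h
      by (rule attractor_vanishing[OF K f l \<delta>(2) z add s u(1) \<open>u \<noteq> 0\<close> ind \<delta>(1)])
  qed
  obtain v0 where v0: "u = v0 + sm (X k u) e" "v0 \<in> lattice n" "X k v0 = 0" "\<And>j. j < n \<Longrightarrow> j \<noteq> k \<Longrightarrow> X j v0 \<ge> 0"
    "w e v0 = w e u" "N v0 = N u" "depth v0 = depth u"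
    using line_base[of u] u(1) by blast
  note mem = line_mem[OF v0(2-4)]
  have z: "h (v0 + sm l e) = 0" "ht (v0 + sm l e) = 0" if "l < 0" for l
    using supp_outside[OF supp_h(1)] supp_outside[OF supp_h(2)] mem(1)[of l] that by auto
  have N: "N v0 \<ge> 0" "N v0 + w e v0 \<ge> 0"
    using N_nonneg[OF v0(4)] N_minus_nonneg[OF v0(2,4)] w_skew[of v0 e] by auto
  have eq: "dil e \<star> h = ht \<star> dil e" by (simp add: dil_h)
  have "(u \<notin> M \<longrightarrow> h u = 0) \<and> (u \<notin> Mt \<longrightarrow> ht u = 0)"
  proof (cases "w e u \<ge> 0")
    case True
    have hl: "h (v0 + sm l e) = 0" if "l > N v0" for l
    proof (rule h1)
      show "v0 + sm l e \<in> K" "v0 + sm l e \<notin> M" using that N(1) mem(1,2)[of l] by auto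
      show "depth (v0 + sm l e) = int D" "w e (v0 + sm l e) \<ge> 0"
        unfolding line_depth using True v0(5,7) u(2) by auto
    qed
    have "ht u = 0" if "u \<notin> Mt"
    proof -
      have "X k u > N v0 + w e v0" using that mem(3)[of "X k u"] v0(1) K_D(2)[OF u(1) k] by auto
      then have "ht (v0 + sm (X k u) e) = 0"
        using True v0(5) dil_line_degree(1)[of e h v0 ht "N v0", OF e(1) z eq N refl _ hl] by auto
      then show ?thesis using v0(1) by simp
    qed
    then show ?thesis using h1[OF u True] by blast
  next
    case False
    have hl: "ht (v0 + sm l e) = 0" if "l > N v0 + w e v0" for l
    proof (rule h2)
      show "v0 + sm l e \<in> K" "v0 + sm l e \<notin> Mt" using that N(2) mem(1,3)[of l] by auto
      show "depth (v0 + sm l e) = int D" "w e (v0 + sm l e) < 0"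
        unfolding line_depth using False v0(5,7) u(2) by auto
    qed
    have "h u = 0" if "u \<notin> M"
    proof -
      have "X k u > N v0" using that mem(2)[of "X k u"] v0(1) K_D(2)[OF u(1) k] by auto
      then have "h (v0 + sm (X k u) e) = 0"
        using False v0(5) dil_line_degree(2)[of e h v0 ht "N v0", OF e(1) z eq N refl _ hl] by auto
      then show ?thesis using v0(1) by simp
    qed
    then show ?thesis using h2[OF u] False by auto
  qed
  then show "u \<notin> M \<Longrightarrow> h u = 0" and "u \<notin> Mt \<Longrightarrow> ht u = 0" by auto
qed

text \<open>Vectors of depth 0 are multiples of \<open>e\<close>, and there removing
  \<open>dil e\<close> leaves just the unit; this starts the induction.\<close>

lemma supports_deep: "supp h \<subseteq> M \<union> deep (Suc D) \<and> supp ht \<subseteq> Mt \<union> deep (Suc D)"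
proof (induction D)
  case 0
  have "u \<in> M \<union> deep (Suc 0) \<and> u \<in> Mt \<union> deep (Suc 0)" if "h u \<noteq> 0 \<or> ht u \<noteq> 0" for u
  proof -
    have "u \<in> K" using that supp_h by (auto simp: supp_def)
    show ?thesis
    proof (cases "u = 0")
      case False
      then have "depth u \<noteq> 0" using depth_0_zero[OF \<open>u \<in> K\<close>] that by auto
      then show ?thesis using depth_nonneg[OF \<open>u \<in> K\<close>] \<open>u \<in> K\<close> by (auto simp: deep_def)
    qed (use M_closed Mt_closed in auto)
  qed
  then show ?case by (auto simp: supp_def)
next
  case (Suc D)
  note step = supports_step[of "Suc D", OF _ conjunct1[OF Suc] conjunct2[OF Suc]]
  have "u \<in> M \<union> deep (Suc (Suc D))" if "h u \<noteq> 0" for u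
    using that step(1)[of u] Suc by (force simp: supp_def deep_def)
  moreover have "u \<in> Mt \<union> deep (Suc (Suc D))" if "ht u \<noteq> 0" for u
    using that step(2)[of u] Suc by (force simp: supp_def deep_def)
  ultimately show ?case by (auto simp: supp_def)
qed

lemma supports: "supp h \<subseteq> M" "supp ht \<subseteq> Mt"
proof -
  have *: "u \<notin> deep (Suc (nat (depth u)))" for u by (auto simp: deep_def)
  show "supp h \<subseteq> M"
  proof
    fix u assume "u \<in> supp h"
    then have "u \<in> M \<union> deep (Suc (nat (depth u)))" using supports_deep[of "nat (depth u)"] by blast
    then show "u \<in> M" using * by blast
  qed
  show "supp ht \<subseteq> Mt"
  proof
    fix u assume "u \<in> supp ht"
    then have "u \<in> Mt \<union> deep (Suc (nat (depth u)))" using supports_deep[of "nat (depth u)"] by blast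
    then show "u \<in> Mt" using * by blast
  qed
qed

end

section \<open>The shear and the series of the mutated seed\<close>

context mutation
begin

text \<open>A transvection along \<open>e\<close>. It is an isometry of \<open>w\<close>, so
  composing with it is an automorphism of the twisted algebra, and it carries the mutated basis to
  the one obtained with the opposite sign of mutation.\<close>

definition shear :: "(nat \<Rightarrow> int) \<Rightarrow> nat \<Rightarrow> int" where
  "shear u = u + sm (w e u) e"

definition "R' = {v. \<exists>m. v = sm (int m) (- e)}"
definition "g' = h \<star> dil (- e)"

lemma w_e_shear: "w e (shear u) = w e u"
  by (simp add: shear_def w_add_right w_sm_right)

lemma shear_add: "shear (u + v) = shear u + shear v"
  by (simp add: shear_def w_add_right sm_add_left algebra_simps)

lemma shear_diff: "shear (u - v) = shear u - shear v"
  by (simp add: shear_def w_diff_right sm_diff_left algebra_simps)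

lemma shear_w: "w (shear u) (shear v) = w u v"
  unfolding shear_def
  by (simp add: w_add_right w_add_left w_sm_right w_sm_left w_skew[of u e] algebra_simps)

lemma shear_inverse: "shear (u - sm (w e u) e) = u" "shear u - sm (w e (shear u)) e = u"
  by (simp add: shear_def w_diff_right w_sm_right) (simp only: w_e_shear, simp add: shear_def)

lemma shear_eq_0_iff: "shear u = 0 \<longleftrightarrow> u = 0"
proof
  assume "shear u = 0"
  then show "u = 0" using shear_inverse(2)[of u] by simp
qed (simp add: shear_def)

lemma shear_lattice: "u \<in> lattice n \<Longrightarrow> shear u \<in> lattice n"
  unfolding shear_def using e by (intro lattice_add lattice_sm)

lemma conv_shear: "(f \<star> q) \<circ> shear = (f \<circ> shear) \<star> (q \<circ> shear)"
proof
  fix v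
  have "a \<in> shear ` {a. f (shear a) \<noteq> 0 \<and> q (shear v - shear a) \<noteq> 0}" if "f a \<noteq> 0" "q (shear v - a) \<noteq> 0" for a
    using that by (intro image_eqI[of _ _ "a - sm (w e a) e"]) (simp_all add: shear_inverse(1))
  then have "{a. f a \<noteq> 0 \<and> q (shear v - a) \<noteq> 0} = shear ` {a. f (shear a) \<noteq> 0 \<and> q (shear v - shear a) \<noteq> 0}"
    by blast
  moreover have "inj shear" by (rule inj_on_inverseI[of _ "\<lambda>u. u - sm (w e u) e"]) (rule shear_inverse(2))
  ultimately show "((f \<star> q) \<circ> shear) v = ((f \<circ> shear) \<star> (q \<circ> shear)) v"
    by (simp add: conv_def shear_diff shear_w sum.reindex inj_on_subset)
qed

lemma e': "- e \<in> K'" "- e \<noteq> 0"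
  using e k basis_uminus[OF b] by (auto simp: K'_iff lattice_uminus)
    (use N_linear(2)[of "-1" e] in \<open>simp add: sm_minus_left\<close>)

lemma R'_subset: "R' \<subseteq> K'"
  using sm_nat_mem[OF pcone_0[OF K'] pcone_add[OF K'] e'(1)] by (auto simp: R'_def)

lemma R'_pcone: "pcone R'"
proof (rule pcone_subset[OF K' R'_subset])
  show "0 \<in> R'" unfolding R'_def by (auto intro: exI[of _ 0])
  show "u + v \<in> R'" if "u \<in> R'" "v \<in> R'" for u v
    using that unfolding R'_def by (auto simp flip: sm_add_left of_nat_add)
qed

lemma supp_dil_R': "supp (dil (- e)) \<subseteq> R'"
  by (auto simp: supp_def R'_def dest: dil_nonzeroD)

lemma supp_K': "supp (dil (- e)) \<subseteq> K'" "supp h \<subseteq> K'" "supp g' \<subseteq> K'"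
proof -
  show 1: "supp (dil (- e)) \<subseteq> K'" using supp_dil_R' R'_subset by simp
  show 2: "supp h \<subseteq> K'" using supports(1) M_mono by simp
  show "supp g' \<subseteq> K'" unfolding g'_def by (rule supp_conv_pcone[OF K' 2 1])
qed

lemma shear_Mt: "shear u \<in> Mt \<Longrightarrow> u \<in> K'"
proof -
  assume u: "shear u \<in> Mt"
  then have "shear u \<in> K" and le: "X k (shear u) + w (shear u) e \<le> N (shear u)" by (auto simp: Mt_def)
  have "u \<in> lattice n"
    using lattice_diff[OF K_D(1)[OF \<open>shear u \<in> K\<close>] lattice_sm[OF e(4)], of "w e (shear u)"]
    unfolding shear_inverse(2) .
  moreover have "X j u \<ge> 0" if "j < n" "j \<noteq> k" for j
    using K_D(2)[OF \<open>shear u \<in> K\<close> that(1)] that e by (simp add: shear_def)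
  moreover have "X k u \<le> N u"
    using le k e w_skew[of "shear u" e] by (simp add: w_e_shear) (simp add: shear_def)
  ultimately show "u \<in> K'" by (simp add: K'_iff)
qed

lemma supp_shear: "supp f \<subseteq> Mt \<Longrightarrow> supp (f \<circ> shear) \<subseteq> K'"
  using shear_Mt by (auto simp: supp_def)

text \<open>The support bounds make \<open>h\<close> and \<open>ht\<close> polynomials on every
  line, so the reversal identity applies. This second description of \<open>g'\<close> gives access
  to the vectors with \<open>w e v < 0\<close>.\<close>

lemma g'_shear: "g' = dil (- e) \<star> (ht \<circ> shear)"
proof
  fix v
  have s: "supp (dil (- e) \<star> (ht \<circ> shear)) \<subseteq> K'"
    by (intro supp_conv_pcone[OF K'] supp_K' supp_shear supports)
  show "g' v = (dil (- e) \<star> (ht \<circ> shear)) v"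
  proof (cases "v \<in> K'")
    case False
    then show ?thesis using supp_outside[OF s] supp_outside[OF supp_K'(3)] by simp
  next
    case True
    obtain v0 where v0: "v = v0 + sm (X k v) e" "v0 \<in> lattice n" "X k v0 = 0" "\<And>j. j < n \<Longrightarrow> j \<noteq> k \<Longrightarrow> X j v0 \<ge> 0"
      "w e v0 = w e v" "N v0 = N v" "depth v0 = depth v"
      by (rule line_base[of v]) (use True in auto)
    note mem = line_mem[OF v0(2-4)]
    have h: "h (v0 + sm l e) = 0" if "l < 0 \<or> l > N v0" for l
      by (rule supp_outside[OF supports(1)]) (use mem(2)[of l] that in auto)
    have ht: "ht (v0 + sm l e) = 0" if "l < 0 \<or> l > N v0 + w e v0" for l
      by (rule supp_outside[OF supports(2)]) (use mem(3)[of l] that in auto)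
    have N: "N v0 \<ge> 0" "N v0 + w e v0 \<ge> 0"
      using N_nonneg[OF v0(4)] N_minus_nonneg[OF v0(2,4)] w_skew[of v0 e] by auto
    have "dil e \<star> h = ht \<star> dil e" by (simp add: dil_h)
    then have "(dil (- e) \<star> (\<lambda>u. ht (u + sm (w e u) e))) (v0 + sm (X k v) e) = (h \<star> dil (- e)) (v0 + sm (X k v) e)"
      using N dil_line_shear[of e "N v0" h v0 "N v0 + w e v0" ht "X k v", OF e(1) h ht] by simp
    then show ?thesis using v0(1) by (simp add: g'_def o_def shear_def)
  qed
qed

definition "c' = mut_basis k c"

text \<open>On the lines involved a single term survives. If \<open>c' i = c i\<close>, the
  comparison with \<open>g\<close> runs through \<open>h\<close>; if a multiple of \<open>e\<close>
  was added, the shear takes \<open>c' i\<close> back to \<open>c i\<close> and the comparison runs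
  through \<open>ht\<close>.\<close>

lemma g'_values: "i < n \<Longrightarrow> g' (sm (int m) (c' i)) = qdil m"
proof -
  assume i: "i < n"
  consider "i = k" | "i \<noteq> k" "w (c i) e \<le> 0" | "i \<noteq> k" "w (c i) e > 0" by linarith
  then show ?thesis
  proof cases
    case 1
    have "g' (sm (int m) (- e)) = (unit \<star> dil (- e)) (sm (int m) (- e))"
      unfolding g'_def
    proof (rule conv_cong_left)
      fix a assume "dil (- e) (sm (int m) (- e) - a) \<noteq> 0"
      then obtain l where "sm (int m) (- e) - a = sm (int l) (- e)" using dil_nonzeroD by blast
      then have "a = sm (int m) (- e) - sm (int l) (- e)" by (metis diff_diff_eq2 add_diff_cancel_left')
      then have a: "a = sm (int l - int m) e" by (simp add: sm_minus_right sm_diff_left)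
      show "h a = unit a" unfolding a by (rule h_line)
    qed
    then show ?thesis using 1 by (simp add: c'_def mut_basis_def dil_sm[OF e'(2)] flip: e_def)
  next
    case 2
    let ?u = "sm (int m) (c i)"
    have u: "c' i = c i" using 2 by (simp add: c'_def mut_basis_def flip: e_def)
    have Nu: "N ?u = 0" using 2 inflow_c[OF b i, of k] by (simp add: e_def flip: N_def)
    have Xu: "X k ?u = 0" using i k 2 by (simp add: basis_c[OF b])
    have z: "h (?u - sm (int l) (- e)) = 0" if "l > 0" for l
      by (rule supp_outside[OF supports(1)])
        (use that Nu Xu k e basis_uminus[OF b] in \<open>auto simp: M_def sm_minus_right\<close>)
    have "g' ?u = h ?u" unfolding g'_def using conv_dil[OF e'(2), of 0 h ?u] z by simp
    moreover have "h (?u - sm (int l) e) = 0" if "l > 0" for l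
      by (rule supp_outside[OF supp_h(1)]) (use that K_D(2)[of "?u - sm (int l) e" k] Xu k e in auto)
    then have "(dil e \<star> h) ?u = h ?u" using dil_conv[OF e(1), of 0 h ?u] by simp
    then have "g ?u = h ?u" by (simp only: dil_h)
    ultimately show ?thesis using g i u by (simp add: is_DT_def)
  next
    case 3
    let ?u = "sm (int m) (c i)" and ?v = "sm (int m) (c' i)"
    have u: "c' i = c i + sm (w (c i) e) e" using 3 by (simp add: c'_def mut_basis_def flip: e_def)
    have sv: "shear ?v = ?u"
      using w_skew[of e "c i"] by (simp add: shear_def u w_add_right w_sm_right sm_add_right sm_sm sm_add_left[symmetric] add.assoc)
    have Nu: "N (c i) = w (c i) e" using 3 inflow_c[OF b i, of k] by (simp add: e_def flip: N_def)
    have Xu: "X k (c i) = 0" using i k 3 by (simp add: basis_c[OF b])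
    have z: "(ht \<circ> shear) (?v - sm (int l) (- e)) = 0" if "l > 0" for l
    proof -
      have *: "shear (?v - sm (int l) (- e)) = ?u + sm (int l) e"
        unfolding shear_diff sv by (simp add: shear_def sm_minus_right w_minus_right w_sm_right)
      have "?u + sm (int l) e \<notin> Mt"
        using that Nu Xu k e by (simp add: Mt_def w_add_left w_sm_left)
      then show ?thesis unfolding o_apply * by (rule supp_outside[OF supports(2)])
    qed
    have "g' ?v = ht ?u" unfolding g'_shear using dil_conv[OF e'(2), of 0 "ht \<circ> shear" ?v] z by (simp add: sv)
    moreover have "ht (?u - sm (int l) e) = 0" if "l > 0" for l
      by (rule supp_outside[OF supp_h(2)]) (use that K_D(2)[of "?u - sm (int l) e" k] Xu k e in auto)
    then have "(ht \<star> dil e) ?u = ht ?u" using conv_dil[OF e(1), of 0 ht ?u] by simp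
    then have "g ?u = ht ?u" by (simp only: dil_h)
    ultimately show ?thesis using g i by (simp add: is_DT_def)
  qed
qed

lemma dil_e'_sign:
  assumes "s * w (- e) v > 0"
  shows "supp (dil (- e)) \<subseteq> K' \<inter> {u. u = 0 \<or> s * w u v > 0}"
proof
  fix u assume "u \<in> supp (dil (- e))"
  then have "u \<in> R'" using supp_dil_R' by auto
  then obtain m where m: "u = sm (int m) (- e)" by (auto simp: R'_def)
  then have "u = 0 \<or> s * w u v > 0" using assms by (cases m) (auto simp: w_sm_left mult.left_commute[of s])
  then show "u \<in> K' \<inter> {u. u = 0 \<or> s * w u v > 0}" using \<open>u \<in> R'\<close> R'_subset by auto
qed

text \<open>The factors of \<open>h\<close> inherit the bound \<open>M\<close>, so its factorisation
  at \<open>v\<close> is also one over the new cone. The new factor \<open>dil (- e)\<close> is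
  negative against \<open>v\<close> and goes into \<open>C\<close>, or is orthogonal to
  \<open>v\<close> and goes into \<open>B\<close> after conjugating \<open>C\<close>.\<close>

lemma attr_g'_nonneg:
  assumes v: "v \<in> K'" "v \<noteq> 0" "\<And>i m. i < n \<Longrightarrow> v \<noteq> sm (int m) (c' i)" and s: "w e v \<ge> 0"
  shows "attr K' g' v"
proof -
  have vL: "v \<in> lattice n" using v(1) by (simp add: K'_iff)
  have nm: "v \<noteq> sm (int m) (c i)" if i: "i < n" for i m
  proof
    assume eq: "v = sm (int m) (c i)"
    then have "m > 0" using v(2) by (cases m) auto
    show False
    proof (cases "i = k")
      case True
      then have "X k v = int m" "N v = 0" using eq True e(2) k by (simp_all flip: e_def)
      then show False using v(1) \<open>m > 0\<close> by (simp add: K'_iff)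
    next
      case False
      have "w (c i) e \<le> 0" using s \<open>m > 0\<close> w_skew[of e "c i"] by (simp add: eq w_sm_right mult_le_0_iff)
      then have "c' i = c i" using False by (simp add: c'_def mut_basis_def flip: e_def)
      then show False using v(3)[OF i, of m] eq by simp
    qed
  qed
  obtain A B C \<delta> \<omega> where f: "fact K v A B C" and h: "h = A \<star> B \<star> C" and l: "log_deriv \<delta> K v B \<omega>" and \<omega>: "\<omega> v = 0"
    and \<delta>: "\<And>a b. \<delta> (a + b) = \<delta> a + \<delta> b" "\<delta> v \<noteq> 0"
    by (rule h_fact[OF vL v(2) nm s]) auto
  note o = fact_0[OF f]
  have hM: "supp (A \<star> B \<star> C) \<subseteq> M" using supports(1) unfolding h .
  have sM: "supp A \<subseteq> M" "supp B \<subseteq> M" "supp C \<subseteq> M"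
    by (rule conv3_supports[OF K fact_supp[OF f] o fact_disjoint[OF f] M_closed hM]; assumption)+
  have \<omega>M: "supp \<omega> \<subseteq> M" by (rule log_deriv_supports[OF K sM(2) fact_supp(2)[OF f] o(2) l M_closed])
  have s': "supp A \<subseteq> K'" "supp B \<subseteq> K'" "supp C \<subseteq> K'" "supp \<omega> \<subseteq> K'"
    using sM \<omega>M M_mono(3) by auto
  have f': "fact K' v A B C" using f s' unfolding fact_def by auto
  have l': "log_deriv \<delta> K' v B \<omega>" using l s' unfolding log_deriv_def by auto
  note sc = supp_conv_pcone[OF K']
  have g1: "g' = A \<star> B \<star> (C \<star> dil (- e))"
    unfolding conv_assoc[OF K' s'(2,3) supp_K'(1), symmetric] conv_assoc[OF K' s'(1) sc[OF s'(2,3)] supp_K'(1), symmetric]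
    by (subst h[symmetric]) (rule g'_def)
  have C1: "(C \<star> dil (- e)) 0 = 1" by (simp add: conv_0[OF K' s'(3) supp_K'(1)] o dil_0[OF e'(2)])
  have Cs: "supp C \<subseteq> K' \<inter> {u. u = 0 \<or> -1 * w u v > 0}" using f' by (simp add: fact_def)
  show ?thesis
  proof (cases "w e v = 0")
    case False
    then have "-1 * w (- e) v > 0" using s by (simp add: w_minus_left)
    from dil_e'_sign[OF this] Cs have "supp (C \<star> dil (- e)) \<subseteq> K' \<inter> {u. u = 0 \<or> -1 * w u v > 0}"
      using pcone_add[OF K'] by (intro supp_conv) (auto simp: w_add_left)
    then have "fact K' v A B (C \<star> dil (- e))" using f' C1 by (simp add: fact_def)
    with g1 l' have "attractor_coeff \<delta> K' g' v \<omega>" unfolding attractor_coeff_def by blast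
    then show ?thesis unfolding attr_def using \<delta> \<omega> by blast
  next
    case True
    obtain T where T: "supp T \<subseteq> R'" "T 0 = 1" "dil (- e) \<star> T = unit" "T \<star> dil (- e) = unit"
      by (rule conv_inverse[OF R'_pcone supp_dil_R' dil_0[OF e'(2)]])
    have perp: "supp q \<subseteq> K' \<inter> {u. w u v = 0}" if "supp q \<subseteq> R'" for q
      using that R'_subset True by (auto simp: R'_def w_sm_left w_minus_left)
    note D = perp[OF supp_dil_R'] and TD = perp[OF T(1)]
    have TK: "supp T \<subseteq> K'" using TD by auto
    note conj = conj_support[OF K' TD D T(4) Cs o(3)]
    have BK: "supp B \<subseteq> K' \<inter> {u. w u v = 0}" using f' by (simp add: fact_def)
    obtain \<tau> where \<tau>: "log_deriv \<delta> K' v (dil (- e)) \<tau>" by (rule log_deriv_exists[OF K' D dil_0[OF e'(2)]])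
    have "supp \<tau> \<subseteq> R'"
      by (rule log_deriv_supports[OF K' supp_dil_R' supp_K'(1) dil_0[OF e'(2)] \<tau>])
        (use pcone_0[OF R'_pcone] pcone_add[OF R'_pcone] in auto)
    moreover have "v \<notin> R'" using v(3)[OF k] by (auto simp: R'_def c'_def mut_basis_def simp flip: e_def)
    ultimately have "\<tau> v = 0" by (rule supp_outside)
    obtain \<theta> where \<theta>: "log_deriv \<delta> K' v (B \<star> dil (- e)) \<theta>" "\<theta> v = \<omega> v + \<tau> v"
      by (rule log_deriv_conv[OF K' BK o(2) D l' \<tau> \<delta>(1)])
    have "fact K' v A (B \<star> dil (- e)) (T \<star> C \<star> dil (- e))"
      unfolding fact_def
    proof (intro conjI)
      show "supp (B \<star> dil (- e)) \<subseteq> K' \<inter> {u. w u v = 0}"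
        by (rule supp_conv[OF BK D]) (use pcone_add[OF K'] in \<open>auto simp: w_add_left\<close>)
      show "(B \<star> dil (- e)) 0 = 1" by (simp add: conv_0[OF K' s'(2) supp_K'(1)] o dil_0[OF e'(2)])
    qed (use conj f' in \<open>simp_all add: fact_def\<close>)
    moreover have "g' = A \<star> (B \<star> dil (- e)) \<star> (T \<star> C \<star> dil (- e))"
    proof -
      have "dil (- e) \<star> T \<star> C \<star> dil (- e) = C \<star> dil (- e)"
        using conv_assoc[OF K' supp_K'(1) TK sc[OF s'(3) supp_K'(1)]] T by simp
      then show ?thesis
        unfolding g1 conv_assoc[OF K' s'(2) supp_K'(1) sc[OF TK sc[OF s'(3) supp_K'(1)]]] by simp
    qed
    ultimately have "attractor_coeff \<delta> K' g' v \<theta>" unfolding attractor_coeff_def using \<theta>(1) by blast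
    moreover have "\<theta> v = 0" by (simp add: \<theta> \<omega> \<open>\<tau> v = 0\<close>)
    ultimately show ?thesis unfolding attr_def using \<delta> by blast
  qed
qed

text \<open>The condition for \<open>ht\<close> at \<open>shear v'\<close> is pulled back along the
  isometry, together with \<open>\<delta>\<close>. The factor \<open>dil (- e)\<close> is positive
  against \<open>v'\<close> and joins \<open>A\<close>.\<close>

lemma attr_g'_neg:
  assumes v': "v' \<in> K'" "v' \<noteq> 0" "\<And>i m. i < n \<Longrightarrow> v' \<noteq> sm (int m) (c' i)" and s: "w e v' < 0"
  shows "attr K' g' v'"
proof -
  define v where "v = shear v'"
  have wv: "w e v = w e v'" by (simp add: v_def w_e_shear)
  have vL: "v \<in> lattice n" using v'(1) by (simp add: K'_iff v_def shear_lattice)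
  have v0: "v \<noteq> 0" using v'(2) by (simp add: v_def shear_eq_0_iff)
  have nm: "v \<noteq> sm (int m) (c i)" if i: "i < n" for i m
  proof
    assume eq: "v = sm (int m) (c i)"
    then have we: "int m * w e (c i) < 0" using s wv by (simp add: w_sm_right)
    then have "m > 0" "w e (c i) < 0" by (auto simp: mult_less_0_iff)
    then have ci: "i \<noteq> k" "w (c i) e > 0" using w_skew[of e "c i"] by (auto simp flip: e_def)
    have "v' = v - sm (w e v) e" unfolding v_def by (rule shear_inverse(2)[symmetric])
    also have "\<dots> = sm (int m) (c i) + sm (int m) (sm (w (c i) e) e)"
      using w_skew[of e "c i"] by (simp add: eq w_sm_right sm_sm sm_minus_left)
    also have "\<dots> = sm (int m) (c' i)" using ci by (simp add: c'_def mut_basis_def sm_add_right flip: e_def)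
    finally show False using v'(3)[OF i] by blast
  qed
  obtain A B C \<delta> \<omega> where f: "fact K v A B C" and h: "ht = A \<star> B \<star> C" and l: "log_deriv \<delta> K v B \<omega>" and \<omega>: "\<omega> v = 0"
    and \<delta>: "\<And>a b. \<delta> (a + b) = \<delta> a + \<delta> b" "\<delta> v \<noteq> 0"
    by (rule ht_fact[OF vL v0 nm]) (use s wv in auto)
  note o = fact_0[OF f]
  have hM: "supp (A \<star> B \<star> C) \<subseteq> Mt" using supports(2) unfolding h .
  have sM: "supp A \<subseteq> Mt" "supp B \<subseteq> Mt" "supp C \<subseteq> Mt"
    by (rule conv3_supports[OF K fact_supp[OF f] o fact_disjoint[OF f] Mt_closed hM]; assumption)+
  have \<omega>M: "supp \<omega> \<subseteq> Mt" by (rule log_deriv_supports[OF K sM(2) fact_supp(2)[OF f] o(2) l Mt_closed])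
  note s' = sM[THEN supp_shear] supp_shear[OF \<omega>M]
  have w_v: "w (shear u) v = w u v'" for u by (simp add: v_def shear_w)
  have f': "fact K' v' (A \<circ> shear) (B \<circ> shear) (C \<circ> shear)"
    unfolding fact_def
  proof (intro conjI)
    have "shear 0 = 0" by (simp add: shear_def)
    then show "(A \<circ> shear) 0 = 1" "(B \<circ> shear) 0 = 1" "(C \<circ> shear) 0 = 1" using o by simp_all
    have P: "supp A \<subseteq> {u. u = 0 \<or> w u v > 0}" "supp B \<subseteq> {u. w u v = 0}" "supp C \<subseteq> {u. u = 0 \<or> w u v < 0}"
      using f by (auto simp: fact_def)
    show "supp (A \<circ> shear) \<subseteq> K' \<inter> {u. u = 0 \<or> w u v' > 0}"
      using s'(1) P(1) w_v shear_eq_0_iff by (fastforce simp: supp_def)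
    show "supp (B \<circ> shear) \<subseteq> K' \<inter> {u. w u v' = 0}"
      using s'(2) P(2) w_v by (fastforce simp: supp_def)
    show "supp (C \<circ> shear) \<subseteq> K' \<inter> {u. u = 0 \<or> w u v' < 0}"
      using s'(3) P(3) w_v shear_eq_0_iff by (fastforce simp: supp_def)
  qed
  have "deriv_by (\<delta> \<circ> shear) (B \<circ> shear) = deriv_by \<delta> B \<circ> shear"
    by (auto simp: deriv_by_def)
  also have "deriv_by \<delta> B = \<omega> \<star> B" using l by (simp add: log_deriv_def)
  also have "(\<omega> \<star> B) \<circ> shear = (\<omega> \<circ> shear) \<star> (B \<circ> shear)" by (rule conv_shear)
  finally have dB: "deriv_by (\<delta> \<circ> shear) (B \<circ> shear) = (\<omega> \<circ> shear) \<star> (B \<circ> shear)" .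
  have "supp \<omega> \<subseteq> {u. w u v = 0}" using l by (auto simp: log_deriv_def)
  then have "supp (\<omega> \<circ> shear) \<subseteq> K' \<inter> {u. w u v' = 0}"
    using s'(4) w_v by (fastforce simp: supp_def)
  with dB have l': "log_deriv (\<delta> \<circ> shear) K' v' (B \<circ> shear) (\<omega> \<circ> shear)" by (simp add: log_deriv_def)
  note sc = supp_conv_pcone[OF K']
  have "ht \<circ> shear = (A \<circ> shear) \<star> (B \<circ> shear) \<star> (C \<circ> shear)" unfolding h by (simp add: conv_shear)
  then have g1: "g' = (dil (- e) \<star> (A \<circ> shear)) \<star> (B \<circ> shear) \<star> (C \<circ> shear)"
    by (simp add: g'_shear conv_assoc[OF K' supp_K'(1) s'(1) sc[OF s'(2,3)]])
  have pos: "1 * w (- e) v' > 0" using s by (simp add: w_minus_left)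
  have "supp (dil (- e) \<star> (A \<circ> shear)) \<subseteq> K' \<inter> {u. u = 0 \<or> w u v' > 0}"
  proof (rule supp_conv)
    show "supp (dil (- e)) \<subseteq> K' \<inter> {u. u = 0 \<or> w u v' > 0}" using dil_e'_sign[OF pos] by simp
    show "supp (A \<circ> shear) \<subseteq> K' \<inter> {u. u = 0 \<or> w u v' > 0}" using f' by (simp add: fact_def)
  qed (use pcone_add[OF K'] in \<open>auto simp: w_add_left\<close>)
  moreover have "(dil (- e) \<star> (A \<circ> shear)) 0 = 1"
    using f' by (simp add: conv_0[OF K' supp_K'(1) s'(1)] dil_0[OF e'(2)] fact_def)
  ultimately have "fact K' v' (dil (- e) \<star> (A \<circ> shear)) (B \<circ> shear) (C \<circ> shear)"
    using f' by (simp add: fact_def)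
  with g1 l' have "attractor_coeff (\<delta> \<circ> shear) K' g' v' (\<omega> \<circ> shear)" unfolding attractor_coeff_def by blast
  moreover have "(\<omega> \<circ> shear) v' = 0" "(\<delta> \<circ> shear) v' \<noteq> 0" using \<omega> \<delta>(2) by (simp_all add: v_def)
  moreover have "(\<delta> \<circ> shear) (x + y) = (\<delta> \<circ> shear) x + (\<delta> \<circ> shear) y" for x y by (simp add: shear_add \<delta>)
  ultimately show ?thesis unfolding attr_def by blast
qed

lemma is_DT_mut: "is_DT n (mut_basis k c) (mut_coord n k c X) g'"
  unfolding is_DT_def K'_def[symmetric] c'_def[symmetric]
proof (intro conjI allI impI ballI)
  show "supp g' \<subseteq> K'" by (rule supp_K'(3))
  show "g' 0 = 1" unfolding g'_def by (simp add: conv_0[OF K' supp_K'(2,1)] h_0 dil_0[OF e'(2)])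
  show "g' (sm (int m) (c' i)) = qdil m" if "i < n" for i m using that by (rule g'_values)
  show "attr K' g' v" if "v \<in> K'" "v \<noteq> 0" "\<forall>i<n. \<forall>m. v \<noteq> sm (int m) (c' i)" for v
    using that attr_g'_nonneg[of v] attr_g'_neg[of v] by (cases "w e v \<ge> 0") auto
qed

end

lemma (in int_form) DT_mutation:
  assumes "basis n c X" "k < n" "is_DT n c X g"
  obtains h where "g = dil (c k) \<star> h" "h 0 = 1" "supp h \<subseteq> cone n X" "supp h \<subseteq> cone n (mut_coord n k c X)"
    "is_DT n (mut_basis k c) (mut_coord n k c X) (h \<star> dil (- c k))"
proof -
  interpret mutation w n c X k g using assms by unfold_locales
  show ?thesis
    by (rule that[of h])
      (use dil_h(1) h_0(1) supp_h(1) supp_K'(2) is_DT_mut in \<open>simp_all add: e_def K_def K'_def g'_def\<close>)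
qed

section \<open>Green sequences\<close>

definition pos :: "nat \<Rightarrow> (nat \<Rightarrow> int) set" where
  "pos n = {v \<in> lattice n. \<forall>i<n. 0 \<le> v i}"

definition neg :: "nat \<Rightarrow> (nat \<Rightarrow> int) set" where
  "neg n = {v \<in> lattice n. \<forall>i<n. v i \<le> 0}"

lemma pos_closed: "0 \<in> pos n" "a \<in> pos n \<Longrightarrow> b \<in> pos n \<Longrightarrow> a + b \<in> pos n"
  by (auto simp: pos_def lattice_0 lattice_add zero_fun_apply plus_fun_apply)

lemma neg_closed: "0 \<in> neg n" "a \<in> neg n \<Longrightarrow> b \<in> neg n \<Longrightarrow> a + b \<in> neg n"
  by (auto simp: neg_def lattice_0 lattice_add zero_fun_apply plus_fun_apply add_nonpos_nonpos)

lemma pos_uminus: "a \<in> pos n \<Longrightarrow> - a \<in> neg n"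
  by (auto simp: pos_def neg_def lattice_uminus)

lemma pos_neg: "a \<in> pos n \<Longrightarrow> a \<in> neg n \<Longrightarrow> a = 0"
  by (rule ext) (metis (mono_tags, lifting) lattice_def leI mem_Collect_eq neg_def order_antisym pos_def zero_fun_apply)

lemma cone_indec:
  assumes b: "basis n c X" and i: "i < n" and a: "a \<in> cone n X" "d \<in> cone n X" "a + d = c i"
  shows "a = 0 \<or> d = 0"
proof -
  have X: "X l a + X l d = (if l = i then 1 else 0)" if "l < n" for l
    using that i a(3) basis_add[OF b that, of a d] by (simp add: basis_c[OF b])
  have ge: "X l a \<ge> 0" "X l d \<ge> 0" if "l < n" for l using a that by (auto simp: cone_def)
  have z: "X l a = 0 \<and> X l d = 0" if "l < n" "l \<noteq> i" for l using X[OF that(1)] ge[OF that(1)] that by auto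
  have "X i a = 0 \<or> X i d = 0" using X[OF i] ge[OF i] by auto
  then show ?thesis
  proof
    assume "X i a = 0"
    then have "a = 0" using z a by (intro basis_inj[OF b]) (auto simp: cone_def)
    then show ?thesis ..
  next
    assume "X i d = 0"
    then have "d = 0" using z a by (intro basis_inj[OF b]) (auto simp: cone_def)
    then show ?thesis ..
  qed
qed

lemma cone_pair:
  assumes b: "basis n c X" and ij: "i < n" "j < n" "i \<noteq> j"
    and a: "a \<in> cone n X" "c i + c j - a \<in> cone n X"
  shows "a \<in> {0, c i, c j, c i + c j}"
proof -
  have X: "0 \<le> X l a" "X l a \<le> (if l = i \<or> l = j then 1 else 0)" if "l < n" for l
    using that ij a by (auto simp: cone_def basis_diff[OF b] basis_add[OF b] basis_c[OF b] split: if_splits)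
  have L: "a \<in> lattice n" using a by (simp add: cone_def)
  have *: "a = sm (X i a) (c i) + sm (X j a) (c j)"
  proof (rule basis_eq[OF b L])
    show "sm (X i a) (c i) + sm (X j a) (c j) \<in> lattice n"
      using ij by (intro lattice_add lattice_sm basis_lattice[OF b])
    show "X l a = X l (sm (X i a) (c i) + sm (X j a) (c j))" if "l < n" for l
      using X[OF that] that ij by (auto simp: basis_add[OF b] basis_sm[OF b] basis_c[OF b])
  qed
  have "X i a = 0 \<or> X i a = 1" "X j a = 0 \<or> X j a = 1" using X[OF ij(1)] X[OF ij(2)] by auto
  then show ?thesis using * by auto
qed

context int_form
begin

text \<open>Building the inverse on the ray of \<open>e\<close> gives one series that is supported
  in every cone containing \<open>e\<close>.\<close>

lemma dil_inverse:
  assumes K: "pcone K" and e: "e \<in> K" "e \<noteq> 0"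
  obtains T where "\<forall>P. pcone P \<longrightarrow> e \<in> P \<longrightarrow> supp T \<subseteq> P" "T 0 = 1" "T \<star> dil e = unit"
proof -
  let ?R = "{v. \<exists>m. v = sm (int m) e}"
  have sub: "?R \<subseteq> P" if "pcone P" "e \<in> P" for P
    using sm_nat_mem[OF pcone_0[OF that(1)] pcone_add[OF that(1)] that(2)] by auto
  have R: "pcone ?R"
  proof (rule pcone_subset[OF K sub[OF K e(1)]])
    show "0 \<in> ?R" by (auto intro: exI[of _ 0])
    show "u + v \<in> ?R" if "u \<in> ?R" "v \<in> ?R" for u v
      using that by (auto simp flip: sm_add_left of_nat_add)
  qed
  have s: "supp (dil e) \<subseteq> ?R" by (auto simp: supp_def dest: dil_nonzeroD)
  obtain T where "supp T \<subseteq> ?R" "T 0 = 1" "T \<star> dil e = unit"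
    by (rule conv_inverse[OF R s dil_0[OF e(2)]])
  then show ?thesis using sub by (intro that[of T]) blast+
qed

text \<open>Along a green sequence the series of the current seed is \<open>p \<star> r\<close>, where \<open>p\<close> is what
  remains to be crossed and \<open>r\<close> collects the inverted dilogarithms of the crossed vectors.\<close>

definition green_state :: "nat \<Rightarrow> (nat \<Rightarrow> nat \<Rightarrow> int) \<Rightarrow> (nat \<Rightarrow> (nat \<Rightarrow> int) \<Rightarrow> int)
    \<Rightarrow> ((nat \<Rightarrow> int) \<Rightarrow> rat) \<Rightarrow> ((nat \<Rightarrow> int) \<Rightarrow> rat) \<Rightarrow> bool" where
  "green_state n c X p r \<longleftrightarrow> basis n c X \<and> is_DT n c X (p \<star> r) \<and> supp p \<subseteq> cone n X \<inter> pos n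
     \<and> supp r \<subseteq> cone n X \<inter> neg n \<and> p 0 = 1 \<and> r 0 = 1"

text \<open>Cancelling \<open>dil (c k)\<close> leaves \<open>h = p' \<star> r\<close>. The supports
  of \<open>p'\<close> and \<open>r\<close> meet only in 0, one being nonnegative and the other
  nonpositive, so the bound of \<open>h\<close> by the new cone passes to each factor.\<close>

lemma green_step:
  assumes st: "green_state n c X p r" and k: "k < n" "c k \<in> pos n"
  obtains p' where "p = dil (c k) \<star> p'" "supp p' \<subseteq> cone n X"
    "green_state n (mut_basis k c) (mut_coord n k c X) p' (r \<star> dil (- c k))"
proof -
  let ?K = "cone n X" and ?K' = "cone n (mut_coord n k c X)" and ?e = "c k"
  have b: "basis n c X" and DT: "is_DT n c X (p \<star> r)" and p: "supp p \<subseteq> ?K \<inter> pos n" "p 0 = 1"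
    and r: "supp r \<subseteq> ?K \<inter> neg n" "r 0 = 1"
    using st by (auto simp: green_state_def)
  have K: "pcone ?K" by (rule cone_pcone[OF b])
  have b': "basis n (mut_basis k c) (mut_coord n k c X)" by (rule basis_mut[OF b k(1)])
  have K': "pcone ?K'" by (rule cone_pcone[OF b'])
  have Kp: "pcone (?K \<inter> pos n)"
    by (rule pcone_subset[OF K]) (auto simp: pcone_0[OF K] pcone_add[OF K] pos_closed)
  have eK: "?e \<in> ?K" "?e \<in> ?K \<inter> pos n" "?e \<noteq> 0"
    using k by (simp_all add: cone_c_mem[OF b] basis_c_nonzero[OF b])
  obtain h where h: "p \<star> r = dil ?e \<star> h" "h 0 = 1" "supp h \<subseteq> ?K" "supp h \<subseteq> ?K'"
    and DT': "is_DT n (mut_basis k c) (mut_coord n k c X) (h \<star> dil (- ?e))"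
    by (rule DT_mutation[OF b k(1) DT])
  obtain T where T: "\<forall>P. pcone P \<longrightarrow> ?e \<in> P \<longrightarrow> supp T \<subseteq> P" "T 0 = 1" "T \<star> dil ?e = unit"
    by (rule dil_inverse[OF K eK(1,3)])
  have TK: "supp T \<subseteq> ?K" and TKp: "supp T \<subseteq> ?K \<inter> pos n" using T(1) K Kp eK by auto
  have dK: "supp (dil ?e) \<subseteq> ?K" by (rule supp_dil_pcone[OF K eK(1)])
  have pK: "supp p \<subseteq> ?K" and rK: "supp r \<subseteq> ?K" using p r by auto
  define p' where "p' = T \<star> p"
  have p'p: "supp p' \<subseteq> ?K \<inter> pos n" unfolding p'_def by (rule supp_conv_pcone[OF Kp TKp p(1)])
  then have p'K: "supp p' \<subseteq> ?K" by simp
  have p'0: "p' 0 = 1" by (simp add: p'_def conv_0[OF K TK pK] T p)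
  obtain D where D: "supp D \<subseteq> ?K" "dil ?e \<star> D = unit" by (rule conv_inverse[OF K dK dil_0[OF eK(3)]])
  have "T = T \<star> dil ?e \<star> D" by (simp add: D)
  also have "\<dots> = D" using conv_assoc[OF K TK dK D(1)] T by simp
  finally have Te: "dil ?e \<star> T = unit" using D by simp
  have p_eq: "p = dil ?e \<star> p'" unfolding p'_def using conv_assoc[OF K dK TK pK] Te by simp
  have "p' \<star> r = T \<star> p \<star> r" unfolding p'_def by (rule conv_assoc[OF K TK pK rK])
  also have "\<dots> = T \<star> dil ?e \<star> h" by (simp add: h)
  also have "\<dots> = h" using conv_assoc[OF K TK dK h(3)] T by simp
  \<comment> \<open>The unit serves as a middle factor so that the support lemma for three factors
    applies.\<close>
  finally have h_eq: "h = p' \<star> unit \<star> r" by simp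
  have disj: "(p' u = 0 \<or> unit u = (0::rat)) \<and> (p' u = 0 \<or> r u = 0) \<and> (unit u = (0::rat) \<or> r u = 0)" if "u \<noteq> 0" for u
    using that p'p r(1) pos_neg[of u n] by (auto simp: unit_def supp_def)
  have hK': "supp (p' \<star> unit \<star> r) \<subseteq> ?K'" using h(4) unfolding h_eq .
  have unitK: "supp (unit :: (nat \<Rightarrow> int) \<Rightarrow> rat) \<subseteq> ?K" by (simp add: supp_unit pcone_0[OF K])
  have p'K': "supp p' \<subseteq> ?K'"
    by (rule conv3_supports(1)[OF K p'K unitK rK p'0 unit_0 r(2) disj pcone_0[OF K'] pcone_add[OF K'] hK'])
  have rK': "supp r \<subseteq> ?K'"
    by (rule conv3_supports(3)[OF K p'K unitK rK p'0 unit_0 r(2) disj pcone_0[OF K'] pcone_add[OF K'] hK'])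
  have e': "- ?e \<in> ?K'" using cone_c_mem[OF b' k(1)] by (simp add: mut_basis_def)
  have d': "supp (dil (- ?e)) \<subseteq> ?K'" by (rule supp_dil_pcone[OF K' e'])
  have dn: "supp (dil (- ?e)) \<subseteq> neg n" by (rule supp_dil) (use neg_closed pos_uminus[OF k(2)] in auto)
  have "supp (r \<star> dil (- ?e)) \<subseteq> ?K'" by (rule supp_conv_pcone[OF K' rK' d'])
  moreover have "supp (r \<star> dil (- ?e)) \<subseteq> neg n" by (rule supp_conv) (use r dn neg_closed in auto)
  moreover have "(r \<star> dil (- ?e)) 0 = 1" using r eK(3) by (simp add: conv_0[OF K' rK' d'] dil_0)
  moreover have "h \<star> dil (- ?e) = p' \<star> r \<star> dil (- ?e)"
    unfolding h_eq by (simp add: conv_assoc[OF K' p'K' rK' d'])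
  ultimately have "green_state n (mut_basis k c) (mut_coord n k c X) p' (r \<star> dil (- ?e))"
    unfolding green_state_def using b' DT' p'K' p'p p'0 by auto
  with p_eq p'K show ?thesis by (rule that)
qed

section \<open>Coefficients at basis vectors and sign coherence\<close>

lemma conv_simple:
  assumes b: "basis n c X" and f: "supp f \<subseteq> cone n X" and q: "supp q \<subseteq> cone n X" and i: "i < n"
  shows "(f \<star> q) (c i) = f (c i) * q 0 + f 0 * q (c i)"
proof -
  have "{a \<in> cone n X. c i - a \<in> cone n X} - {0, c i} = {}"
  proof -
    have "a = 0 \<or> a = c i" if "a \<in> cone n X" "c i - a \<in> cone n X" for a
      using cone_indec[OF b i that] by auto
    then show ?thesis by blast
  qed
  then show ?thesis
    using conv_top[OF cone_pcone[OF b] f q cone_c_mem[OF b i] basis_c_nonzero[OF b i]]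
    by (simp only: sum.empty add_0_right)
qed

text \<open>Basis vectors are indecomposable in their cone, so the product splits there; 2 / 3 is
  the linear dilogarithm coefficient \<open>1 / (2 - 1/2)\<close>. As it is nonzero,
  \<open>p\<close> or \<open>r\<close> must be nonzero at \<open>c i\<close>, which fixes a
  sign.\<close>

lemma green_coeff:
  assumes st: "green_state n c X p r" and i: "i < n"
  shows "p (c i) + r (c i) = 2 / 3"
proof -
  have b: "basis n c X" and DT: "is_DT n c X (p \<star> r)" and p: "supp p \<subseteq> cone n X" "p 0 = 1"
    and r: "supp r \<subseteq> cone n X" "r 0 = 1"
    using st by (auto simp: green_state_def)
  have "(p \<star> r) (sm (int 1) (c i)) = qdil 1" using DT i unfolding is_DT_def by blast
  then show ?thesis using conv_simple[OF b p(1) r(1) i] p r by simp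
qed

lemma sign_coherence:
  assumes st: "green_state n c X p r" and i: "i < n"
  shows "c i \<in> pos n \<or> c i \<in> neg n"
proof -
  have "p (c i) \<noteq> 0 \<or> r (c i) \<noteq> 0" using green_coeff[OF st i] by auto
  moreover have "supp p \<subseteq> pos n" "supp r \<subseteq> neg n" using st by (auto simp: green_state_def)
  ultimately show ?thesis by (auto simp: supp_def)
qed

lemma green_coeff_pos:
  assumes st: "green_state n c X p r" and i: "i < n" "c i \<in> pos n"
  shows "p (c i) = 2 / 3"
proof -
  have "basis n c X" "supp r \<subseteq> neg n" using st by (auto simp: green_state_def)
  then have "r (c i) = 0" using i pos_neg[of "c i" n] basis_c_nonzero by (auto simp: supp_def)
  then show ?thesis using green_coeff[OF st i(1)] by simp
qed

section \<open>Factorisation of \<open>p\<close> along a maximal green sequence\<close>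

fun green_run :: "nat \<Rightarrow> (nat \<Rightarrow> nat \<Rightarrow> int) \<Rightarrow> nat list \<Rightarrow> bool" where
  "green_run n c [] \<longleftrightarrow> (\<forall>i<n. c i \<notin> pos n)"
| "green_run n c (k # ks) \<longleftrightarrow> k < n \<and> c k \<in> pos n \<and> green_run n (mut_basis k c) ks"

fun dils :: "(nat \<Rightarrow> int) list \<Rightarrow> (nat \<Rightarrow> int) \<Rightarrow> rat" where
  "dils [] = unit"
| "dils (a # as) = dil a \<star> dils as"

lemma supp_dils: "pcone K \<Longrightarrow> set as \<subseteq> K \<Longrightarrow> supp (dils as) \<subseteq> K"
  by (induction as) (simp_all add: supp_unit pcone_0 supp_conv_pcone supp_dil_pcone)

lemma dils_0: "pcone K \<Longrightarrow> set as \<subseteq> K - {0} \<Longrightarrow> dils as 0 = 1"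
proof (induction as)
  case (Cons a as)
  then have "a \<in> K" "set as \<subseteq> K" by auto
  then have "supp (dil a) \<subseteq> K" "supp (dils as) \<subseteq> K" using Cons by (simp_all add: supp_dil_pcone supp_dils)
  then show ?case using Cons by (simp add: conv_0[of K] dil_0)
qed simp

text \<open>When all basis vectors are nonpositive, their cone meets the nonnegative vectors only in
  0.\<close>

lemma green_end:
  assumes st: "green_state n c X p r" and red: "\<forall>i<n. c i \<notin> pos n"
  shows "p = unit"
proof -
  have b: "basis n c X" and p: "supp p \<subseteq> cone n X \<inter> pos n" "p 0 = 1" using st by (auto simp: green_state_def)
  have "v = 0" if "v \<in> cone n X" "v \<in> pos n" for v
  proof -
    have L: "v \<in> lattice n" and X: "X j v \<ge> 0" if "j < n" for j using \<open>v \<in> cone n X\<close> that by (auto simp: cone_def)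
    have negs: "(\<Sum>j\<in>J. sm (X j v) (c j)) \<in> neg n" if "J \<subseteq> {..<n}" for J
      using that
    proof (induction J rule: infinite_finite_induct)
      case (insert j J)
      then have "c j \<in> neg n" "X j v \<ge> 0" using sign_coherence[OF st, of j] red X by auto
      then have "sm (X j v) (c j) \<in> neg n" by (auto simp: neg_def lattice_sm sm_apply mult_nonneg_nonpos)
      then show ?case using insert by (simp add: neg_closed)
    qed (auto simp: neg_closed)
    have "v \<in> lattice n" using that by (simp add: cone_def)
    from basis_expand[OF b this] negs[of "{..<n}"] have "v \<in> neg n" by simp
    then show "v = 0" using that pos_neg by blast
  qed
  then have z: "p v = 0" if "v \<noteq> 0" for v using that suppD[OF p(1), of v] by auto
  show ?thesis
  proof
    fix v show "p v = unit v" using z[of v] p(2) by (cases "v = 0") (simp_all add: unit_def)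
  qed
qed

text \<open>\<open>P\<close> stays fixed while the seed changes: \<open>p\<close> has the
  coefficient 2 / 3 at the vector mutated next, so this vector lies in \<open>P\<close>, and
  dividing by its dilogarithm keeps the support in \<open>P\<close>. With the cone of one seed as
  \<open>P\<close>, all vectors mutated later are located in that cone.\<close>

lemma green_product:
  assumes "green_run n c ks" "green_state n c X p r" "pcone P" "supp p \<subseteq> P"
  shows "\<exists>as. p = dils as \<and> set as \<subseteq> P - {0}"
  using assms
proof (induction ks arbitrary: c X p r)
  case Nil
  then show ?case using green_end[OF Nil(2)] by (intro exI[of _ "[]"]) simp
next
  case (Cons k ks)
  then have k: "k < n" "c k \<in> pos n" by auto
  have b: "basis n c X" and p: "supp p \<subseteq> cone n X" using Cons.prems(2) by (auto simp: green_state_def)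
  note K = cone_pcone[OF b]
  obtain p' where p': "p = dil (c k) \<star> p'" "supp p' \<subseteq> cone n X"
    "green_state n (mut_basis k c) (mut_coord n k c X) p' (r \<star> dil (- c k))"
    by (rule green_step[OF Cons.prems(2) k])
  have e: "c k \<in> cone n X" "c k \<noteq> 0" using k by (simp_all add: cone_c_mem[OF b] basis_c_nonzero[OF b])
  have "p (c k) \<noteq> 0" using green_coeff_pos[OF Cons.prems(2) k] by simp
  then have eP: "c k \<in> P" using Cons.prems(4) by (auto simp: supp_def)
  obtain T where T: "\<forall>P. pcone P \<longrightarrow> c k \<in> P \<longrightarrow> supp T \<subseteq> P" "T 0 = 1" "T \<star> dil (c k) = unit"
    by (rule dil_inverse[OF K e])
  have "p' = T \<star> p"
    unfolding p'(1) using conv_assoc[OF K T(1)[rule_format, OF K e(1)] supp_dil_pcone[OF K e(1)] p'(2)] T(3) by simp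
  then have "supp p' \<subseteq> P"
    using supp_conv_pcone[OF Cons.prems(3) T(1)[rule_format, OF Cons.prems(3) eP] Cons.prems(4)] by simp
  then obtain as where "p' = dils as" "set as \<subseteq> P - {0}"
    using Cons.IH[OF _ p'(3) Cons.prems(3)] Cons.prems(1) by auto
  then show ?case using eP e(2) p'(1) by (intro exI[of _ "c k # as"]) simp
qed

section \<open>Coefficients at sums of two basis vectors\<close>

lemma pow_relation_false:
  assumes "m \<ge> 2" and "4 / 9 * 2 powi m = (2 / 3) * of_nat N + 4 / 9 * (2 powi - m :: rat)"
  shows False
proof -
  define l where "l = nat (m - 2)"
  have m: "m = int (Suc (Suc l))" using assms(1) by (simp add: l_def)
  \<comment> \<open>The relation multiplied by \<open>9 / 2 * 2 powi m\<close>. Since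
    \<open>m \<ge> 2\<close>, the powers of 2 are divisible by 4, and the summand 2 remains modulo
    4.\<close>
  have "(2::rat) ^ Suc (Suc l) * 2 ^ Suc (Suc l) * 2 = 3 * of_nat N * 2 ^ Suc (Suc l) + 2"
    using assms(2) unfolding m by (simp add: power_int_minus field_simps del: of_nat_Suc power_Suc)
  then have "of_nat (2 ^ Suc (Suc l) * 2 ^ Suc (Suc l) * 2) = (of_nat (3 * N * 2 ^ Suc (Suc l) + 2) :: rat)"
    by simp
  then have "2 ^ Suc (Suc l) * 2 ^ Suc (Suc l) * 2 = 3 * N * 2 ^ Suc (Suc l) + (2::nat)"
    by (simp only: of_nat_eq_iff)
  then have "4 * (2 * (2 ^ l * 2 ^ Suc (Suc l))) = 4 * (3 * N * 2 ^ l) + (2::nat)" by simp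
  moreover have "4 * x \<noteq> 4 * y + (2::nat)" for x y by presburger
  ultimately show False by blast
qed

lemma conv_pair:
  assumes b: "basis n c X" and f: "supp f \<subseteq> cone n X" and q: "supp q \<subseteq> cone n X" and ij: "i < n" "j < n" "i \<noteq> j"
  shows "(f \<star> q) (c i + c j) = f (c i + c j) * q 0 + f 0 * q (c i + c j)
    + 2 powi w (c i) (c j) * f (c i) * q (c j) + 2 powi w (c j) (c i) * f (c j) * q (c i)"
proof -
  let ?v = "c i + c j"
  note K = cone_pcone[OF b]
  have ci: "c i \<in> cone n X" "c j \<in> cone n X" and ne: "c i \<noteq> 0" "c j \<noteq> 0"
    using ij by (auto simp: cone_c_mem[OF b] basis_c_nonzero[OF b])
  have cij: "c i \<noteq> c j" using ij basis_c[OF b, of i i] basis_c[OF b, of i j] by auto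
  have v: "?v \<in> cone n X" "?v \<noteq> 0"
    using pcone_add[OF K ci] pcone_pointed[OF K ci(1)] ci ne by (auto simp: add_eq_0_iff)
  have "{a \<in> cone n X. ?v - a \<in> cone n X} - {0, ?v} = {c i, c j}"
    using cone_pair[OF b ij] ci ne by auto
  then show ?thesis
    using conv_top[OF K f q v] cij by (simp add: w_add_right)
qed

text \<open>The coordinate \<open>X i\<close> is 1 at both vectors, so a dilogarithm contributes
  there only through its linear coefficient. If \<open>c i\<close> does not occur, the mixed terms
  vanish and the coefficient counts occurrences; if it occurs, nonnegativity of all contributions
  excludes cancellation.\<close>

lemma dils_coeffs:
  assumes b: "basis n c X" and ij: "i < n" "j < n" "i \<noteq> j" and as: "set as \<subseteq> cone n X - {0}"
  shows "c i \<notin> set as \<Longrightarrow> dils as (c i) = 0 \<and> dils as (c i + c j) = (2 / 3) * of_nat (count_list as (c i + c j))"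
    and "c i \<in> set as \<Longrightarrow> dils as (c i) > 0"
proof -
  note K = cone_pcone[OF b]
  have ndil: "dil a v \<ge> 0" if "a \<noteq> 0" for a v
    using dil_nonzeroD[of a v] dil_sm[OF that] qdil_pos by (cases "dil a v = 0") (auto intro: less_imp_le)
  have d: "dil a v = (if a = v then 2 / 3 else 0)" if "a \<in> cone n X - {0}" "X i v = 1" for a v
  proof (cases "a = v")
    case True
    then show ?thesis using that by (simp add: dil_self)
  next
    case False
    have "dil a v = 0"
    proof (rule ccontr)
      assume "dil a v \<noteq> 0"
      then obtain m where m: "v = sm (int m) a" using dil_nonzeroD by blast
      then have "int m * X i a = 1" using that(2) basis_sm[OF b ij(1)] by simp
      then have "m = 1" by (simp add: zmult_eq_1_iff)
      then show False using m False by simp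
    qed
    then show ?thesis using False by simp
  qed
  have Xi: "X i (c i) = 1" "X i (c i + c j) = 1" using ij by (simp_all add: basis_add[OF b] basis_c[OF b])
  have dj: "c i \<notin> set as \<Longrightarrow> dils as (c i) = 0 \<and> dils as (c i + c j) = (2 / 3) * of_nat (count_list as (c i + c j))"
    if "set as \<subseteq> cone n X - {0}" for as
    using that
  proof (induction as)
    case Nil
    have "c i \<noteq> 0" "c i + c j \<noteq> 0" using Xi basis_0[OF b ij(1)] by auto
    then show ?case by (simp add: unit_def)
  next
    case (Cons a as)
    have s: "supp (dil a) \<subseteq> cone n X" "supp (dils as) \<subseteq> cone n X"
      using Cons.prems supp_dil_pcone[OF K, of a] supp_dils[OF K, of as] by auto
    have 0: "dil a 0 = 1" "dils as 0 = 1" using Cons.prems by (auto simp: dil_0 intro!: dils_0[OF K])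
    have a: "a \<in> cone n X - {0}" using Cons.prems by simp
    have "a \<noteq> c i" using Cons.prems by auto
    then have dai: "dil a (c i) = 0" using d[OF a Xi(1)] by simp
    have IH: "dils as (c i) = 0" "dils as (c i + c j) = (2 / 3) * of_nat (count_list as (c i + c j))"
      using Cons by auto
    show ?case
      using conv_simple[OF b s ij(1)] conv_pair[OF b s ij] d[OF a Xi(2)] dai IH 0
      by (simp add: algebra_simps)
  qed
  show "c i \<notin> set as \<Longrightarrow> dils as (c i) = 0 \<and> dils as (c i + c j) = (2 / 3) * of_nat (count_list as (c i + c j))"
    using dj[OF as] .
  show "dils as (c i) > 0" if "c i \<in> set as"
    using as that
  proof (induction as)
    case (Cons a as)
    have s: "supp (dil a) \<subseteq> cone n X" "supp (dils as) \<subseteq> cone n X"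
      using Cons.prems supp_dil_pcone[OF K, of a] supp_dils[OF K, of as] by auto
    have 0: "dil a 0 = 1" "dils as 0 = 1" using Cons.prems by (auto simp: dil_0 intro!: dils_0[OF K])
    have a: "a \<in> cone n X - {0}" using Cons.prems by simp
    have "dils as (c i) \<ge> 0" using dj[of as] Cons by (cases "c i \<in> set as") (auto intro: less_imp_le)
    moreover have "a = c i \<or> dils as (c i) > 0" using Cons by auto
    moreover have "dil a (c i) \<ge> 0" using a by (intro ndil) simp
    ultimately show ?case
      using conv_simple[OF b s ij(1)] d[OF a Xi(1)] 0 by (auto split: if_splits)
  qed simp
qed

text \<open>Against the sum \<open>c j\<close> is positive and \<open>c i\<close> negative, so
  \<open>A\<close> carries the value 2 / 3 at \<open>c j\<close> and \<open>C\<close> that at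
  \<open>c i\<close>, while the attractor condition kills \<open>B\<close> at the sum. Only the
  product of \<open>c j\<close> before \<open>c i\<close> survives, which gives the twist.\<close>

lemma DT_coeff_pair:
  assumes b: "basis n c X" and DT: "is_DT n c X g" and ij: "i < n" "j < n" and m: "w (c j) (c i) > 0"
  shows "g (c i + c j) = 4 / 9 * 2 powi w (c j) (c i)"
proof -
  let ?K = "cone n X" and ?v = "c i + c j"
  note K = cone_pcone[OF b]
  have ij': "i \<noteq> j" using m by auto
  have vK: "?v \<in> ?K" using pcone_add[OF K] cone_c_mem[OF b] ij by simp
  have Xv: "X l ?v = (if l = i \<or> l = j then 1 else 0)" if "l < n" for l
    using that ij ij' by (auto simp: basis_add[OF b] basis_c[OF b])
  have v0: "?v \<noteq> 0" using Xv[OF ij(1)] basis_0[OF b ij(1)] by auto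
  have nm: "?v \<noteq> sm (int a) (c l)" if "l < n" for l a
  proof
    assume eq: "?v = sm (int a) (c l)"
    have "X i ?v = (if i = l then int a else 0)" "X j ?v = (if j = l then int a else 0)"
      unfolding eq using that ij by (auto simp: basis_sm[OF b] basis_c[OF b])
    then show False using Xv ij ij' by (auto split: if_splits)
  qed
  have "attr ?K g ?v" using DT vK v0 nm unfolding is_DT_def by blast
  then obtain A B C \<delta> \<omega> where f: "fact ?K ?v A B C" and gABC: "g = A \<star> B \<star> C" and l: "log_deriv \<delta> ?K ?v B \<omega>" and \<omega>: "\<omega> ?v = 0"
    and \<delta>: "\<And>a b. \<delta> (a + b) = \<delta> a + \<delta> b" "\<delta> ?v \<noteq> 0"
    unfolding attr_def attractor_coeff_def by blast
  note s = fact_supp[OF f] and o = fact_0[OF f]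
  have wi: "w (c i) ?v < 0" "w (c j) ?v > 0" using m w_skew[of "c i" "c j"] by (simp_all add: w_add_right)
  have ne: "c i \<noteq> 0" "c j \<noteq> 0" using ij by (simp_all add: basis_c_nonzero[OF b])
  have z: "A (c i) = 0" "A ?v = 0" "B (c i) = 0" "B (c j) = 0" "C (c j) = 0" "C ?v = 0" "\<omega> (c i) = 0" "\<omega> (c j) = 0"
    using f l wi ne v0 unfolding fact_def log_deriv_def supp_def by (auto simp: order.strict_iff_order)
  have dB: "deriv_by \<delta> B = \<omega> \<star> B" and sw: "supp \<omega> \<subseteq> ?K" using l by (auto simp: log_deriv_def)
  have "\<delta> 0 = 0" using \<delta>(1)[of 0 0] by simp
  then have "\<omega> 0 = 0" using fun_cong[OF dB, of 0] o by (simp add: conv_0[OF K sw s(2)] deriv_by_def)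
  then have "of_int (\<delta> ?v) * B ?v = 0"
    using fun_cong[OF dB, of ?v] conv_pair[OF b sw s(2) ij ij'] z \<omega> by (simp add: deriv_by_def)
  then have Bv: "B ?v = 0" using \<delta>(2) by simp
  note BC = supp_conv_pcone[OF K s(2,3)]
  have 0: "(B \<star> C) 0 = 1" using o by (simp add: conv_0[OF K s(2,3)])
  have BCi: "(B \<star> C) (c i) = C (c i)" "(B \<star> C) (c j) = 0"
    using conv_simple[OF b s(2,3) ij(1)] conv_simple[OF b s(2,3) ij(2)] z o by simp_all
  have BCv: "(B \<star> C) ?v = 0" using conv_pair[OF b s(2,3) ij ij'] z o Bv by simp
  have val: "g (c l) = 2 / 3" if "l < n" for l
  proof -
    have "g (sm (int 1) (c l)) = qdil 1" using DT that unfolding is_DT_def by blast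
    then show ?thesis by simp
  qed
  have AC: "A (c j) = 2 / 3" "C (c i) = 2 / 3"
    using val[OF ij(2)] val[OF ij(1)] conv_simple[OF b s(1) BC ij(1)] conv_simple[OF b s(1) BC ij(2)] z o 0 BCi
    unfolding gABC by simp_all
  show ?thesis unfolding gABC conv_pair[OF b s(1) BC ij ij'] BCi BCv AC z o 0 by simp
qed

text \<open>Mutating first at the head of a multiple arrow between two green vertices would force the
  quantum integer with value \<open>(2\<^sup>m - 2\<^sup>-\<^sup>m) / (2 - 1/2)\<close> to be a multiplicity, but it is not an
  integer for \<open>m \<ge> 2\<close>.\<close>

lemma no_bad_mutation:
  assumes st: "green_state n c X p r" and run: "green_run n c (k # ks)"
    and j: "j < n" "c j \<in> pos n" and m: "w (c j) (c k) \<ge> 2"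
  shows False
proof -
  have b: "basis n c X" and DT: "is_DT n c X (p \<star> r)" and p: "supp p \<subseteq> cone n X" "p 0 = 1"
    and r: "supp r \<subseteq> cone n X" "supp r \<subseteq> neg n" "r 0 = 1"
    using st by (auto simp: green_state_def)
  have k: "k < n" "c k \<in> pos n" using run by auto
  have kj: "k \<noteq> j" using m by auto
  note K = cone_pcone[OF b]
  let ?v = "c k + c j"
  obtain p' where p': "p = dil (c k) \<star> p'" "supp p' \<subseteq> cone n X"
    "green_state n (mut_basis k c) (mut_coord n k c X) p' (r \<star> dil (- c k))"
    by (rule green_step[OF st k])
  obtain as where as: "p' = dils as" "set as \<subseteq> cone n X - {0}"
    using green_product[OF _ p'(3) K p'(2)] run by auto
  have ck: "c k \<noteq> 0" "c k \<in> cone n X" using k by (simp_all add: basis_c_nonzero[OF b] cone_c_mem[OF b])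
  note d = supp_dil_pcone[OF K ck(2)]
  have p'0: "p' 0 = 1" using p'(3) by (simp add: green_state_def)
  have dz: "dil (c k) v = 0" if "X j v = 1" for v
  proof (rule ccontr)
    assume "dil (c k) v \<noteq> 0"
    then obtain m where "v = sm (int m) (c k)" using dil_nonzeroD by blast
    then show False using that k j kj by (simp add: basis_sm[OF b] basis_c[OF b])
  qed
  have Xj: "X j (c j) = 1" "X j ?v = 1" using k j kj by (simp_all add: basis_add[OF b] basis_c[OF b])
  have rz: "r (c k) = 0" "r (c j) = 0" "r ?v = 0"
  proof -
    have "u \<in> pos n \<Longrightarrow> u \<noteq> 0 \<Longrightarrow> r u = 0" for u using r(2) pos_neg[of u n] by (auto simp: supp_def)
    moreover have "c j \<noteq> 0" "?v \<noteq> 0" using Xj basis_0[OF b j(1)] by auto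
    ultimately show "r (c k) = 0" "r (c j) = 0" "r ?v = 0" using k j ck pos_closed by auto
  qed
  have "p (c k) = 2 / 3" "p (c j) = 2 / 3" using green_coeff_pos[OF st] k j by auto
  then have pk: "p' (c k) = 0" and pj: "p' (c j) = 2 / 3"
    using conv_simple[OF b d p'(2) k(1)] conv_simple[OF b d p'(2) j(1)] dil_0[OF ck(1)] dil_self[OF ck(1)] p'0 dz[OF Xj(1)]
    unfolding p'(1) by simp_all
  \<comment> \<open>The dilogarithm split off accounts for the whole coefficient of \<open>p\<close>
    at \<open>c k\<close>, so \<open>p'\<close> vanishes there. By positivity \<open>c k\<close> is
    not in \<open>as\<close>, and the coefficient is a pure count.\<close>
  have "p' ?v = (2 / 3) * of_nat (count_list as ?v)"
    using dils_coeffs[OF b k(1) j(1) kj as(2)] pk unfolding as(1) by fastforce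
  \<comment> \<open>Here \<open>c k\<close> stands before \<open>c j\<close>, so the exponent is
    opposite to the one dictated by the attractor condition.\<close>
  then have "p ?v = (2 / 3) * of_nat (count_list as ?v) + 2 powi w (c k) (c j) * (2 / 3) * (2 / 3)"
    unfolding p'(1) using conv_pair[OF b d p'(2) k(1) j(1) kj] dz Xj pk pj dil_0[OF ck(1)] dil_self[OF ck(1)] p'0 by simp
  moreover have "(p \<star> r) ?v = p ?v" using conv_pair[OF b p(1) r(1) k(1) j(1) kj] rz r p by simp
  moreover have "(p \<star> r) ?v = 4 / 9 * 2 powi w (c j) (c k)"
    by (rule DT_coeff_pair[OF b DT k(1) j(1)]) (use m in simp)
  ultimately show False
    using pow_relation_false[OF m, of "count_list as ?v"] w_skew[of "c k" "c j"] by simp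
qed

end

section \<open>Mutation of matrices\<close>

text \<open>Columns of \<open>cmat\<close> with the opposite sign, so that green vertices have nonnegative vectors.\<close>

definition cvec :: "nat \<Rightarrow> (nat \<Rightarrow> nat \<Rightarrow> int) \<Rightarrow> nat \<Rightarrow> nat \<Rightarrow> int" where
  "cvec n M j = (\<lambda>i. if i < n then - M (n + i) j else 0)"

definition arrow_form :: "nat \<Rightarrow> (nat \<Rightarrow> nat \<Rightarrow> int) \<Rightarrow> (nat \<Rightarrow> int) \<Rightarrow> (nat \<Rightarrow> int) \<Rightarrow> int" where
  "arrow_form n B a b = (\<Sum>i<n. \<Sum>j<n. B i j * a i * b j)"

lemma arrow_form_int_form:
  assumes "cluster_quiver n B" shows "int_form (arrow_form n B)"
proof
  show "arrow_form n B (a + b) d = arrow_form n B a d + arrow_form n B b d" for a b d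
    by (simp add: arrow_form_def plus_fun_apply algebra_simps sum.distrib)
  show "arrow_form n B a b = - arrow_form n B b a" for a b
  proof -
    have "arrow_form n B a b = (\<Sum>j<n. \<Sum>i<n. B i j * a i * b j)"
      unfolding arrow_form_def by (rule sum.swap)
    also have "\<dots> = (\<Sum>j<n. \<Sum>i<n. - (B j i * b j * a i))"
    proof (intro sum.cong refl)
      fix i j assume "i \<in> {..<n}" "j \<in> {..<n}"
      then have "B i j = - B j i" using assms unfolding cluster_quiver_def by blast
      then show "B i j * a i * b j = - (B j i * b j * a i)" by simp
    qed
    finally show ?thesis by (simp add: arrow_form_def sum_negf)
  qed
qed

text \<open>The recursion starts from an arbitrary matrix, as inductions along a sequence
  require.\<close>

fun green_list :: "nat \<Rightarrow> (nat \<Rightarrow> nat \<Rightarrow> int) \<Rightarrow> nat list \<Rightarrow> bool" where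
  "green_list n M [] \<longleftrightarrow> (\<forall>j<n. \<not> green n M j)"
| "green_list n M (k # ks) \<longleftrightarrow> green n M k \<and> green_list n (mut k M) ks"

lemma green_list_iff:
  "green_list n M ks \<longleftrightarrow> (\<forall>t < length ks. green n (mutseq (take t ks) M) (ks ! t)) \<and> (\<forall>j<n. \<not> green n (mutseq ks M) j)"
proof (induction ks arbitrary: M)
  case (Cons k ks)
  show ?case by (simp add: Cons less_Suc_eq_0_disj all_simps ex_simps conj_assoc) (auto simp: less_Suc_eq_0_disj)
qed simp

section \<open>Seeds given by matrices, and comparison with the split quiver\<close>

context int_form
begin

definition represents :: "nat \<Rightarrow> (nat \<Rightarrow> nat \<Rightarrow> int) \<Rightarrow> (nat \<Rightarrow> nat \<Rightarrow> int) \<Rightarrow> bool" where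
  "represents n c M \<longleftrightarrow> (\<forall>j<n. c j = cvec n M j) \<and> (\<forall>i<n. \<forall>j<n. M i j = w (c i) (c j))"

lemma represents_green: "represents n c M \<Longrightarrow> green n M k \<longleftrightarrow> k < n \<and> c k \<in> pos n"
  by (auto simp: represents_def green_def pos_def cvec_def lattice_def)

lemma represents_mut:
  assumes R: "represents n c M" and g: "green n M k"
  shows "represents n (mut_basis k c) (mut k M)"
proof -
  have k: "k < n" and neg: "\<And>i. i < n \<Longrightarrow> M (n + i) k \<le> 0" using g by (auto simp: green_def)
  have c: "\<And>j. j < n \<Longrightarrow> c j = cvec n M j" and M: "\<And>i j. i < n \<Longrightarrow> j < n \<Longrightarrow> M i j = w (c i) (c j)"
    using R by (auto simp: represents_def)
  have "mut_basis k c j = cvec n (mut k M) j" if j: "j < n" for j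
  proof
    fix i
    show "mut_basis k c j i = cvec n (mut k M) j i"
    proof (cases "i < n")
      case True
      have w: "w (c j) (c k) = M j k" "- M k j = M j k" using M j k w_skew[of "c k" "c j"] by simp_all
      have ci: "c j i = - M (n + i) j" "c k i = - M (n + i) k" using c j k True by (simp_all add: cvec_def)
      have "max (M (n + i) k) 0 = 0" "max (- M (n + i) k) 0 = - M (n + i) k" using neg[OF True] by auto
      then show ?thesis using True k
        by (simp add: mut_basis_def cvec_def mut_def plus_fun_apply sm_apply w ci)
    next
      case False
      then show ?thesis using c[OF j] c[OF k] by (simp add: mut_basis_def cvec_def plus_fun_apply sm_apply)
    qed
  qed
  moreover have "mut k M i j = w (mut_basis k c i) (mut_basis k c j)" if ij: "i < n" "j < n" for i j
  proof -
    have "max x 0 * max (- y) 0 - max (- x) 0 * max y 0 = max y 0 * x - max x 0 * y" for x y :: int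
      by (auto simp: max_def)
    then show ?thesis
      using ij k M w_skew[of "c k" "c j"]
      by (auto simp: mut_def mut_basis_def w_minus_left w_minus_right w_add_left w_add_right w_sm_left w_sm_right)
  qed
  ultimately show ?thesis by (simp add: represents_def)
qed

lemma green_list_run: "represents n c M \<Longrightarrow> green_list n M ks \<Longrightarrow> green_run n c ks"
proof (induction ks arbitrary: c M)
  case Nil
  then show ?case by (auto simp: represents_green)
next
  case (Cons k ks)
  then show ?case using represents_green[of n c M k] represents_mut[of n c M k] by auto
qed

text \<open>Divisibility belongs to the invariant since it is used anew at every mutation. The
  vanishing frozen entries say that each \<open>c\<close>-vector stays in its own part, so that
  vectors of different parts have disjoint supports.\<close>

definition split_rel :: "int \<Rightarrow> nat \<Rightarrow> nat set \<Rightarrow> (nat \<Rightarrow> nat \<Rightarrow> int) \<Rightarrow> (nat \<Rightarrow> nat \<Rightarrow> int) \<Rightarrow> bool" where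
  "split_rel d n Qt M Ms \<longleftrightarrow> (\<forall>i<n. \<forall>j<n.
     Ms (n + i) j = M (n + i) j \<and>
     (if (i \<in> Qt) = (j \<in> Qt) then Ms i j = M i j else Ms i j = 0 \<and> M (n + i) j = 0 \<and> d dvd M i j))"

lemma no_mixing:
  assumes st: "green_state n c X p r" and R: "represents n c M" and gl: "green_list n M (k # ks)"
    and S: "split_rel d n Qt M Ms" and d: "d > 1" and j: "j < n" "(j \<in> Qt) \<noteq> (k \<in> Qt)"
  shows "M j k \<le> 0"
proof (rule ccontr)
  assume "\<not> M j k \<le> 0"
  then have Mp: "M j k > 0" by simp
  have run: "green_run n c (k # ks)" by (rule green_list_run[OF R gl])
  then have k: "k < n" "c k \<in> pos n" by auto
  have b: "basis n c X" using st by (simp add: green_state_def)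
  have "d dvd M j k" using S j k by (auto simp: split_rel_def)
  then have "M j k \<ge> 2" using Mp d zdvd_imp_le by fastforce
  then have m: "w (c j) (c k) \<ge> 2" using R j k by (simp add: represents_def)
  show False
  proof (cases "c j \<in> pos n")
    case True
    show False by (rule no_bad_mutation[OF st run j(1) True m])
  next
    case False
    then have cj: "c j \<in> neg n" using sign_coherence[OF st j(1)] by blast
    have kj: "j \<noteq> k" using j by auto
    have pure: "c l i = 0" if "l < n" "i < n" "(i \<in> Qt) \<noteq> (l \<in> Qt)" for l i
      using that S R by (auto simp: split_rel_def represents_def cvec_def)
    obtain p' where st': "green_state n (mut_basis k c) (mut_coord n k c X) p' (r \<star> dil (- c k))"
      by (rule green_step[OF st k])
    have c': "mut_basis k c j i = c j i + w (c j) (c k) * c k i" for i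
      using kj m by (simp add: mut_basis_def plus_fun_apply sm_apply)
    have ex: "\<exists>i<n. c l i \<noteq> 0" if "l < n" for l
    proof (rule ccontr)
      assume "\<not> (\<exists>i<n. c l i \<noteq> 0)"
      then have "c l = 0" using basis_lattice[OF b that] by (auto simp: fun_eq_iff lattice_def zero_fun_apply) (metis not_le)
      then show False using basis_c_nonzero[OF b that] by simp
    qed
    \<comment> \<open>By disjointness of supports the new vector keeps both a negative entry of
      \<open>c j\<close> and a positive entry of \<open>c k\<close>.\<close>
    obtain i1 where i1: "i1 < n" "c j i1 \<noteq> 0" using ex[OF j(1)] by blast
    have "(i1 \<in> Qt) = (j \<in> Qt)" using pure[OF j(1) i1(1)] i1(2) by auto
    then have "c k i1 = 0" using pure[OF k(1) i1(1)] j by auto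
    then have "mut_basis k c j i1 < 0" using c' i1 cj by (auto simp: neg_def order.strict_iff_order)
    then have "mut_basis k c j \<notin> pos n" using i1 by (auto simp: pos_def)
    moreover obtain i2 where i2: "i2 < n" "c k i2 \<noteq> 0" using ex[OF k(1)] by blast
    have "(i2 \<in> Qt) = (k \<in> Qt)" using pure[OF k(1) i2(1)] i2(2) by auto
    then have "c j i2 = 0" using pure[OF j(1) i2(1)] j by auto
    moreover have "c k i2 > 0" using i2 k by (auto simp: pos_def order.strict_iff_order)
    ultimately have "mut_basis k c j i2 > 0" using c'[of i2] m by simp
    then have "mut_basis k c j \<notin> neg n" using i2 by (auto simp: neg_def)
    then show False using sign_coherence[OF st' j(1)] \<open>mut_basis k c j \<notin> pos n\<close> by blast
  qed
qed

text \<open>With these signs no path through \<open>k\<close> joins two vertices of the part not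
  containing \<open>k\<close>, or such a vertex and a frozen one. Arrows between the two parts
  change by multiples of \<open>d\<close>.\<close>

lemma split_rel_mut:
  assumes R: "represents n c M" and S: "split_rel d n Qt M Ms" and k: "k < n"
    and nm: "\<And>j. j < n \<Longrightarrow> (j \<in> Qt) \<noteq> (k \<in> Qt) \<Longrightarrow> M j k \<le> 0" and neg: "\<And>i. i < n \<Longrightarrow> M (n + i) k \<le> 0"
  shows "split_rel d n Qt (mut k M) (mut k Ms)"
  unfolding split_rel_def
proof (intro allI impI)
  fix i j assume ij: "i < n" "j < n"
  have skew: "M a b = - M b a" if "a < n" "b < n" for a b
    using that R w_skew[of "c a" "c b"] by (simp add: represents_def)
  have S1: "Ms (n + a) b = M (n + a) b" if "a < n" "b < n" for a b
    using S that by (simp add: split_rel_def)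
  have S2: "Ms a b = M a b" if "a < n" "b < n" "(a \<in> Qt) = (b \<in> Qt)" for a b
    using S that by (auto simp: split_rel_def)
  have S3: "Ms a b = 0" "M (n + a) b = 0" "d dvd M a b" if "a < n" "b < n" "(a \<in> Qt) \<noteq> (b \<in> Qt)" for a b
    using S that by (auto simp: split_rel_def)
  have kj: "M k j \<ge> 0" if "(j \<in> Qt) \<noteq> (k \<in> Qt)" using nm[OF ij(2) that] skew[OF k ij(2)] by simp
  have ik: "M i k \<le> 0" if "(i \<in> Qt) \<noteq> (k \<in> Qt)" using nm[OF ij(1) that] .
  have dmax: "d dvd max x 0" if "d dvd x" for x :: int using that by (auto simp: max_def)
  have A: "mut k Ms (n + i) j = mut k M (n + i) j"
  proof (cases "(j \<in> Qt) = (k \<in> Qt)")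
    case True
    then show ?thesis using S1[OF ij] S1[OF ij(1) k] S2[OF k ij(2)] by (simp add: mut_def)
  next
    case False
    then have "j \<noteq> k" by auto
    then show ?thesis using False S1[OF ij] S1[OF ij(1) k] S3(1)[OF k ij(2)] kj neg[OF ij(1)] k
      by (auto simp: mut_def max_def)
  qed
  show "mut k Ms (n + i) j = mut k M (n + i) j \<and>
     (if (i \<in> Qt) = (j \<in> Qt) then mut k Ms i j = mut k M i j
      else mut k Ms i j = 0 \<and> mut k M (n + i) j = 0 \<and> d dvd mut k M i j)"
  proof (cases "(i \<in> Qt) = (j \<in> Qt)")
    case True
    have "mut k Ms i j = mut k M i j"
    proof (cases "(i \<in> Qt) = (k \<in> Qt)")
      case T: True
      then show ?thesis using True S2[OF ij] S2[OF ij(1) k] S2[OF k ij(2)] by (simp add: mut_def)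
    next
      case False
      then have "(j \<in> Qt) \<noteq> (k \<in> Qt)" "i \<noteq> k" "j \<noteq> k" using True by auto
      then show ?thesis using True False S2[OF ij] S3(1)[OF ij(1) k] S3(1)[OF k ij(2)] ik kj
        by (auto simp: mut_def max_def)
    qed
    then show ?thesis using A True by simp
  next
    case False
    have "Ms i k = 0 \<or> Ms k j = 0" using S3(1)[OF ij(1) k] S3(1)[OF k ij(2)] False by blast
    then have Ms: "mut k Ms i j = 0" using S3(1)[OF ij False] by (auto simp: mut_def)
    have dv: "d dvd mut k M i j"
    proof (cases "(i \<in> Qt) = (k \<in> Qt)")
      case T: True
      then have *: "d dvd M k j" using S3(3)[OF k ij(2)] False by auto
      then have "d dvd max (M k j) 0" "d dvd max (- M k j) 0" by (auto intro!: dmax)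
      then show ?thesis using S3(3)[OF ij False] by (auto simp: mut_def)
    next
      case F: False
      then have *: "d dvd M i k" using S3(3)[OF ij(1) k] by auto
      then have "d dvd max (M i k) 0" "d dvd max (- M i k) 0" by (auto intro!: dmax)
      then show ?thesis using S3(3)[OF ij False] by (auto simp: mut_def)
    qed
    have "mut k M (n + i) j = 0"
    proof (cases "(i \<in> Qt) = (k \<in> Qt)")
      case T: True
      then have "(j \<in> Qt) \<noteq> (k \<in> Qt)" "j \<noteq> k" using False by auto
      then show ?thesis using S3(2)[OF ij False] kj neg[OF ij(1)] k by (auto simp: mut_def max_def)
    next
      case F: False
      then show ?thesis using S3(2)[OF ij False] S3(2)[OF ij(1) k] by (simp add: mut_def)
    qed
    then show ?thesis using A Ms dv False by simp
  qed
qed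

lemma split_mutseq:
  assumes "green_state n c X p r" "represents n c M" "green_list n M ks" "split_rel d n Qt M Ms" "d > 1"
  shows "green_list n Ms ks \<and> (\<forall>t \<le> length ks. \<forall>i<n. \<forall>j<n. mutseq (take t ks) Ms (n + i) j = mutseq (take t ks) M (n + i) j)"
  using assms
proof (induction ks arbitrary: c X p r M Ms)
  case Nil
  then show ?case by (auto simp: split_rel_def green_def)
next
  case (Cons k ks)
  have eq: "Ms (n + i) j = M (n + i) j" if "i < n" "j < n" for i j
    using Cons.prems(4) that by (simp add: split_rel_def)
  have g: "green n M k" using Cons.prems(3) by simp
  then have k: "k < n" "c k \<in> pos n" using represents_green[OF Cons.prems(2)] by auto
  obtain p' where st': "green_state n (mut_basis k c) (mut_coord n k c X) p' (r \<star> dil (- c k))"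
    by (rule green_step[OF Cons.prems(1) k])
  have "split_rel d n Qt (mut k M) (mut k Ms)"
    by (rule split_rel_mut[OF Cons.prems(2,4) k(1)])
      (use no_mixing[OF Cons.prems] g in \<open>auto simp: green_def\<close>)
  from Cons.IH[OF st' represents_mut[OF Cons.prems(2) g] _ this Cons.prems(5)] Cons.prems(3)
  have IH: "green_list n (mut k Ms) ks"
    "\<forall>t \<le> length ks. \<forall>i<n. \<forall>j<n. mutseq (take t ks) (mut k Ms) (n + i) j = mutseq (take t ks) (mut k M) (n + i) j"
    by auto
  have "green n Ms k" using g eq by (simp add: green_def)
  moreover have "mutseq (take t (k # ks)) Ms (n + i) j = mutseq (take t (k # ks)) M (n + i) j"
    if "t \<le> length (k # ks)" "i < n" "j < n" for t i j
    using that IH(2) eq by (cases t) auto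
  ultimately show ?case using IH(1) by simp
qed

text \<open>At the start nothing has been crossed and the cone consists of the nonnegative vectors,
  so the whole series is \<open>p\<close>. The total degree serves as \<open>\<delta>\<close>: it is
  nonzero on the cone away from 0, and it recovers \<open>m\<close> from
  \<open>sm (int m) (c i)\<close>.\<close>

lemma initial_state:
  fixes n :: nat
  defines "c \<equiv> \<lambda>i j. if j = i then 1 else 0"
  shows "\<exists>p. green_state n c (\<lambda>i v. v i) p unit"
proof -
  let ?X = "\<lambda>i v. v i :: int"
  have b: "basis n c ?X"
    by (auto simp: basis_def c_def lattice_def plus_fun_apply fun_eq_iff zero_fun_apply) (meson not_le)
  have K: "pcone (cone n ?X)" by (rule cone_pcone[OF b])
  define \<delta> where "\<delta> v = (\<Sum>i<n. v i)" for v :: "nat \<Rightarrow> int"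
  have \<delta>1: "\<delta> (u + v) = \<delta> u + \<delta> v" for u v by (simp add: \<delta>_def plus_fun_apply sum.distrib)
  have \<delta>2: "\<delta> v \<noteq> 0" if v: "v \<in> cone n ?X" "v \<noteq> 0" for v
  proof
    assume "\<delta> v = 0"
    then have "\<forall>i\<in>{..<n}. v i = 0"
      using v unfolding \<delta>_def by (subst (asm) sum_nonneg_eq_0_iff) (auto simp: cone_def)
    then show False using v basis_inj[OF b, of v] by (auto simp: cone_def)
  qed
  have \<delta>c: "\<delta> (sm (int m) (c i)) = int m" if "i < n" for i m
    using that by (simp add: \<delta>_def sm_apply c_def if_distrib cong: if_cong)
  obtain p where p: "supp p \<subseteq> cone n ?X" "p 0 = 1"
    and val: "\<And>v. v \<in> cone n ?X \<Longrightarrow> v \<noteq> 0 \<Longrightarrow> v \<in> {v. \<exists>i<n. \<exists>m. v = sm (int m) (c i)} \<Longrightarrow> p v = qdil (nat (\<delta> v))"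
    and attr: "\<And>v. v \<in> cone n ?X \<Longrightarrow> v \<noteq> 0 \<Longrightarrow> v \<notin> {v. \<exists>i<n. \<exists>m. v = sm (int m) (c i)} \<Longrightarrow> attr (cone n ?X) p v"
    by (rule attractor_solution[OF K \<delta>1 \<delta>2, where X = "{v. \<exists>i<n. \<exists>m. v = sm (int m) (c i)}" and \<tau> = "\<lambda>v. qdil (nat (\<delta> v))"])
      auto
  have "p (sm (int m) (c i)) = qdil m" if i: "i < n" for i m
  proof (cases "m = 0")
    case False
    then have "sm (int m) (c i) \<noteq> 0" using basis_c_nonzero[OF b i] by (simp add: sm_eq_0_iff)
    moreover have "sm (int m) (c i) \<in> {v. \<exists>i<n. \<exists>m. v = sm (int m) (c i)}" using i by blast
    ultimately show ?thesis using val[OF cone_sm_mem[OF b i]] \<delta>c[OF i, of m] by simp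
  qed (simp add: p)
  then have "is_DT n c ?X p" using p attr unfolding is_DT_def by auto
  moreover have "cone n ?X = pos n" by (simp add: cone_def pos_def)
  ultimately have "green_state n c ?X p unit"
    using b p pcone_0[OF K] by (simp add: green_state_def supp_unit neg_closed)
  then show ?thesis by blast
qed

end

theorem theorem1p4:
  fixes n :: nat and B :: "nat \<Rightarrow> nat \<Rightarrow> int" and k :: int and Qt :: "nat set"
    and ks :: "nat list"
  assumes "cluster_quiver n B"
    and "k > 1"
    and "Qt \<subseteq> {..<n}"
    and "\<forall>i\<in>Qt. \<forall>j\<in>{..<n} - Qt. k dvd B i j \<and> k dvd B j i"
    and "max_green_seq n B ks"
  shows "\<exists>js. length js = length ks \<and> max_green_seq n (split_quiver Qt B) js
           \<and> cmat n (framed n (split_quiver Qt B)) = cmat n (framed n B)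
           \<and> (\<forall>t < length ks. \<forall>i < n.
                 cmat n (mutseq (take t js) (framed n (split_quiver Qt B))) i (js ! t)
               = cmat n (mutseq (take t ks) (framed n B)) i (ks ! t))"
proof -
  interpret int_form "arrow_form n B" by (rule arrow_form_int_form) fact
  define c :: "nat \<Rightarrow> nat \<Rightarrow> int" where "c = (\<lambda>i j. if j = i then 1 else 0)"
  obtain p where st: "green_state n c (\<lambda>i v. v i) p unit"
    using initial_state unfolding c_def by blast
  have "B i j = arrow_form n B (c i) (c j)" if "i < n" "j < n" for i j
  proof -
    have "arrow_form n B (c i) (c j) = (\<Sum>a<n. \<Sum>b<n. if b = j then (if a = i then B a b else 0) else 0)"
      unfolding arrow_form_def c_def by (intro sum.cong) auto
    then show ?thesis using that by simp
  qed
  then have R: "represents n c (framed n B)"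
    by (auto simp: represents_def framed_def cvec_def c_def)
  have gl: "green_list n (framed n B) ks"
    using assms(5) by (simp add: green_list_iff max_green_seq_def)
  have S: "split_rel k n Qt (framed n B) (framed n (split_quiver Qt B))"
    using assms(4) by (auto simp: split_rel_def framed_def split_quiver_def)
  from split_mutseq[OF st R gl S assms(2)]
  have gs: "green_list n (framed n (split_quiver Qt B)) ks"
    and eq: "\<And>t i j. t \<le> length ks \<Longrightarrow> i < n \<Longrightarrow> j < n \<Longrightarrow>
      mutseq (take t ks) (framed n (split_quiver Qt B)) (n + i) j = mutseq (take t ks) (framed n B) (n + i) j"
    by auto
  have "cmat n (framed n (split_quiver Qt B)) = cmat n (framed n B)"
    by (auto simp: cmat_def framed_def fun_eq_iff)
  moreover have "max_green_seq n (split_quiver Qt B) ks"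
    using gs by (simp add: green_list_iff max_green_seq_def)
  moreover have "ks ! t < n" if "t < length ks" for t
    using gl that by (auto simp: green_list_iff green_def)
  ultimately show ?thesis using eq by (intro exI[of _ ks]) (simp add: cmat_def)
qed

end
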